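(* Let $\gamma=(i,j)$ be fixed, with incoming boundary datum $\phi_i$ and test function $\psi_j$. Then $\partial_\eta\mathcal{M}_\gamma$ is Lipschitz continuous: there is a constant $L_\gamma$, depending on $\|\phi_i\|_\infty$ and $\|\psi_j\|_\infty$, such that for all reflection coefficients $\eta_1,\eta_2$, $$\|\partial_\eta\mathcal{M}_\gamma(\eta_1)-\partial_\eta\mathcal{M}_\gamma(\eta_2)\|_2\le L_\gamma\,\|\eta_1-\eta_2\|_2 .$$
   Context: Variables: $x\in[0,1]$, $\mu\in[-1,1]$, $\omega\in(0,\infty)$, $t\in[0,t_{\max}]$. The bracket denotes $\langle f\rangle=\int_{-1}^{1}\int_0^\infty f\,d\omega\,d\mu$; $g^\ast(\omega)=\dfrac{\omega^2e^\omega}{(e^\omega-1)^2}$; $\mathcal{L}g=-\omega g+\dfrac{\omega g^\ast}{\langle\omega g^\ast\rangle}\langle\omega g\rangle$. A reflection coefficient is a function $\eta=\eta(\omega)$ with values between $0$ and $1$. The datum $\phi_i=\phi_i(\mu,\omega,t)$ is given for $\mu>0$, and $\psi_j=\psi_j(t)$. For a reflection coefficient $\eta$, let $g_\eta$ be the solution of the forward problem $\partial_t g+\mu\omega\partial_x g=\mathcal{L}g$ on $x\in[0,1]$ with zero initial condition at $t=0$, $g(x=0,\mu,\omega,t)=\phi_i(\mu,\omega,t)$ for $\mu>0$, and $g(x=1,\mu,\omega,t)=\eta(\omega)g(x=1,-\mu,\omega,t)$ for $\mu<0$. Let $h_\eta$ be the solution of the adjoint problem $\partial_t h+\mu\omega\partial_x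 h=-\mathcal{L}h$ on $x\in[0,1]$ with $h=0$ at $t=t_{\max}$, $h(x=0,\mu,\omega,t)=\psi_j(t)g^\ast(\omega)/\mu$ for $\mu<0$, and $h(x=1,\mu,\omega,t)=\eta(\omega)h(x=1,-\mu,\omega,t)$ for $\mu>0$. The forward map is $\mathcal{M}_\gamma(\eta)=\int_0^{t_{\max}}\frac{\langle\omega g_\eta\rangle(x=0,t)}{\langle\omega g^\ast\rangle}\psi_j(t)\,dt$, and its Fréchet derivative is the function of $\omega$ given by $$\partial_\eta\mathcal{M}_\gamma(\eta)(\omega)=\frac{1}{\langle\omega g^\ast\rangle}\int_0^{t_{\max}}\int_{-1}^0\frac{\mu\,\omega\,h_\eta(x=1,\mu,\omega,t)\,g_\eta(x=1,-\mu,\omega,t)}{g^\ast(\omega)}\,d\mu\,dt .$$ The norm $\|\cdot\|_2$ is the $L^2$ norm in $\omega$, and $\|\cdot\|_\infty$ is the $L^\infty$ norm.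
   Formalization: The datum is also assumed to satisfy |φ_i| ≤ ‖φ_i‖_∞ w(ω) with ωw integrable and square integrable, and L_γ may depend on w and t_max; for merely bounded φ_i the bracket or the L² norm can be infinite. Solutions are mild, with ωg and ωh integrable. *)

theory Defs
  imports "HOL-Analysis.Analysis" "HOL-Probability.Essential_Supremum"
begin

text \<open>
  Phase-space functions are written \<open>g x \<mu> \<omega> t\<close> with \<open>x \<in> [0,1]\<close>, \<open>\<mu> \<in> [-1,1]\<close>,
  \<open>\<omega> > 0\<close>, \<open>t \<in> [0,tmax]\<close>; values outside these ranges are irrelevant.
\<close>

definition bracket :: "(real \<Rightarrow> real \<Rightarrow> real) \<Rightarrow> real"  (\<open>\<langle>_\<rangle>\<close>) where
  "\<langle>f\<rangle> = (LINT \<mu>:{-1..1}|lborel. (LINT \<omega>:{0<..}|lborel. f \<mu> \<omega>))"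

definition gstar :: "real \<Rightarrow> real" where
  "gstar \<omega> = \<omega>\<^sup>2 * exp \<omega> / (exp \<omega> - 1)\<^sup>2"

definition collision :: "(real \<Rightarrow> real \<Rightarrow> real) \<Rightarrow> real \<Rightarrow> real \<Rightarrow> real" where
  "collision f \<mu> \<omega> =
     - \<omega> * f \<mu> \<omega> + \<omega> * gstar \<omega> / \<langle>\<lambda>\<mu> \<omega>. \<omega> * gstar \<omega>\<rangle> * \<langle>\<lambda>\<mu> \<omega>. \<omega> * f \<mu> \<omega>\<rangle>"

text \<open>
  The data are merely essentially bounded (and incompatible with the initial condition at the
  corner \<open>x = t = 0\<close>), so solutions are mild: the equation
  \<open>\<partial>\<^sub>t g + \<mu>\<omega> \<partial>\<^sub>x g = q\<close> is integrated along almost every characteristic line \<open>x = c + \<mu>\<omega>t\<close>.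
  The identity includes the end points of each characteristic in \<open>[0,1] \<times> [0,tmax]\<close>.
  Hence the values of \<open>g\<close> at \<open>x = 0\<close>, \<open>x = 1\<close>, \<open>t = 0\<close> and \<open>t = tmax\<close> are its traces.
  Integrability of \<open>\<omega>g\<close> gives meaning to \<open>\<langle>\<omega>g\<rangle>\<close> for almost every \<open>(x,t)\<close>.
\<close>

definition phase_integrable :: "real \<Rightarrow> (real \<Rightarrow> real \<Rightarrow> real \<Rightarrow> real \<Rightarrow> real) \<Rightarrow> bool" where
  "phase_integrable tmax g \<longleftrightarrow>
     set_integrable lborel ({0..1} \<times> {-1..1} \<times> {0<..} \<times> {0..tmax})
       (\<lambda>(x, \<mu>, \<omega>, t). \<omega> * g x \<mu> \<omega> t)"

definition mild_transport ::
    "real \<Rightarrow> (real \<Rightarrow> real \<Rightarrow> real \<Rightarrow> real \<Rightarrow> real) \<Rightarrow> (real \<Rightarrow> real \<Rightarrow> real \<Rightarrow> real \<Rightarrow> real) \<Rightarrow> bool" where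
  "mild_transport tmax g q \<longleftrightarrow>
     (AE (\<mu>, \<omega>, c) in lborel. \<mu> \<in> {-1..1} \<and> \<omega> > 0 \<longrightarrow>
        (\<forall>t1 t2. 0 \<le> t1 \<and> t1 \<le> t2 \<and> t2 \<le> tmax \<and>
           c + \<mu> * \<omega> * t1 \<in> {0..1} \<and> c + \<mu> * \<omega> * t2 \<in> {0..1} \<longrightarrow>
           set_integrable lborel {t1..t2} (\<lambda>t. q (c + \<mu> * \<omega> * t) \<mu> \<omega> t) \<and>
           g (c + \<mu> * \<omega> * t2) \<mu> \<omega> t2 - g (c + \<mu> * \<omega> * t1) \<mu> \<omega> t1 =
             (LINT t:{t1..t2}|lborel. q (c + \<mu> * \<omega> * t) \<mu> \<omega> t)))"

definition forward_solution ::
    "real \<Rightarrow> (real \<Rightarrow> real \<Rightarrow> real \<Rightarrow> real) \<Rightarrow> (real \<Rightarrow> real) \<Rightarrow>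
     (real \<Rightarrow> real \<Rightarrow> real \<Rightarrow> real \<Rightarrow> real) \<Rightarrow> bool" where
  "forward_solution tmax \<phi> \<eta> g \<longleftrightarrow>
     phase_integrable tmax g \<and>
     mild_transport tmax g (\<lambda>x \<mu> \<omega> t. collision (\<lambda>\<mu> \<omega>. g x \<mu> \<omega> t) \<mu> \<omega>) \<and>
     (AE (x, \<mu>, \<omega>) in lborel. x \<in> {0..1} \<and> \<mu> \<in> {-1..1} \<and> \<omega> > 0 \<longrightarrow> g x \<mu> \<omega> 0 = 0) \<and>
     (AE (\<mu>, \<omega>, t) in lborel. \<mu> \<in> {0<..1} \<and> \<omega> > 0 \<and> t \<in> {0..tmax} \<longrightarrow>
        g 0 \<mu> \<omega> t = \<phi> \<mu> \<omega> t) \<and>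
     (AE (\<mu>, \<omega>, t) in lborel. \<mu> \<in> {-1..<0} \<and> \<omega> > 0 \<and> t \<in> {0..tmax} \<longrightarrow>
        g 1 \<mu> \<omega> t = \<eta> \<omega> * g 1 (- \<mu>) \<omega> t)"

definition adjoint_solution ::
    "real \<Rightarrow> (real \<Rightarrow> real) \<Rightarrow> (real \<Rightarrow> real) \<Rightarrow>
     (real \<Rightarrow> real \<Rightarrow> real \<Rightarrow> real \<Rightarrow> real) \<Rightarrow> bool" where
  "adjoint_solution tmax \<psi> \<eta> h \<longleftrightarrow>
     phase_integrable tmax h \<and>
     mild_transport tmax h (\<lambda>x \<mu> \<omega> t. - collision (\<lambda>\<mu> \<omega>. h x \<mu> \<omega> t) \<mu> \<omega>) \<and>
     (AE (x, \<mu>, \<omega>) in lborel. x \<in> {0..1} \<and> \<mu> \<in> {-1..1} \<and> \<omega> > 0 \<longrightarrow> h x \<mu> \<omega> tmax = 0) \<and>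
     (AE (\<mu>, \<omega>, t) in lborel. \<mu> \<in> {-1..<0} \<and> \<omega> > 0 \<and> t \<in> {0..tmax} \<longrightarrow>
        h 0 \<mu> \<omega> t = \<psi> t * gstar \<omega> / \<mu>) \<and>
     (AE (\<mu>, \<omega>, t) in lborel. \<mu> \<in> {0<..1} \<and> \<omega> > 0 \<and> t \<in> {0..tmax} \<longrightarrow>
        h 1 \<mu> \<omega> t = \<eta> \<omega> * h 1 (- \<mu>) \<omega> t)"

definition reflection_coefficient :: "(real \<Rightarrow> real) \<Rightarrow> bool" where
  "reflection_coefficient \<eta> \<longleftrightarrow>
     \<eta> \<in> borel_measurable (restrict_space lborel {0<..}) \<and> (\<forall>\<omega>>0. 0 \<le> \<eta> \<omega> \<and> \<eta> \<omega> \<le> 1)"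

text \<open>
  The Frechet derivative \<open>\<partial>\<^sub>\<eta> M\<^sub>\<gamma>(\<eta>)\<close> as a function of \<open>\<omega>\<close>, for \<open>g\<close>, \<open>h\<close> the forward and adjoint
  solutions with reflection coefficient \<open>\<eta>\<close>.
\<close>

definition frechet_M ::
    "real \<Rightarrow> (real \<Rightarrow> real \<Rightarrow> real \<Rightarrow> real \<Rightarrow> real) \<Rightarrow>
     (real \<Rightarrow> real \<Rightarrow> real \<Rightarrow> real \<Rightarrow> real) \<Rightarrow> real \<Rightarrow> real" where
  "frechet_M tmax g h \<omega> =
     1 / \<langle>\<lambda>\<mu> \<omega>. \<omega> * gstar \<omega>\<rangle> *
       (LINT t:{0..tmax}|lborel. (LINT \<mu>:{-1..0}|lborel.
          \<mu> * \<omega> * h 1 \<mu> \<omega> t * g 1 (- \<mu>) \<omega> t / gstar \<omega>))"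

text \<open>The norms take values in \<open>[0,\<infinity>]\<close>; they are \<open>\<infinity>\<close> outside \<open>L\<^sup>2\<close> and \<open>L\<^sup>\<infinity>\<close>.\<close>

definition L2_norm :: "(real \<Rightarrow> real) \<Rightarrow> ennreal" where
  "L2_norm f =
     (let I = (\<integral>\<^sup>+\<omega>\<in>{0<..}. ennreal ((f \<omega>)\<^sup>2) \<partial>lborel)
      in if I = \<infinity> then \<infinity> else ennreal (sqrt (enn2real I)))"

definition Linf_norm :: "'a measure \<Rightarrow> ('a \<Rightarrow> real) \<Rightarrow> ennreal" where
  "Linf_norm M f = esssup M (\<lambda>z. ennreal \<bar>f z\<bar>)"

abbreviation inflow_space :: "real \<Rightarrow> (real \<times> real \<times> real) measure" where
  "inflow_space tmax \<equiv> restrict_space lborel ({0<..1} \<times> {0<..} \<times> {0..tmax})"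

abbreviation phi_norm :: "real \<Rightarrow> (real \<Rightarrow> real \<Rightarrow> real \<Rightarrow> real) \<Rightarrow> real" where
  "phi_norm tmax \<phi> \<equiv> enn2real (Linf_norm (inflow_space tmax) (\<lambda>(\<mu>, \<omega>, t). \<phi> \<mu> \<omega> t))"

abbreviation psi_norm :: "real \<Rightarrow> (real \<Rightarrow> real) \<Rightarrow> real" where
  "psi_norm tmax \<psi> \<equiv> enn2real (Linf_norm (restrict_space lborel {0..tmax}) \<psi>)"

text \<open>
  Boundedness of \<open>\<phi>\<close> alone makes neither \<open>\<langle>\<omega>g\<rangle>\<close> nor \<open>\<parallel>\<partial>\<^sub>\<eta> M\<^sub>\<gamma>\<parallel>\<^sub>2\<close> finite, since \<open>\<omega>\<close> ranges over an
  unbounded set (for \<open>\<phi> = 1\<close> the bracket already diverges at \<open>x = 0\<close>). The decay of the data in \<open>\<omega>\<close> is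
  therefore recorded by an envelope \<open>w\<close>, with \<open>\<omega>w(\<omega>)\<close> integrable and square integrable. For instance
  \<open>w = gstar\<close>, the indicator function of a bounded frequency band, or the supremum of
  \<open>\<bar>\<phi>\<bar> / \<parallel>\<phi>\<parallel>\<^sub>\<infinity>\<close> over \<open>(\<mu>,t)\<close> when this has the required integrability.
\<close>

definition frequency_envelope :: "(real \<Rightarrow> real) \<Rightarrow> bool" where
  "frequency_envelope w \<longleftrightarrow>
     (\<forall>\<omega>>0. 0 \<le> w \<omega>) \<and>
     set_integrable lborel {0<..} (\<lambda>\<omega>. \<omega> * w \<omega>) \<and>
     set_integrable lborel {0<..} (\<lambda>\<omega>. (\<omega> * w \<omega>)\<^sup>2)"

definition incoming_datum ::
    "real \<Rightarrow> (real \<Rightarrow> real) \<Rightarrow> (real \<Rightarrow> real \<Rightarrow> real \<Rightarrow> real) \<Rightarrow> bool" where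
  "incoming_datum tmax w \<phi> \<longleftrightarrow>
     (\<lambda>(\<mu>, \<omega>, t). \<phi> \<mu> \<omega> t) \<in> borel_measurable (inflow_space tmax) \<and>
     Linf_norm (inflow_space tmax) (\<lambda>(\<mu>, \<omega>, t). \<phi> \<mu> \<omega> t) < \<infinity> \<and>
     (AE (\<mu>, \<omega>, t) in inflow_space tmax. \<bar>\<phi> \<mu> \<omega> t\<bar> \<le> phi_norm tmax \<phi> * w \<omega>)"

definition test_function :: "real \<Rightarrow> (real \<Rightarrow> real) \<Rightarrow> bool" where
  "test_function tmax \<psi> \<longleftrightarrow>
     \<psi> \<in> borel_measurable (restrict_space lborel {0..tmax}) \<and>
     Linf_norm (restrict_space lborel {0..tmax}) \<psi> < \<infinity>"

end

theory Submission
  imports Defs "HOL-Real_Asymp.Real_Asymp"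
begin

text \<open>
  Time reversal together with \<open>\<mu> \<mapsto> -\<mu>\<close> turns the adjoint problem into a forward problem with datum
  \<open>-\<psi>(T - t) g\<^sup>*/\<mu>\<close>, so only forward problems with an inflow bounded by \<open>b(\<omega>)/\<mu>\<close> have to be estimated.
  Duhamel's formula along characteristics bounds \<open>\<langle>\<omega>\<bar>f\<bar>\<rangle>\<close> by the unscattered inflow plus a positive integral
  operator of \<open>\<langle>\<omega>\<bar>f\<bar>\<rangle>\<close>. As a particle survives without collision up to time \<open>T\<close> with probability
  \<open>exp(-\<omega>T) > 0\<close>, this operator is a contraction in \<open>L\<^sup>1\<close> with a factor \<open>\<kappa> < 1\<close>.

  The contraction gives pointwise bounds for the outgoing traces at \<open>x = 1\<close> by comparison with a supersolution,
  and it bounds the difference of two solutions in \<open>L\<^sup>1\<close> by the defect \<open>(\<eta>\<^sub>1 - \<eta>\<^sub>2) f\<^sub>2\<close> of the reflection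
  law. In the difference of the derivatives one factor of each product is then estimated pointwise and the other
  one in \<open>L\<^sup>1\<close>, and the Cauchy--Schwarz inequality in \<open>\<omega>\<close> concludes.
\<close>

subsection \<open>Duhamel's formula and integrals over the real line\<close>

text \<open>Two features shape the estimates. The adjoint datum carries the factor 1/\<mu>, so the
  unscattered part of the intensity at x is only bounded by the integral of exp(-x/\<nu>)/\<nu> over
  \<nu>, which is logarithmically singular at x = 0; a constant cannot be a supersolution.
  \<open>exp_div_le_powr\<close> separates this kernel into x^(-1/4) \<nu>^(-3/4). The first factor
  stays integrable when multiplied by another singularity of the same kind, the second is integrable
  in \<nu> and is at most 1 after multiplication by the flux weight \<nu>. The derivative also
  divides by \<open>gstar\<close>, while the forward datum decays only like the envelope. After time
  reversal both traces in the product are outgoing ones at x = 1. There the difference of two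
  solutions with the same inflow consists of scattered particles alone, so its time integral carries
  the factor \<open>gstar \<omega> / \<nu>\<close>, which cancels the weight
  \<nu>\<omega>/\<open>gstar \<omega>\<close> up to \<omega>. Absorbing the \<kappa>-term needs a
  finite mass beforehand; it comes from \<open>phase_integrable\<close>.\<close>

lemma duhamel_bound:
  fixes u q p :: "real \<Rightarrow> real"
  assumes ab: "a \<le> b" and int: "set_integrable lborel {a..b} q"
    and inc: "\<And>t. t \<in> {a..b} \<Longrightarrow> u t - u a = (LINT s:{a..t}|lborel. q s)"
    and q: "\<And>s. s \<in> {a..b} \<Longrightarrow> q s = - \<omega> * u s + p s"
  shows "ennreal \<bar>u b\<bar> \<le> ennreal (exp (- \<omega> * (b - a))) * ennreal \<bar>u a\<bar>
    + (\<integral>\<^sup>+s. ennreal (exp (- \<omega> * (b - s)) * \<bar>p s\<bar>) * indicator {a..b} s \<partial>lborel)"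
proof -
  let ?I = "indicator {a..b} :: real \<Rightarrow> real"
  define E where "E t = \<omega> * exp (\<omega> * t)" for t
  define Q where "Q t = (LINT s:{a..t}|lborel. q s)" for t
  define K where "K = \<bar>\<omega>\<bar> * exp (\<bar>\<omega>\<bar> * (\<bar>a\<bar> + \<bar>b\<bar>))"
  have int1: "integrable lborel (\<lambda>s. ?I s * q s)"
    using int by (simp add: set_integrable_def)
  then have [measurable]: "(\<lambda>s. ?I s * q s) \<in> borel_measurable borel" by auto
  have [measurable]: "E \<in> borel_measurable borel" unfolding E_def by measurable
  have expb: "exp (\<omega> * t) \<le> exp (\<bar>\<omega>\<bar> * (\<bar>a\<bar> + \<bar>b\<bar>))" if "t \<in> {a..b}" for t
  proof -
    have "\<bar>t\<bar> \<le> \<bar>a\<bar> + \<bar>b\<bar>" using that by auto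
    have "\<omega> * t \<le> \<bar>\<omega>\<bar> * \<bar>t\<bar>" using abs_ge_self[of "\<omega> * t"] by (simp add: abs_mult)
    also have "\<dots> \<le> \<bar>\<omega>\<bar> * (\<bar>a\<bar> + \<bar>b\<bar>)" using \<open>\<bar>t\<bar> \<le> _\<close> by (intro mult_left_mono) auto
    finally show ?thesis by simp
  qed
  have EK: "\<bar>E t\<bar> \<le> K" if "t \<in> {a..b}" for t
    using expb[OF that] unfolding E_def K_def by (auto simp: abs_mult intro!: mult_left_mono)
  have E_int: "integrable lborel (\<lambda>t. E t * indicator {s..b} t)"
    "(\<integral>t. E t * indicator {s..b} t \<partial>lborel) = exp (\<omega> * b) - exp (\<omega> * s)" if "s \<le> b" for s
  proof -
    have "has_bochner_integral lborel (\<lambda>t. E t * indicator {s..b} t) (exp (\<omega> * b) - exp (\<omega> * s))"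
      using that unfolding E_def
      by (intro has_bochner_integral_FTC_Icc_real) (auto intro!: derivative_eq_intros continuous_intros)
    then show "integrable lborel (\<lambda>t. E t * indicator {s..b} t)"
      "(\<integral>t. E t * indicator {s..b} t \<partial>lborel) = exp (\<omega> * b) - exp (\<omega> * s)"
      by (auto simp: has_bochner_integral_iff)
  qed
  \<comment> \<open>\<open>u\<close> is only an indefinite integral of \<open>q\<close>, so
    exp(\<omega>t) u(t) is not differentiated. Integration by parts is replaced by Fubini on the
    triangle s \<le> t \<le> b, with \<open>E\<close> the derivative of exp(\<omega>t): one order
    gives q(s) (exp(\<omega>b) - exp(\<omega>s)), the other E(t) Q(t).\<close>
  define f where "f s t = ?I s * q s * (indicator {s..b} t * E t)" for s t
  have f_meas: "case_prod f \<in> borel_measurable (lborel \<Otimes>\<^sub>M lborel)"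
  proof -
    have "(\<lambda>(s, t). (?I s * q s) * (indicator {(s,t). s \<le> t \<and> t \<le> b} (s,t) * E t)) \<in> borel_measurable (lborel \<Otimes>\<^sub>M lborel)"
      by measurable
    also have "(\<lambda>(s, t). (?I s * q s) * (indicator {(s,t). s \<le> t \<and> t \<le> b} (s,t) * E t)) = case_prod f"
      by (auto simp: f_def fun_eq_iff split: split_indicator)
    finally show ?thesis .
  qed
  have f_int: "integrable (lborel \<Otimes>\<^sub>M lborel) (case_prod f)"
  proof (rule integrableI_bounded[OF f_meas])
    have "(\<integral>\<^sup>+z. ennreal (norm (case_prod f z)) \<partial>(lborel \<Otimes>\<^sub>M lborel))
       = (\<integral>\<^sup>+s. \<integral>\<^sup>+t. ennreal (norm (f s t)) \<partial>lborel \<partial>lborel)"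
      using f_meas by (subst lborel.nn_integral_fst[symmetric]) auto
    also have "\<dots> \<le> (\<integral>\<^sup>+s. \<integral>\<^sup>+t. ennreal \<bar>?I s * q s\<bar> * (ennreal K * indicator {a..b} t) \<partial>lborel \<partial>lborel)"
    proof (intro nn_integral_mono)
      fix s t
      show "ennreal (norm (f s t)) \<le> ennreal \<bar>?I s * q s\<bar> * (ennreal K * indicator {a..b} t)"
      proof (cases "s \<in> {a..b} \<and> t \<in> {s..b}")
        case True
        then have "\<bar>E t\<bar> \<le> K" by (intro EK) auto
        then have "\<bar>q s\<bar> * \<bar>E t\<bar> \<le> \<bar>q s\<bar> * K" by (rule mult_left_mono) auto
        with True \<open>\<bar>E t\<bar> \<le> K\<close> show ?thesis
          by (auto simp: f_def abs_mult ennreal_mult[symmetric])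
      qed (auto simp: f_def)
    qed
    also have "\<dots> = (\<integral>\<^sup>+s. ennreal \<bar>?I s * q s\<bar> \<partial>lborel) * (ennreal K * ennreal (b - a))"
      using ab by (simp add: nn_integral_cmult nn_integral_multc)
    also have "\<dots> < \<infinity>"
      using int1 by (auto simp: integrable_iff_bounded ennreal_mult_less_top)
    finally show "(\<integral>\<^sup>+z. ennreal (norm (case_prod f z)) \<partial>(lborel \<Otimes>\<^sub>M lborel)) < \<infinity>" .
  qed
  have inner_t: "(\<integral>t. f s t \<partial>lborel) = ?I s * q s * (exp (\<omega> * b) - exp (\<omega> * s))" for s
    using E_int(2)[of s] by (cases "s \<in> {a..b}") (auto simp: f_def mult.commute)
  have inner_s: "(\<integral>s. f s t \<partial>lborel) = ?I t * E t * Q t" for t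
  proof (cases "t \<in> {a..b}")
    case True
    have "(\<integral>s. f s t \<partial>lborel) = (\<integral>s. (indicator {a..t} s * q s) * E t \<partial>lborel)"
      using True by (intro Bochner_Integration.integral_cong) (auto simp: f_def split: split_indicator)
    then show ?thesis using True by (simp add: Q_def set_lebesgue_integral_def)
  next
    case False
    then have "f s t = 0" for s by (auto simp: f_def split: split_indicator)
    then show ?thesis using False by simp
  qed
  have EQ_int: "integrable lborel (\<lambda>t. ?I t * E t * Q t)"
    using lborel_pair.integrable_snd[OF f_int] by (simp add: inner_s)
  have EQ: "(\<integral>t. ?I t * E t * Q t \<partial>lborel) = (\<integral>s. ?I s * q s * (exp (\<omega> * b) - exp (\<omega> * s)) \<partial>lborel)"
    using lborel_pair.Fubini_integral[OF f_int] by (simp add: inner_s inner_t)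
  have int2: "integrable lborel (\<lambda>s. ?I s * q s * exp (\<omega> * s))"
  proof (rule Bochner_Integration.integrable_bound[where f="\<lambda>s. exp (\<bar>\<omega>\<bar> * (\<bar>a\<bar> + \<bar>b\<bar>)) * (?I s * q s)"])
    show "integrable lborel (\<lambda>s. exp (\<bar>\<omega>\<bar> * (\<bar>a\<bar> + \<bar>b\<bar>)) * (?I s * q s))" using int1 by simp
    show "AE s in lborel. norm (?I s * q s * exp (\<omega> * s)) \<le> norm (exp (\<bar>\<omega>\<bar> * (\<bar>a\<bar> + \<bar>b\<bar>)) * (?I s * q s))"
    proof (rule AE_I2)
      fix s show "norm (?I s * q s * exp (\<omega> * s)) \<le> norm (exp (\<bar>\<omega>\<bar> * (\<bar>a\<bar> + \<bar>b\<bar>)) * (?I s * q s))"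
      proof (cases "s \<in> {a..b}")
        case True
        then show ?thesis using mult_left_mono[OF expb[OF True], of "\<bar>q s\<bar>"] by (simp add: abs_mult mult.commute)
      qed auto
    qed
  qed measurable
  have ueq: "u t = u a + Q t" if "t \<in> {a..b}" for t
    using inc[OF that] by (simp add: Q_def)
  \<comment> \<open>Substituting u = u(a) + Q into p = q + \<omega>u leaves three terms of known
    integrability. After \<open>EQ\<close> the two integrals of q(s) exp(\<omega>s) cancel, so only
    the end values of \<open>u\<close> survive.\<close>
  have p_eq: "?I s * (exp (\<omega> * s) * p s) = ?I s * q s * exp (\<omega> * s) + (u a * (E s * ?I s) + ?I s * E s * Q s)" for s
  proof (cases "s \<in> {a..b}")
    case True
    then have "p s = q s + \<omega> * (u a + Q s)" using q[of s] ueq[of s] by simp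
    then show ?thesis using True by (simp add: E_def algebra_simps)
  qed simp
  have p_int: "integrable lborel (\<lambda>s. ?I s * (exp (\<omega> * s) * p s))"
    unfolding p_eq using int2 E_int(1)[OF ab] EQ_int
    by (intro Bochner_Integration.integrable_add) auto
  have "(\<integral>s. ?I s * (exp (\<omega> * s) * p s) \<partial>lborel)
      = (\<integral>s. ?I s * q s * exp (\<omega> * s) \<partial>lborel) + (u a * (exp (\<omega> * b) - exp (\<omega> * a))
       + (\<integral>s. ?I s * q s * (exp (\<omega> * b) - exp (\<omega> * s)) \<partial>lborel))"
    unfolding p_eq using int2 E_int[OF ab] EQ_int by (simp add: EQ)
  also have "(\<integral>s. ?I s * q s * (exp (\<omega> * b) - exp (\<omega> * s)) \<partial>lborel)
      = (\<integral>s. ?I s * q s \<partial>lborel) * exp (\<omega> * b) - (\<integral>s. ?I s * q s * exp (\<omega> * s) \<partial>lborel)"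
    using int1 int2 by (simp add: right_diff_distrib)
  also have "(\<integral>s. ?I s * q s \<partial>lborel) = u b - u a"
    using inc[of b] ab by (simp add: set_lebesgue_integral_def)
  finally have main: "(\<integral>s. ?I s * (exp (\<omega> * s) * p s) \<partial>lborel) = exp (\<omega> * b) * u b - exp (\<omega> * a) * u a"
    by (simp add: algebra_simps)
  have exp_shift: "exp (- \<omega> * b) * exp (\<omega> * s) = exp (- \<omega> * (b - s))" for s
    by (subst exp_add[symmetric]) (simp add: algebra_simps)
  define g where "g s = exp (- \<omega> * b) * (?I s * (exp (\<omega> * s) * p s))" for s
  have g_int: "integrable lborel g" unfolding g_def using p_int by simp
  have "(\<integral>s. g s \<partial>lborel) = u b - exp (- \<omega> * (b - a)) * u a"
  proof -
    have "(\<integral>s. g s \<partial>lborel) = exp (- \<omega> * b) * (exp (\<omega> * b) * u b - exp (\<omega> * a) * u a)"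
      unfolding g_def using main by simp
    also have "\<dots> = (exp (- \<omega> * b) * exp (\<omega> * b)) * u b - (exp (- \<omega> * b) * exp (\<omega> * a)) * u a"
      by (simp add: right_diff_distrib)
    finally show ?thesis by (simp only: exp_shift) simp
  qed
  then have ub: "u b = exp (- \<omega> * (b - a)) * u a + (\<integral>s. g s \<partial>lborel)" by simp
  have "\<bar>u b\<bar> \<le> exp (- \<omega> * (b - a)) * \<bar>u a\<bar> + \<bar>\<integral>s. g s \<partial>lborel\<bar>"
    unfolding ub by (rule order_trans[OF abs_triangle_ineq]) (simp add: abs_mult)
  then have "ennreal \<bar>u b\<bar> \<le> ennreal (exp (- \<omega> * (b - a))) * ennreal \<bar>u a\<bar> + ennreal \<bar>\<integral>s. g s \<partial>lborel\<bar>"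
    by (simp add: ennreal_mult[symmetric] ennreal_plus[symmetric] del: ennreal_plus)
  also have "ennreal \<bar>\<integral>s. g s \<partial>lborel\<bar> \<le> (\<integral>\<^sup>+s. ennreal (norm (g s)) \<partial>lborel)"
    using integral_norm_bound_ennreal[OF g_int] by simp
  also have "\<dots> = (\<integral>\<^sup>+s. ennreal (exp (- \<omega> * (b - s)) * \<bar>p s\<bar>) * indicator {a..b} s \<partial>lborel)"
  proof (intro nn_integral_cong)
    fix s
    have "norm (g s) = ?I s * ((exp (- \<omega> * b) * exp (\<omega> * s)) * \<bar>p s\<bar>)"
      by (simp add: g_def abs_mult)
    then show "ennreal (norm (g s)) = ennreal (exp (- \<omega> * (b - s)) * \<bar>p s\<bar>) * indicator {a..b} s"
      by (simp only: exp_shift) (simp split: split_indicator)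
  qed
  finally show ?thesis by (simp add: add_left_mono)
qed

section \<open>Almost-everywhere statements under permutation and affine change of variables\<close>

lemma AE_rotate:
  fixes P :: "real \<Rightarrow> real \<Rightarrow> real \<Rightarrow> bool"
  assumes "AE (x, y, z) in lborel. P x y z"
  shows "AE y in lborel. AE z in lborel. AE x in lborel. P x y z"
proof -
  have "AE w in lborel \<Otimes>\<^sub>M lborel. case w of (x, y, z) \<Rightarrow> P x y z"
    using assms unfolding lborel_prod .
  \<comment> \<open>Commuting two AE quantifiers requires a measurable event, so the exceptional set
    is first enlarged to a measurable null set \<open>N\<close>.\<close>
  then obtain N where N: "{w \<in> space (lborel \<Otimes>\<^sub>M lborel). \<not> (case w of (x, y, z) \<Rightarrow> P x y z)} \<subseteq> N"
    "N \<in> sets (lborel \<Otimes>\<^sub>M lborel)" "emeasure (lborel \<Otimes>\<^sub>M lborel) N = 0"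
    by (elim AE_E)
  have "AE w in lborel \<Otimes>\<^sub>M (lborel :: (real \<times> real) measure). w \<notin> N"
    using N by (intro AE_not_in null_setsI) auto
  then have "AE x in (lborel :: real measure). AE yz in (lborel :: (real \<times> real) measure). (x, yz) \<notin> N"
    by (rule lborel_pair.AE_pair)
  then have "AE yz in (lborel :: (real \<times> real) measure). AE x in (lborel :: real measure). (x, yz) \<notin> N"
    using sets.compl_sets[OF N(2)] by (subst (asm) lborel_pair.AE_commute) (simp_all add: set_diff_eq)
  then have "AE yz in lborel \<Otimes>\<^sub>M lborel. AE x in (lborel :: real measure). (x, yz) \<notin> N"
    unfolding lborel_prod .
  then have AE_N: "AE y in lborel. AE z in lborel. AE x in (lborel :: real measure). (x, y, z) \<notin> N"
    by (rule lborel_pair.AE_pair)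
  have imp: "P x y z" if "(x, y, z) \<notin> N" for x y z
    using that subsetD[OF N(1), of "(x, y, z)"] by (auto simp: space_pair_measure)
  show ?thesis
    by (rule eventually_mono[OF AE_N], erule eventually_mono, erule eventually_mono, rule imp)
qed

lemma AE_lborel_prod3:
  fixes P :: "real \<Rightarrow> real \<Rightarrow> real \<Rightarrow> bool"
  assumes "AE (x, y, z) in lborel. P x y z"
  shows "AE x in lborel. AE y in lborel. AE z in lborel. P x y z"
proof -
  have "AE w in lborel \<Otimes>\<^sub>M lborel. case w of (x, y, z) \<Rightarrow> P x y z"
    using assms unfolding lborel_prod .
  then have "AE x in lborel. AE w in lborel. case w of (y, z) \<Rightarrow> P x y z"
    by (drule_tac lborel_pair.AE_pair) simp
  then have "AE x in lborel. AE w in lborel \<Otimes>\<^sub>M lborel. case w of (y, z) \<Rightarrow> P x y z"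
    unfolding lborel_prod .
  then show ?thesis
    by (rule eventually_mono) (drule lborel_pair.AE_pair, simp)
qed

text \<open>Line parameter, position and time are linked by c = y - \<nu>\<omega>t. This lemma
  transfers null sets between them, for instance from almost every line to almost every time at a
  fixed position.\<close>

lemma AE_lborel_affine:
  fixes P :: "real \<Rightarrow> bool"
  assumes "c \<noteq> 0" and "AE x in lborel. P x"
  shows "AE x in lborel. P (t + c * x)"
proof -
  obtain N where N: "{x \<in> space lborel. \<not> P x} \<subseteq> N" "N \<in> sets lborel" "emeasure lborel N = 0"
    using assms(2) by (elim AE_E)
  have "AE x in lborel. x \<notin> N" using N by (intro AE_not_in null_setsI) auto
  then have "AE x in lborel. t + c * x \<notin> N"
    using N(2) by (intro AE_borel_affine[OF assms(1), of "\<lambda>x. x \<notin> N"]) auto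
  then show ?thesis using N(1) by (elim AE_mp) (auto intro!: AE_I2)
qed

lemma AE_lborel_uminus:
  fixes P :: "real \<Rightarrow> bool"
  assumes "AE \<mu> in lborel. P \<mu>" shows "AE \<mu> in lborel. P (- \<mu>)"
  using AE_lborel_affine[of "-1" P 0] assms by simp

lemma AE_lborel_reflect:
  fixes P :: "real \<Rightarrow> bool"
  assumes "AE t in lborel. P t" shows "AE t in lborel. P (a - t)"
  using AE_lborel_affine[of "-1" P a] assms by simp

section \<open>Translations, reflections and explicit integrals\<close>

lemma nn_integral_shift:
  fixes f :: "real \<Rightarrow> ennreal"
  assumes [measurable]: "f \<in> borel_measurable borel"
  shows "(\<integral>\<^sup>+x. f (x - a) \<partial>lborel) = (\<integral>\<^sup>+x. f x \<partial>lborel)"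
  using nn_integral_real_affine[OF assms, of 1 "-a"] by (simp add: algebra_simps)

lemma nn_integral_flip:
  fixes f :: "real \<Rightarrow> ennreal"
  assumes [measurable]: "f \<in> borel_measurable borel"
  shows "(\<integral>\<^sup>+x. f (a - x) \<partial>lborel) = (\<integral>\<^sup>+x. f x \<partial>lborel)"
  using nn_integral_real_affine[OF assms, of "-1" "a"] by (simp add: algebra_simps)

lemma nn_integral_powr:
  assumes "-1 < a" "0 \<le> c"
  shows "(\<integral>\<^sup>+x. ennreal (x powr a) * indicator {0..c} x \<partial>lborel) = ennreal (c powr (a + 1) / (a + 1))"
  using nn_integral_has_integral_lebesgue'[OF _ has_integral_powr_from_0[OF assms]] by simp

lemma nn_integral_exp_Icc:
  assumes "0 < \<omega>" "0 \<le> T"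
  shows "(\<integral>\<^sup>+s. ennreal (exp (- \<omega> * s)) * indicator {0..T} s \<partial>lborel) = ennreal ((1 - exp (- \<omega> * T)) / \<omega>)"
proof -
  have "(\<integral>\<^sup>+s. ennreal (exp (- \<omega> * s)) * indicator {0..T} s \<partial>lborel)
      = ennreal (- exp (- \<omega> * T) / \<omega> - (- exp (- \<omega> * 0) / \<omega>))"
    using assms by (intro nn_integral_FTC_Icc) (auto intro!: derivative_eq_intros)
  then show ?thesis by (simp add: diff_divide_distrib)
qed

lemma nn_integral_exp_Ici:
  assumes "0 < c"
  shows "(\<integral>\<^sup>+s. ennreal (exp (- c * s)) * indicator {0..} s \<partial>lborel) = ennreal (1 / c)"
proof -
  have lim: "((\<lambda>x. - exp (- c * x) / c) \<longlongrightarrow> 0) at_top"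
    using assms by real_asymp
  have "(\<integral>\<^sup>+s. ennreal (exp (- c * s)) * indicator {0..} s \<partial>lborel) = ennreal (0 - (- exp (- c * 0) / c))"
    using assms by (intro nn_integral_FTC_atLeast[OF _ _ _ lim]) (auto intro!: derivative_eq_intros)
  then show ?thesis by simp
qed

section \<open>Separation of variables in the singular kernel\<close>

lemma exp_minus_le_powr:
  assumes "0 < z" shows "exp (- z) \<le> z powr (- (1/4 :: real))"
proof -
  have "z powr (1/4) \<le> exp z"
  proof (cases "z \<le> 1")
    case True
    have "z powr (1/4) \<le> 1 powr (1/4)" using True assms by (intro powr_mono2) auto
    then show ?thesis using assms one_le_exp_iff[of z] by (simp; linarith)
  next
    case False
    have "z powr (1/4) \<le> z powr 1" using False by (intro powr_mono) auto
    also have "\<dots> \<le> exp z" using assms exp_ge_add_one_self[of z] by (simp; linarith)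
    finally show ?thesis .
  qed
  then show ?thesis using assms by (simp add: exp_minus powr_minus le_imp_inverse_le)
qed

text \<open>The kernel is homogeneous of degree -1, so the two exponents must add up to -1. The
  choice 1/4 and 3/4 makes the power of \<nu> integrable on (0,1] and the power of u square
  integrable near 0.\<close>

lemma exp_div_le_powr:
  fixes u \<nu> :: real
  assumes "0 < u" "0 < \<nu>"
  shows "exp (- u / \<nu>) / \<nu> \<le> u powr (- (1/4)) * \<nu> powr (- (3/4))"
proof -
  have "exp (- u / \<nu>) / \<nu> \<le> (u / \<nu>) powr (- (1/4)) / \<nu>"
    using exp_minus_le_powr[of "u / \<nu>"] assms by (intro divide_right_mono) auto
  also have "\<dots> = u powr (- (1/4)) * (\<nu> powr (1/4) * \<nu> powr (-1))"
    using assms by (simp add: powr_divide powr_minus field_simps)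
  also have "\<nu> powr (1/4) * \<nu> powr (-1) = \<nu> powr (- (3/4))"
    by (subst powr_add[symmetric]) simp
  finally show ?thesis .
qed

lemma mult_powr_le_1:
  fixes \<nu> :: real
  assumes "\<nu> \<in> {0<..1}" shows "\<nu> * \<nu> powr - (3/4) \<le> 1"
proof -
  have "\<nu> * \<nu> powr - (3/4) = \<nu> powr (1/4)"
    using assms powr_add[of \<nu> 1 "- (3/4)"] by simp
  also have "\<dots> \<le> 1" using assms powr_mono2[of "1/4" \<nu> 1] by simp
  finally show ?thesis .
qed

subsection \<open>The equilibrium distribution\<close>

lemma gstar_nonneg: "0 \<le> gstar \<omega>"
  by (simp add: gstar_def)

lemma gstar_pos: "0 < \<omega> \<Longrightarrow> 0 < gstar \<omega>"
  by (simp add: gstar_def)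

lemma gstar_measurable [measurable]: "gstar \<in> borel_measurable borel"
  unfolding gstar_def by measurable

text \<open>From exp \<omega> - 1 \<ge> exp(3\<omega>/4) \<omega>/4 the \<omega>^2 in the numerator
  cancels and 16 exp(-\<omega>/2) remains; the extra \<omega> \<le> 4 exp(\<omega>/4) costs half of
  the decay and gives 64.\<close>

lemma gstar_le:
  assumes "0 < \<omega>" shows "\<omega> * gstar \<omega> \<le> 64 * exp (- (1/4) * \<omega>)"
proof -
  have e: "exp (\<omega>/4) - 1 \<ge> \<omega>/4" using exp_ge_add_one_self[of "\<omega>/4"] by linarith
  have "exp \<omega> - 1 \<ge> exp (3*\<omega>/4) * (exp (\<omega>/4) - 1)"
    using assms by (simp add: algebra_simps exp_add[symmetric])
  moreover have "exp (3*\<omega>/4) * (exp (\<omega>/4) - 1) \<ge> exp (3*\<omega>/4) * (\<omega>/4)"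
    using e by (intro mult_left_mono) auto
  ultimately have "exp (3*\<omega>/4) * (\<omega>/4) \<le> exp \<omega> - 1" by linarith
  then have "(exp (3*\<omega>/4) * (\<omega>/4))\<^sup>2 \<le> (exp \<omega> - 1)\<^sup>2" using assms by (intro power_mono) auto
  then have "exp (3*\<omega>/2) * \<omega>\<^sup>2 / 16 \<le> (exp \<omega> - 1)\<^sup>2"
    by (simp add: power_mult_distrib power2_eq_square field_simps exp_add[symmetric])
  then have "gstar \<omega> \<le> \<omega>\<^sup>2 * exp \<omega> / (exp (3*\<omega>/2) * \<omega>\<^sup>2 / 16)"
    using assms unfolding gstar_def by (intro divide_left_mono) (auto simp: zero_less_mult_iff)
  also have "\<dots> = 16 * exp (-\<omega>/2)"
  proof -
    have "exp (-\<omega>/2) * exp (3*\<omega>/2) = exp \<omega>" by (simp add: exp_add[symmetric])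
    then have "16 * exp (-\<omega>/2) * (exp (3*\<omega>/2) * \<omega>\<^sup>2 / 16) = \<omega>\<^sup>2 * exp \<omega>"
      by (metis (no_types, lifting) mult.commute mult.left_commute nonzero_mult_div_cancel_left times_divide_eq_right zero_neq_numeral)
    then show ?thesis using assms by (subst divide_eq_eq) auto
  qed
  finally have 1: "gstar \<omega> \<le> 16 * exp (-\<omega>/2)" .
  have "\<omega> \<le> 4 * exp (\<omega>/4)" using e by linarith
  then have "\<omega> * gstar \<omega> \<le> (4 * exp (\<omega>/4)) * (16 * exp (-\<omega>/2))"
    using 1 assms gstar_nonneg by (intro mult_mono) auto
  also have "\<dots> = 64 * exp (- (1/4) * \<omega>)" by (simp add: exp_add[symmetric])
  finally show ?thesis .
qed

lemma gstar_integral_finite: "(\<integral>\<^sup>+\<omega>. ennreal (\<omega> * gstar \<omega>) * indicator {0<..} \<omega> \<partial>lborel) < \<infinity>"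
proof -
  have "(\<integral>\<^sup>+\<omega>. ennreal (\<omega> * gstar \<omega>) * indicator {0<..} \<omega> \<partial>lborel)
    \<le> (\<integral>\<^sup>+\<omega>. 64 * (ennreal (exp (- (1/4) * \<omega>)) * indicator {0..} \<omega>) \<partial>lborel)"
    using gstar_le by (intro nn_integral_mono)
      (auto split: split_indicator simp: ennreal_leI ennreal_mult[symmetric] simp flip: ennreal_numeral)
  also have "\<dots> = 64 * ennreal 4"
    using nn_integral_exp_Ici[of "1/4"] by (simp add: nn_integral_cmult)
  also have "\<dots> < \<infinity>" by (simp add: ennreal_mult_less_top)
  finally show ?thesis .
qed

lemma gstar_square_integral_finite:
  "(\<integral>\<^sup>+\<omega>. (ennreal (\<omega> * gstar \<omega>))\<^sup>2 * indicator {0<..} \<omega> \<partial>lborel) < \<infinity>"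
proof -
  have "(\<omega> * gstar \<omega>)\<^sup>2 \<le> 64\<^sup>2 * exp (- (1/2) * \<omega>)" if "0 < \<omega>" for \<omega>
  proof -
    have "(\<omega> * gstar \<omega>)\<^sup>2 \<le> (64 * exp (- (1/4) * \<omega>))\<^sup>2"
      using gstar_le[OF that] that gstar_nonneg by (intro power_mono) auto
    then show ?thesis by (simp add: power_mult_distrib power2_eq_square exp_add[symmetric])
  qed
  then have "(\<integral>\<^sup>+\<omega>. (ennreal (\<omega> * gstar \<omega>))\<^sup>2 * indicator {0<..} \<omega> \<partial>lborel)
    \<le> (\<integral>\<^sup>+\<omega>. 4096 * (ennreal (exp (- (1/2) * \<omega>)) * indicator {0..} \<omega>) \<partial>lborel)"
    using gstar_nonneg by (intro nn_integral_mono)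
      (auto split: split_indicator simp: ennreal_power ennreal_leI ennreal_mult[symmetric] simp flip: ennreal_numeral)
  also have "\<dots> = 4096 * ennreal 2"
    using nn_integral_exp_Ici[of "1/2"] by (simp add: nn_integral_cmult)
  also have "\<dots> < \<infinity>" by (simp add: ennreal_mult_less_top)
  finally show ?thesis .
qed

subsection \<open>The scattering operator\<close>

text \<open>
  The slab is doubled: \<open>y \<in> [0,1]\<close> stands for \<open>x = y\<close> before the reflection at \<open>x = 1\<close>, and
  \<open>y \<in> [1,2]\<close> for \<open>x = 2 - y\<close> after it.
\<close>

definition unfold_reflection :: "real \<Rightarrow> (real \<times> real \<Rightarrow> ennreal) \<Rightarrow> real \<times> real \<Rightarrow> ennreal" where
  "unfold_reflection T E z = indicator ({0..2} \<times> {0..T}) z * E (1 - \<bar>1 - fst z\<bar>, snd z)"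

text \<open>
  Attenuated contribution at \<open>(y, t)\<close> of an emission \<open>E\<close> along the unfolded characteristic through
  \<open>(y, t)\<close>; the cut-off in \<open>unfold_reflection\<close> ends the integral at the boundary \<open>y = 0\<close> and at \<open>t = 0\<close>.
\<close>

definition gain :: "real \<Rightarrow> (real \<times> real \<Rightarrow> ennreal) \<Rightarrow> real \<Rightarrow> real \<Rightarrow> real \<Rightarrow> real \<Rightarrow> ennreal" where
  "gain T E y \<nu> \<omega> t =
     (\<integral>\<^sup>+s. ennreal (exp (- \<omega> * s)) * indicator {0..} s * unfold_reflection T E (y - \<nu> * \<omega> * s, t - s) \<partial>lborel)"

definition mass :: "real \<Rightarrow> (real \<times> real \<Rightarrow> ennreal) \<Rightarrow> ennreal" where
  "mass T E = (\<integral>\<^sup>+x. \<integral>\<^sup>+t. indicator ({0..1} \<times> {0..T}) (x, t) * E (x, t) \<partial>lborel \<partial>lborel)"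

text \<open>The integral over \<mu> in [-1,1] doubles this value, so the bracket normalising the
  collision operator is \<open>2 * gstar_mass\<close>.\<close>

definition gstar_mass :: ennreal where
  "gstar_mass = (\<integral>\<^sup>+\<omega>. ennreal (\<omega> * gstar \<omega>) * indicator {0<..} \<omega> \<partial>lborel)"

text \<open>Of the two factors \<omega>, one is the weight in the moment and the other belongs to
  the emission rate \<open>\<omega> * gstar \<omega>\<close> divided by its bracket. The gains at x
  and 2 - x are the contributions of the directions \<nu> and -\<nu> to the intensity at x.\<close>

definition scattering :: "real \<Rightarrow> (real \<times> real \<Rightarrow> ennreal) \<Rightarrow> real \<times> real \<Rightarrow> ennreal" where
  "scattering T E = (\<lambda>(x, t). \<integral>\<^sup>+\<nu>. \<integral>\<^sup>+\<omega>. indicator ({0<..1} \<times> {0<..}) (\<nu>, \<omega>) *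
     (ennreal (\<omega> * (\<omega> * gstar \<omega>)) / (2 * gstar_mass) * (gain T E x \<nu> \<omega> t + gain T E (2 - x) \<nu> \<omega> t)) \<partial>lborel \<partial>lborel)"

text \<open>The probability of a collision within time T, averaged over the frequency density
  \<open>\<omega> * gstar \<omega> / gstar_mass\<close>.\<close>

definition kappa :: "real \<Rightarrow> ennreal" where
  "kappa T = (\<integral>\<^sup>+\<omega>. ennreal (\<omega> * gstar \<omega> * (1 - exp (- \<omega> * T))) * indicator {0<..} \<omega> \<partial>lborel) / gstar_mass"

lemma unfold_reflection_measurable [measurable]:
  assumes [measurable]: "E \<in> borel_measurable (borel \<Otimes>\<^sub>M borel)"
  shows "unfold_reflection T E \<in> borel_measurable (borel \<Otimes>\<^sub>M borel)"
proof -
  have "(\<lambda>z. indicator ({0..2} \<times> {0..T}) (fst z, snd z) * E (1 - \<bar>1 - fst z\<bar>, snd z)) \<in> borel_measurable (borel \<Otimes>\<^sub>M borel)"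
    by measurable
  then show ?thesis by (simp add: unfold_reflection_def[abs_def])
qed

lemma gain_measurable [measurable]:
  assumes [measurable]: "E \<in> borel_measurable (borel \<Otimes>\<^sub>M borel)"
    "a \<in> borel_measurable M" "b \<in> borel_measurable M" "c \<in> borel_measurable M" "d \<in> borel_measurable M"
  shows "(\<lambda>z. gain T E (a z) (b z) (c z) (d z)) \<in> borel_measurable M"
  unfolding gain_def by measurable

lemma scattering_measurable [measurable]:
  assumes [measurable]: "E \<in> borel_measurable (borel \<Otimes>\<^sub>M borel)"
  shows "scattering T E \<in> borel_measurable (borel \<Otimes>\<^sub>M borel)"
  unfolding scattering_def by measurable

lemma unfold_reflection_mono:
  assumes "\<And>x t. x \<in> {0..1} \<Longrightarrow> t \<in> {0..T} \<Longrightarrow> E (x, t) \<le> E' (x, t)"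
  shows "unfold_reflection T E z \<le> unfold_reflection T E' z"
  using assms unfolding unfold_reflection_def by (cases z) (auto split: split_indicator)

lemma gain_mono:
  assumes "\<And>x t. x \<in> {0..1} \<Longrightarrow> t \<in> {0..T} \<Longrightarrow> E (x, t) \<le> E' (x, t)"
  shows "gain T E y \<nu> \<omega> t \<le> gain T E' y \<nu> \<omega> t"
  unfolding gain_def by (intro nn_integral_mono mult_left_mono unfold_reflection_mono assms) auto

lemma gain_add:
  assumes [measurable]: "E \<in> borel_measurable (borel \<Otimes>\<^sub>M borel)" "E' \<in> borel_measurable (borel \<Otimes>\<^sub>M borel)"
  shows "gain T (\<lambda>z. E z + E' z) y \<nu> \<omega> t = gain T E y \<nu> \<omega> t + gain T E' y \<nu> \<omega> t"
proof -
  have "unfold_reflection T (\<lambda>z. E z + E' z) z = unfold_reflection T E z + unfold_reflection T E' z" for z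
    by (simp add: unfold_reflection_def distrib_left)
  then show ?thesis unfolding gain_def by (subst nn_integral_add[symmetric]) (auto simp: distrib_left)
qed

lemma gain_cmult:
  assumes [measurable]: "E \<in> borel_measurable (borel \<Otimes>\<^sub>M borel)"
  shows "gain T (\<lambda>z. c * E z) y \<nu> \<omega> t = c * gain T E y \<nu> \<omega> t"
proof -
  have "unfold_reflection T (\<lambda>z. c * E z) z = c * unfold_reflection T E z" for z
    by (simp add: unfold_reflection_def mult_ac)
  then show ?thesis unfolding gain_def by (subst nn_integral_cmult[symmetric]) (auto simp: mult_ac)
qed

lemma nn_integral_unfold_reflection:
  assumes [measurable]: "E \<in> borel_measurable (borel \<Otimes>\<^sub>M borel)"
  shows "(\<integral>\<^sup>+y. \<integral>\<^sup>+t. unfold_reflection T E (y, t) \<partial>lborel \<partial>lborel) \<le> 2 * mass T E"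
proof -
  define F where "F z = indicator ({0..1} \<times> {0..T}) z * E z" for z
  have [measurable]: "F \<in> borel_measurable (borel \<Otimes>\<^sub>M borel)" unfolding F_def by measurable
  have "(\<integral>\<^sup>+y. \<integral>\<^sup>+t. unfold_reflection T E (y, t) \<partial>lborel \<partial>lborel)
      \<le> (\<integral>\<^sup>+y. \<integral>\<^sup>+t. F (y, t) + F (2 - y, t) \<partial>lborel \<partial>lborel)"
  proof (intro nn_integral_mono)
    fix y t
    show "unfold_reflection T E (y, t) \<le> F (y, t) + F (2 - y, t)"
      by (cases "y \<le> 1") (auto simp: unfold_reflection_def F_def split: split_indicator)
  qed
  also have "\<dots> = (\<integral>\<^sup>+y. \<integral>\<^sup>+t. F (y, t) \<partial>lborel \<partial>lborel) + (\<integral>\<^sup>+y. \<integral>\<^sup>+t. F (2 - y, t) \<partial>lborel \<partial>lborel)"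
    by (simp add: nn_integral_add)
  also have "(\<integral>\<^sup>+y. \<integral>\<^sup>+t. F (2 - y, t) \<partial>lborel \<partial>lborel) = (\<integral>\<^sup>+y. \<integral>\<^sup>+t. F (y, t) \<partial>lborel \<partial>lborel)"
    by (rule nn_integral_flip) measurable
  finally show ?thesis by (simp add: mass_def F_def mult_2)
qed

text \<open>Integration over all y and t makes the transport a translation, which drops out and
  leaves only the integral of exp(-\<omega>s). The cut-off at time 0 forces s \<le> t \<le> T; this
  finite horizon is where the factor 1 - exp(-\<omega>T), hence \<kappa> < 1, comes from.\<close>

lemma gain_integral_le:
  assumes [measurable]: "E \<in> borel_measurable (borel \<Otimes>\<^sub>M borel)" and "0 < \<omega>" "0 \<le> T"
  shows "(\<integral>\<^sup>+y. \<integral>\<^sup>+t. gain T E y \<nu> \<omega> t * indicator {0..T} t \<partial>lborel \<partial>lborel)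
    \<le> ennreal ((1 - exp (- \<omega> * T)) / \<omega>) * (2 * mass T E)"
proof -
  let ?U = "unfold_reflection T E"
  let ?e = "\<lambda>s. ennreal (exp (- \<omega> * s)) * indicator {0..T} s"
  have "(\<integral>\<^sup>+y. \<integral>\<^sup>+t. gain T E y \<nu> \<omega> t * indicator {0..T} t \<partial>lborel \<partial>lborel)
    \<le> (\<integral>\<^sup>+y. \<integral>\<^sup>+t. \<integral>\<^sup>+s. ?e s * ?U (y - \<nu> * \<omega> * s, t - s) \<partial>lborel \<partial>lborel \<partial>lborel)"
    unfolding gain_def by (subst nn_integral_multc[symmetric], simp, intro nn_integral_mono)
      (auto simp: unfold_reflection_def split: split_indicator)
  also have "\<dots> = (\<integral>\<^sup>+y. \<integral>\<^sup>+s. \<integral>\<^sup>+t. ?e s * ?U (y - \<nu> * \<omega> * s, t - s) \<partial>lborel \<partial>lborel \<partial>lborel)"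
    by (intro nn_integral_cong lborel_pair.Fubini') measurable
  also have "\<dots> = (\<integral>\<^sup>+s. \<integral>\<^sup>+y. \<integral>\<^sup>+t. ?e s * ?U (y - \<nu> * \<omega> * s, t - s) \<partial>lborel \<partial>lborel \<partial>lborel)"
    by (intro lborel_pair.Fubini') measurable
  also have "\<dots> = (\<integral>\<^sup>+s. ?e s * (\<integral>\<^sup>+y. \<integral>\<^sup>+t. ?U (y, t) \<partial>lborel \<partial>lborel) \<partial>lborel)"
  proof (intro nn_integral_cong)
    fix s
    have "(\<integral>\<^sup>+y. \<integral>\<^sup>+t. ?e s * ?U (y - \<nu> * \<omega> * s, t - s) \<partial>lborel \<partial>lborel)
        = ?e s * (\<integral>\<^sup>+y. \<integral>\<^sup>+t. ?U (y - \<nu> * \<omega> * s, t - s) \<partial>lborel \<partial>lborel)"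
      by (simp add: nn_integral_cmult)
    also have "(\<integral>\<^sup>+y. \<integral>\<^sup>+t. ?U (y - \<nu> * \<omega> * s, t - s) \<partial>lborel \<partial>lborel)
        = (\<integral>\<^sup>+y. \<integral>\<^sup>+t. ?U (y - \<nu> * \<omega> * s, t) \<partial>lborel \<partial>lborel)"
      by (intro nn_integral_cong nn_integral_shift[of "\<lambda>t. ?U (_, t)"]) measurable
    also have "\<dots> = (\<integral>\<^sup>+y. \<integral>\<^sup>+t. ?U (y, t) \<partial>lborel \<partial>lborel)"
      by (rule nn_integral_shift[of "\<lambda>y. \<integral>\<^sup>+t. ?U (y, t) \<partial>lborel"]) measurable
    finally show "(\<integral>\<^sup>+y. \<integral>\<^sup>+t. ?e s * ?U (y - \<nu> * \<omega> * s, t - s) \<partial>lborel \<partial>lborel)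
      = ?e s * (\<integral>\<^sup>+y. \<integral>\<^sup>+t. ?U (y, t) \<partial>lborel \<partial>lborel)" .
  qed
  also have "\<dots> = ennreal ((1 - exp (- \<omega> * T)) / \<omega>) * (\<integral>\<^sup>+y. \<integral>\<^sup>+t. ?U (y, t) \<partial>lborel \<partial>lborel)"
    using nn_integral_exp_Icc[OF assms(2,3)] by (simp add: nn_integral_multc)
  also have "\<dots> \<le> ennreal ((1 - exp (- \<omega> * T)) / \<omega>) * (2 * mass T E)"
    by (intro mult_left_mono nn_integral_unfold_reflection) auto
  finally show ?thesis .
qed

text \<open>A flux estimate at fixed position: after a shift in time, the substitution z = y -
  \<nu>\<omega>s turns the integral along the line into one over the doubled slab, with Jacobian
  1/(\<nu>\<omega>). The attenuation is simply bounded by 1.\<close>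

lemma gain_time_integral_le:
  assumes [measurable]: "E \<in> borel_measurable (borel \<Otimes>\<^sub>M borel)" and "0 < \<omega>" "0 < \<nu>"
  shows "(\<integral>\<^sup>+t. gain T E y \<nu> \<omega> t \<partial>lborel) \<le> ennreal (1 / (\<nu> * \<omega>)) * (2 * mass T E)"
proof -
  let ?U = "unfold_reflection T E"
  define F where "F z = (\<integral>\<^sup>+t. ?U (z, t) \<partial>lborel)" for z
  have [measurable]: "F \<in> borel_measurable borel" unfolding F_def by measurable
  have "(\<integral>\<^sup>+t. gain T E y \<nu> \<omega> t \<partial>lborel)
    \<le> (\<integral>\<^sup>+t. \<integral>\<^sup>+s. ?U (y - \<nu> * \<omega> * s, t - s) \<partial>lborel \<partial>lborel)"
  proof (unfold gain_def, intro nn_integral_mono)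
    fix t s
    have "ennreal (exp (- \<omega> * s)) * indicator {0..} s \<le> 1"
      using assms(2) by (auto split: split_indicator)
    then show "ennreal (exp (- \<omega> * s)) * indicator {0..} s * ?U (y - \<nu> * \<omega> * s, t - s) \<le> ?U (y - \<nu> * \<omega> * s, t - s)"
      using mult_right_mono[of _ 1 "?U (y - \<nu> * \<omega> * s, t - s)"] by simp
  qed
  also have "\<dots> = (\<integral>\<^sup>+s. \<integral>\<^sup>+t. ?U (y - \<nu> * \<omega> * s, t - s) \<partial>lborel \<partial>lborel)"
    by (intro lborel_pair.Fubini') measurable
  also have "\<dots> = (\<integral>\<^sup>+s. F (y - \<nu> * \<omega> * s) \<partial>lborel)"
    unfolding F_def by (intro nn_integral_cong nn_integral_shift[of "\<lambda>t. ?U (_, t)"]) measurable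
  also have "\<dots> = ennreal (1 / (\<nu> * \<omega>)) * (\<integral>\<^sup>+z. F z \<partial>lborel)"
    using assms(2,3) nn_integral_real_affine[of F "- (\<nu> * \<omega>)" y]
    by (simp add: mult.assoc[symmetric] ennreal_mult[symmetric])
  also have "\<dots> \<le> ennreal (1 / (\<nu> * \<omega>)) * (2 * mass T E)"
    unfolding F_def by (intro mult_left_mono nn_integral_unfold_reflection) auto
  finally show ?thesis .
qed

lemma gain_const_le:
  assumes "0 < \<omega>" "t \<in> {0..T}"
  shows "gain T (\<lambda>_. \<beta>) y \<nu> \<omega> t \<le> \<beta> * ennreal ((1 - exp (- \<omega> * T)) / \<omega>)"
proof -
  have "gain T (\<lambda>_. \<beta>) y \<nu> \<omega> t \<le> (\<integral>\<^sup>+s. \<beta> * (ennreal (exp (- \<omega> * s)) * indicator {0..T} s) \<partial>lborel)"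
    unfolding gain_def using assms(2)
    by (intro nn_integral_mono) (auto simp: unfold_reflection_def mult.commute split: split_indicator)
  also have "\<dots> = \<beta> * ennreal ((1 - exp (- \<omega> * T)) / \<omega>)"
    using assms nn_integral_exp_Icc[of \<omega> T] by (subst nn_integral_cmult) auto
  finally show ?thesis .
qed

lemma powr_quarter_square: "(x powr - (1/4 :: real))\<^sup>2 = x powr - (1/2)"
proof -
  have "(x powr - (1/4))\<^sup>2 = x powr (- (1/4) + - (1/4))" by (simp only: powr_add power2_eq_square)
  then show ?thesis by simp
qed

text \<open>With z = y - \<nu>\<omega>s as variable the kernel becomes exp(-(y - z)/\<nu>)/\<nu> and
  is separated by \<open>exp_div_le_powr\<close>. The product of the singularity at z = y with those
  at z = 0 and z = 2 is bounded by the sum of their squares, which are powers -1/2. Their integrals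
  are 2 sqrt 2 \<le> 3 and twice 2, which gives 7.\<close>

lemma gain_powr_le:
  assumes "0 < \<omega>" "0 < \<nu>" "y \<in> {0..2}"
  shows "gain T (\<lambda>(x, t). ennreal (x powr - (1/4))) y \<nu> \<omega> t \<le> ennreal (7 * \<nu> powr - (3/4) / \<omega>)"
proof -
  define S where "S z = (1 - \<bar>1 - z\<bar>) powr - (1/4)" for z :: real
  define F where "F z = ennreal (exp (- (y - z) / \<nu>) * S z) * indicator {0..y} z" for z
  define H where "H z = ennreal ((y - z) powr - (1/2)) * indicator {0..2} (y - z)
    + (ennreal (z powr - (1/2)) * indicator {0..1} z + ennreal ((2 - z) powr - (1/2)) * indicator {0..1} (2 - z))" for z
  have [measurable]: "F \<in> borel_measurable borel" unfolding F_def S_def by measurable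
  have "gain T (\<lambda>(x, t). ennreal (x powr - (1/4))) y \<nu> \<omega> t \<le> (\<integral>\<^sup>+s. F (y + (- (\<nu> * \<omega>)) * s) \<partial>lborel)"
    unfolding gain_def
  proof (intro nn_integral_mono)
    fix s
    have "- (y - (y + (- (\<nu> * \<omega>)) * s)) / \<nu> = - \<omega> * s" using assms by (simp add: field_simps)
    moreover have "0 \<le> s \<Longrightarrow> y - \<nu> * \<omega> * s \<le> y" using assms by simp
    ultimately show "ennreal (exp (- \<omega> * s)) * indicator {0..} s *
      unfold_reflection T (\<lambda>(x, t). ennreal (x powr - (1/4))) (y - \<nu> * \<omega> * s, t - s)
      \<le> F (y + (- (\<nu> * \<omega>)) * s)"
      unfolding F_def S_def unfold_reflection_def
      by (auto simp: ennreal_mult mult.assoc split: split_indicator)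
  qed
  also have "\<dots> = ennreal (1 / (\<nu> * \<omega>)) * (\<integral>\<^sup>+z. F z \<partial>lborel)"
    using assms nn_integral_real_affine[of F "- (\<nu> * \<omega>)" y]
    by (simp add: mult.assoc[symmetric] ennreal_mult[symmetric])
  also have "\<dots> = ennreal (1 / \<omega>) * (\<integral>\<^sup>+z. ennreal (1 / \<nu>) * F z \<partial>lborel)"
  proof -
    have "ennreal (1 / (\<nu> * \<omega>)) = ennreal (1 / \<omega>) * ennreal (1 / \<nu>)"
      using assms by (simp add: ennreal_mult[symmetric] mult.commute)
    then show ?thesis by (simp add: nn_integral_cmult mult.assoc)
  qed
  also have "(\<integral>\<^sup>+z. ennreal (1 / \<nu>) * F z \<partial>lborel) \<le> (\<integral>\<^sup>+z. ennreal (\<nu> powr - (3/4)) * H z \<partial>lborel)"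
  proof (rule nn_integral_mono_AE)
    \<comment> \<open>The separated bound needs y - z > 0, so the single point z = y is
      discarded.\<close>
    have "AE z in lborel. z \<noteq> y" by (rule AE_lborel_singleton)
    then show "AE z in lborel. ennreal (1 / \<nu>) * F z \<le> ennreal (\<nu> powr - (3/4)) * H z"
    proof (rule eventually_mono)
      fix z assume "z \<noteq> y"
      show "ennreal (1 / \<nu>) * F z \<le> ennreal (\<nu> powr - (3/4)) * H z"
      proof (cases "z \<in> {0..y}")
        case True
        with \<open>z \<noteq> y\<close> have zy: "0 < y - z" "y - z \<le> 2" using assms by auto
        let ?a = "(y - z) powr - (1/4)"
        have "1 / \<nu> * (exp (- (y - z) / \<nu>) * S z) \<le> (?a * \<nu> powr - (3/4)) * S z"
          using exp_div_le_powr[OF zy(1) assms(2)]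
          by (simp add: S_def) (metis (no_types, opaque_lifting) mult_right_mono powr_ge_zero times_divide_eq_left)
        also have "\<dots> \<le> \<nu> powr - (3/4) * (?a\<^sup>2 + (S z)\<^sup>2)"
        proof -
          have "?a * S z \<le> ?a\<^sup>2 + (S z)\<^sup>2"
          proof -
            have "0 \<le> ?a * S z" by (simp add: S_def)
            then show ?thesis using sum_squares_bound[of ?a "S z"] by linarith
          qed
          from mult_left_mono[OF this, of "\<nu> powr - (3/4)"] show ?thesis by (simp add: mult_ac)
        qed
        finally have "ennreal (1 / \<nu>) * F z \<le> ennreal (\<nu> powr - (3/4)) * (ennreal (?a\<^sup>2) + ennreal ((S z)\<^sup>2))"
          using True assms(2) unfolding F_def
          by (simp add: ennreal_mult[symmetric] ennreal_plus[symmetric] S_def ennreal_leI del: ennreal_plus)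
        also have "\<dots> \<le> ennreal (\<nu> powr - (3/4)) * H z"
        proof (intro mult_left_mono)
          have "ennreal ((S z)\<^sup>2) \<le> ennreal (z powr - (1/2)) * indicator {0..1} z + ennreal ((2 - z) powr - (1/2)) * indicator {0..1} (2 - z)"
            using True assms(3) unfolding S_def powr_quarter_square
            by (cases "z \<le> 1") (auto split: split_indicator)
          moreover have "ennreal (?a\<^sup>2) \<le> ennreal ((y - z) powr - (1/2)) * indicator {0..2} (y - z)"
            using zy unfolding powr_quarter_square by simp
          ultimately show "ennreal (?a\<^sup>2) + ennreal ((S z)\<^sup>2) \<le> H z"
            unfolding H_def by (rule add_mono[rotated])
        qed simp
        finally show ?thesis .
      qed (auto simp: F_def)
    qed
  qed
  also have "(\<integral>\<^sup>+z. ennreal (\<nu> powr - (3/4)) * H z \<partial>lborel) \<le> ennreal (\<nu> powr - (3/4)) * 7"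
  proof -
    define p where "p c u = ennreal (u powr - (1/2)) * indicator {0..c} u" for c u :: real
    have [measurable]: "p c \<in> borel_measurable borel" for c unfolding p_def by measurable
    have ip: "(\<integral>\<^sup>+u. p c u \<partial>lborel) = ennreal (2 * sqrt c)" if "0 \<le> c" for c
      using nn_integral_powr[of "- (1/2)" c] that by (simp add: p_def powr_half_sqrt mult.commute)
    have H: "H z = p 2 (y - z) + (p 1 z + p 1 (2 - z))" for z by (simp add: H_def p_def)
    have "(\<integral>\<^sup>+z. H z \<partial>lborel) = ennreal (2 * sqrt 2) + (ennreal 2 + ennreal 2)"
      unfolding H by (simp add: nn_integral_add nn_integral_flip ip)
    also have "\<dots> \<le> ennreal 7"
    proof -
      have "sqrt 2 \<le> sqrt (9/4)" by (rule real_sqrt_le_mono) simp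
      also have "\<dots> = 3/2" by (simp add: real_sqrt_divide)
      finally have "ennreal (2 * sqrt 2) \<le> ennreal 3" by (intro ennreal_leI) simp
      then have "ennreal (2 * sqrt 2) + (ennreal 2 + ennreal 2) \<le> ennreal 3 + (ennreal 2 + ennreal 2)"
        by (rule add_right_mono)
      also have "\<dots> = ennreal 7" by (simp add: ennreal_plus[symmetric] del: ennreal_plus ennreal_numeral)
      finally show ?thesis .
    qed
    finally have "(\<integral>\<^sup>+z. H z \<partial>lborel) \<le> 7" by simp
    moreover have "H \<in> borel_measurable borel" unfolding H by measurable
    ultimately show ?thesis by (simp add: nn_integral_cmult mult_left_mono)
  qed
  finally have "gain T (\<lambda>(x, t). ennreal (x powr - (1/4))) y \<nu> \<omega> t \<le> ennreal (1 / \<omega>) * (ennreal (\<nu> powr - (3/4)) * 7)"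
    by (simp add: mult_left_mono)
  also have "\<dots> = ennreal (7 * \<nu> powr - (3/4) / \<omega>)"
    using assms by (simp add: ennreal_mult[symmetric] mult.commute flip: ennreal_numeral)
  finally show ?thesis .
qed

section \<open>The contraction in L1 and the supersolution\<close>

lemma gstar_mass_less_top: "gstar_mass < \<infinity>"
  using gstar_integral_finite by (simp add: gstar_mass_def)

lemma weighted_gstar_pos:
  assumes "\<And>\<omega>. 0 < \<omega> \<Longrightarrow> 0 < p \<omega>" and [measurable]: "p \<in> borel_measurable borel"
  shows "0 < (\<integral>\<^sup>+\<omega>. ennreal (\<omega> * gstar \<omega> * p \<omega>) * indicator {0<..} \<omega> \<partial>lborel)"
proof (rule ccontr)
  assume "\<not> ?thesis"
  then have "AE \<omega> in lborel. ennreal (\<omega> * gstar \<omega> * p \<omega>) * indicator {0<..} \<omega> = 0"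
    by (subst (asm) not_gr_zero, subst (asm) nn_integral_0_iff_AE) auto
  then have "AE \<omega>::real in lborel. \<not> 0 < \<omega>"
  proof (rule eventually_mono)
    fix \<omega> :: real assume *: "ennreal (\<omega> * gstar \<omega> * p \<omega>) * indicator {0<..} \<omega> = 0"
    show "\<not> 0 < \<omega>"
    proof
      assume "0 < \<omega>"
      then have "0 < \<omega> * gstar \<omega> * p \<omega>" using assms gstar_pos by simp
      with * \<open>0 < \<omega>\<close> show False by (simp add: ennreal_eq_0_iff)
    qed
  qed
  then have "emeasure lborel {x \<in> space lborel. 0 < (x::real)} = 0"
    by (rule emeasure_eq_0_AE)
  moreover have "emeasure lborel {0<..<1::real} \<le> emeasure lborel {x \<in> space lborel. 0 < (x::real)}"
    by (rule emeasure_mono) auto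
  ultimately show False by simp
qed

lemma gstar_mass_pos: "0 < gstar_mass"
  using weighted_gstar_pos[of "\<lambda>_. 1"] by (simp add: gstar_mass_def)

lemma inverse_double_ennreal:
  fixes g :: ennreal
  assumes "0 < g" "g < \<infinity>" shows "inverse (2 * g) * 2 = inverse g"
  using assms
  by (cases g) (auto simp: inverse_ennreal ennreal_mult[symmetric] ennreal_zero_less_mult_iff simp flip: ennreal_numeral)

text \<open>The numerator \<open>A\<close> and the surviving part \<open>B\<close> add up to
  \<open>gstar_mass\<close>. As \<open>B\<close> is positive and the total is finite,
  \<open>A\<close> is strictly smaller.\<close>

lemma kappa_less_1:
  assumes "0 < T" shows "kappa T < 1"
proof -
  define A where "A = (\<integral>\<^sup>+\<omega>. ennreal (\<omega> * gstar \<omega> * (1 - exp (- \<omega> * T))) * indicator {0<..} \<omega> \<partial>lborel)"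
  define B where "B = (\<integral>\<^sup>+\<omega>. ennreal (\<omega> * gstar \<omega> * exp (- \<omega> * T)) * indicator {0<..} \<omega> \<partial>lborel)"
  have "A + B = gstar_mass" unfolding A_def B_def gstar_mass_def
  proof (subst nn_integral_add[symmetric], measurable, intro nn_integral_cong)
    fix \<omega> :: real
    have "ennreal (\<omega> * gstar \<omega> * (1 - exp (- \<omega> * T))) + ennreal (\<omega> * gstar \<omega> * exp (- \<omega> * T)) = ennreal (\<omega> * gstar \<omega>)"
      if "0 < \<omega>"
    proof -
      have "0 \<le> \<omega> * gstar \<omega> * (1 - exp (- \<omega> * T))" "0 \<le> \<omega> * gstar \<omega> * exp (- \<omega> * T)"
        using that assms gstar_nonneg[of \<omega>] by (intro mult_nonneg_nonneg, auto)+
      from ennreal_plus[OF this, symmetric] show ?thesis by (simp add: algebra_simps)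
    qed
    then show "ennreal (\<omega> * gstar \<omega> * (1 - exp (- \<omega> * T))) * indicator {0<..} \<omega> +
        ennreal (\<omega> * gstar \<omega> * exp (- \<omega> * T)) * indicator {0<..} \<omega> = ennreal (\<omega> * gstar \<omega>) * indicator {0<..} \<omega>"
      by (auto split: split_indicator)
  qed
  moreover have "0 < B" unfolding B_def by (rule weighted_gstar_pos) auto
  moreover have "A < A + B" if "A + B < \<infinity>" "0 < B"
    using that by (cases A; cases B) (auto simp: ennreal_plus[symmetric] ennreal_less_iff simp del: ennreal_plus)
  ultimately have "A < gstar_mass" using gstar_mass_less_top by simp
  have "a / g < 1" if "a < g" "0 < g" "g < \<infinity>" for a g :: ennreal
    using that by (cases a; cases g) (auto simp: divide_ennreal ennreal_less_iff field_simps)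
  from this[OF \<open>A < gstar_mass\<close> gstar_mass_pos gstar_mass_less_top] have "A / gstar_mass < 1" .
  then show ?thesis by (simp add: kappa_def A_def)
qed

lemma nn_integral_swap4:
  fixes f :: "real \<times> real \<times> real \<times> real \<Rightarrow> ennreal"
  assumes [measurable]: "f \<in> borel_measurable (borel \<Otimes>\<^sub>M borel \<Otimes>\<^sub>M borel \<Otimes>\<^sub>M borel)"
  shows "(\<integral>\<^sup>+x. \<integral>\<^sup>+t. \<integral>\<^sup>+\<nu>. \<integral>\<^sup>+\<omega>. f (x, t, \<nu>, \<omega>) \<partial>lborel \<partial>lborel \<partial>lborel \<partial>lborel)
    = (\<integral>\<^sup>+\<nu>. \<integral>\<^sup>+\<omega>. \<integral>\<^sup>+x. \<integral>\<^sup>+t. f (x, t, \<nu>, \<omega>) \<partial>lborel \<partial>lborel \<partial>lborel \<partial>lborel)"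
proof -
  have "(\<integral>\<^sup>+x. \<integral>\<^sup>+t. \<integral>\<^sup>+\<nu>. \<integral>\<^sup>+\<omega>. f (x, t, \<nu>, \<omega>) \<partial>lborel \<partial>lborel \<partial>lborel \<partial>lborel)
    = (\<integral>\<^sup>+x. \<integral>\<^sup>+\<nu>. \<integral>\<^sup>+t. \<integral>\<^sup>+\<omega>. f (x, t, \<nu>, \<omega>) \<partial>lborel \<partial>lborel \<partial>lborel \<partial>lborel)"
    by (intro nn_integral_cong lborel_pair.Fubini') measurable
  also have "\<dots> = (\<integral>\<^sup>+\<nu>. \<integral>\<^sup>+x. \<integral>\<^sup>+t. \<integral>\<^sup>+\<omega>. f (x, t, \<nu>, \<omega>) \<partial>lborel \<partial>lborel \<partial>lborel \<partial>lborel)"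
    by (intro lborel_pair.Fubini') measurable
  also have "\<dots> = (\<integral>\<^sup>+\<nu>. \<integral>\<^sup>+x. \<integral>\<^sup>+\<omega>. \<integral>\<^sup>+t. f (x, t, \<nu>, \<omega>) \<partial>lborel \<partial>lborel \<partial>lborel \<partial>lborel)"
    by (intro nn_integral_cong lborel_pair.Fubini') measurable
  also have "\<dots> = (\<integral>\<^sup>+\<nu>. \<integral>\<^sup>+\<omega>. \<integral>\<^sup>+x. \<integral>\<^sup>+t. f (x, t, \<nu>, \<omega>) \<partial>lborel \<partial>lborel \<partial>lborel \<partial>lborel)"
    by (intro nn_integral_cong lborel_pair.Fubini') measurable
  finally show ?thesis .
qed

lemma nn_integral_fold_le:
  fixes h :: "real \<Rightarrow> ennreal"
  assumes [measurable]: "h \<in> borel_measurable borel"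
  shows "(\<integral>\<^sup>+x. indicator {0..1} x * (h x + h (2 - x)) \<partial>lborel) \<le> (\<integral>\<^sup>+y. h y \<partial>lborel)"
proof -
  have "(\<integral>\<^sup>+x. indicator {0..1} x * (h x + h (2 - x)) \<partial>lborel)
    = (\<integral>\<^sup>+x. indicator {0..1} x * h x \<partial>lborel) + (\<integral>\<^sup>+x. indicator {1..2} (2 - x) * h (2 - x) \<partial>lborel)"
    by (subst nn_integral_add[symmetric]) (auto intro!: nn_integral_cong split: split_indicator)
  also have "(\<integral>\<^sup>+x. indicator {1..2} (2 - x) * h (2 - x) \<partial>lborel) = (\<integral>\<^sup>+x. indicator {1..2} x * h x \<partial>lborel)"
    by (rule nn_integral_flip) measurable
  also have "(\<integral>\<^sup>+x. indicator {0..1} x * h x \<partial>lborel) + \<dots> = (\<integral>\<^sup>+x. indicator {0..1} x * h x + indicator {1..2} x * h x \<partial>lborel)"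
    by (simp add: nn_integral_add)
  also have "\<dots> \<le> (\<integral>\<^sup>+y. h y \<partial>lborel)"
    by (intro nn_integral_mono_AE eventually_mono[OF AE_lborel_singleton[of 1]]) (auto split: split_indicator)
  finally show ?thesis .
qed

text \<open>For fixed \<nu> and \<omega>, the gains at x and 2 - x together cover the doubled slab
  once, so \<open>gain_integral_le\<close> applies. Its 1/\<omega> cancels one factor \<omega> of
  the kernel and its factor 2 cancels the 2 in \<open>2 * gstar_mass\<close>; the remaining average
  over \<omega> is exactly \<kappa>.\<close>

lemma mass_scattering_le:
  assumes [measurable]: "E \<in> borel_measurable (borel \<Otimes>\<^sub>M borel)" and "0 < T"
  shows "mass T (scattering T E) \<le> kappa T * mass T E"
proof -
  let ?c = "\<lambda>\<nu> \<omega>. indicator ({0<..1} \<times> {0<..}) (\<nu>, \<omega>) * (ennreal (\<omega> * (\<omega> * gstar \<omega>)) / (2 * gstar_mass))"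
  let ?g = "\<lambda>x t \<nu> \<omega>. gain T E x \<nu> \<omega> t + gain T E (2 - x) \<nu> \<omega> t"
  have "mass T (scattering T E)
    = (\<integral>\<^sup>+x. \<integral>\<^sup>+t. \<integral>\<^sup>+\<nu>. \<integral>\<^sup>+\<omega>. indicator ({0..1} \<times> {0..T}) (x, t) * (?c \<nu> \<omega> * ?g x t \<nu> \<omega>) \<partial>lborel \<partial>lborel \<partial>lborel \<partial>lborel)"
    unfolding mass_def scattering_def by (simp add: nn_integral_cmult mult.assoc)
  also have "\<dots> = (\<integral>\<^sup>+\<nu>. \<integral>\<^sup>+\<omega>. \<integral>\<^sup>+x. \<integral>\<^sup>+t. indicator ({0..1} \<times> {0..T}) (x, t) * (?c \<nu> \<omega> * ?g x t \<nu> \<omega>) \<partial>lborel \<partial>lborel \<partial>lborel \<partial>lborel)"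
    using nn_integral_swap4[of "\<lambda>(x, t, \<nu>, \<omega>). indicator ({0..1} \<times> {0..T}) (x, t) * (?c \<nu> \<omega> * ?g x t \<nu> \<omega>)"]
    by simp
  also have "\<dots> \<le> (\<integral>\<^sup>+\<nu>. \<integral>\<^sup>+\<omega>. indicator {0<..1::real} \<nu> * (ennreal (\<omega> * gstar \<omega> * (1 - exp (- \<omega> * T))) * indicator {0<..} \<omega> / gstar_mass * mass T E) \<partial>lborel \<partial>lborel)"
  proof (intro nn_integral_mono)
    fix \<nu> \<omega> :: real
    show "(\<integral>\<^sup>+x. \<integral>\<^sup>+t. indicator ({0..1} \<times> {0..T}) (x, t) * (?c \<nu> \<omega> * ?g x t \<nu> \<omega>) \<partial>lborel \<partial>lborel)
      \<le> indicator {0<..1} \<nu> * (ennreal (\<omega> * gstar \<omega> * (1 - exp (- \<omega> * T))) * indicator {0<..} \<omega> / gstar_mass * mass T E)"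
    proof (cases "\<nu> \<in> {0<..1} \<and> \<omega> \<in> {0<..}")
      case True
      define h where "h y = (\<integral>\<^sup>+t. gain T E y \<nu> \<omega> t * indicator {0..T} t \<partial>lborel)" for y
      have [measurable]: "h \<in> borel_measurable borel" unfolding h_def by measurable
      have "(\<integral>\<^sup>+x. \<integral>\<^sup>+t. indicator ({0..1} \<times> {0..T}) (x, t) * (?c \<nu> \<omega> * ?g x t \<nu> \<omega>) \<partial>lborel \<partial>lborel)
        = (\<integral>\<^sup>+x. \<integral>\<^sup>+t. ?c \<nu> \<omega> * (indicator {0..1} x * (gain T E x \<nu> \<omega> t * indicator {0..T} t + gain T E (2 - x) \<nu> \<omega> t * indicator {0..T} t)) \<partial>lborel \<partial>lborel)"
        by (intro nn_integral_cong) (auto split: split_indicator)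
      also have "\<dots> = ?c \<nu> \<omega> * (\<integral>\<^sup>+x. indicator {0..1} x * (h x + h (2 - x)) \<partial>lborel)"
        unfolding h_def by (simp add: nn_integral_cmult nn_integral_add)
      also have "\<dots> \<le> ?c \<nu> \<omega> * (ennreal ((1 - exp (- \<omega> * T)) / \<omega>) * (2 * mass T E))"
        using order_trans[OF nn_integral_fold_le[of h] gain_integral_le[OF assms(1), of \<omega> T \<nu>, folded h_def]] True assms(2)
        by (intro mult_left_mono) auto
      also have "\<dots> = ennreal (\<omega> * gstar \<omega> * (1 - exp (- \<omega> * T))) / gstar_mass * mass T E"
      proof -
        have "ennreal (\<omega> * (\<omega> * gstar \<omega>)) * ennreal ((1 - exp (- \<omega> * T)) / \<omega>) = ennreal (\<omega> * gstar \<omega> * (1 - exp (- \<omega> * T)))"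
          using True assms(2) gstar_nonneg[of \<omega>] by (subst ennreal_mult[symmetric]) auto
        moreover have "a / (2 * gstar_mass) * (b * (2 * m)) = a * b / gstar_mass * m" for a b m :: ennreal
        proof -
          have "inverse (2 * gstar_mass) * 2 = inverse gstar_mass"
            by (rule inverse_double_ennreal) (use gstar_mass_pos gstar_mass_less_top in auto)
          then show ?thesis by (simp add: divide_ennreal_def mult_ac)
        qed
        ultimately show ?thesis using True by simp
      qed
      finally show ?thesis using True by simp
    next
      case False
      then have "indicator ({0<..1} \<times> {0<..}) (\<nu>, \<omega>) = (0 :: ennreal)" by auto
      then show ?thesis by simp
    qed
  qed
  also have "\<dots> = kappa T * mass T E"
    unfolding kappa_def
    by (simp add: nn_integral_cmult nn_integral_multc nn_integral_divide divide_ennreal_def)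
  finally show ?thesis .
qed

lemma ennreal_quarter_integral: "(\<integral>\<^sup>+\<nu>. ennreal (\<nu> powr - (3/4)) * indicator {0<..1} \<nu> \<partial>lborel) = 4"
proof -
  have "(\<integral>\<^sup>+\<nu>. ennreal (\<nu> powr - (3/4)) * indicator {0<..1} \<nu> \<partial>lborel)
      = (\<integral>\<^sup>+\<nu>. ennreal (\<nu> powr - (3/4)) * indicator {0..1} \<nu> \<partial>lborel)"
    by (intro nn_integral_cong) (auto split: split_indicator simp: less_le)
  also have "\<dots> = 4" using nn_integral_powr[of "- (3/4)" 1] by simp
  finally show ?thesis .
qed

text \<open>Here 28 = 7 * 4, with 7 from \<open>gain_powr_le\<close> and 4 from the integral of
  \<nu>^(-3/4). The singular part is thus smoothed to a constant, while a constant only shrinks by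
  \<kappa>.\<close>

lemma scattering_supersolution:
  assumes "x \<in> {0..1}" "t \<in> {0..T}"
  shows "scattering T (\<lambda>(x, t). \<alpha> * ennreal (x powr - (1/4)) + \<beta>) (x, t) \<le> 28 * \<alpha> + \<beta> * kappa T"
proof -
  let ?E = "\<lambda>(x, t::real). ennreal (x powr - (1/4))"
  have E[measurable]: "?E \<in> borel_measurable (borel \<Otimes>\<^sub>M borel)" by measurable
  have gle: "gain T (\<lambda>(x, t). \<alpha> * ennreal (x powr - (1/4)) + \<beta>) y \<nu> \<omega> t
    \<le> \<alpha> * ennreal (7 * \<nu> powr - (3/4) / \<omega>) + \<beta> * ennreal ((1 - exp (- \<omega> * T)) / \<omega>)"
    if "0 < \<nu>" "0 < \<omega>" "y \<in> {0..2}" for y \<nu> \<omega>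
  proof -
    have "gain T (\<lambda>(x, t). \<alpha> * ennreal (x powr - (1/4)) + \<beta>) y \<nu> \<omega> t = gain T (\<lambda>z. (\<alpha> * ?E z) + \<beta>) y \<nu> \<omega> t"
      by (rule arg_cong[where f="\<lambda>E. gain T E y \<nu> \<omega> t"]) auto
    also have "\<dots> = \<alpha> * gain T ?E y \<nu> \<omega> t + gain T (\<lambda>_. \<beta>) y \<nu> \<omega> t"
      by (subst gain_add) (auto simp: gain_cmult)
    also have "\<dots> \<le> \<alpha> * ennreal (7 * \<nu> powr - (3/4) / \<omega>) + \<beta> * ennreal ((1 - exp (- \<omega> * T)) / \<omega>)"
      using that assms by (intro add_mono mult_left_mono gain_powr_le gain_const_le) auto
    finally show ?thesis .
  qed
  have "scattering T (\<lambda>(x, t). \<alpha> * ennreal (x powr - (1/4)) + \<beta>) (x, t)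
    \<le> (\<integral>\<^sup>+\<nu>. \<integral>\<^sup>+\<omega>. 7 * \<alpha> * (ennreal (\<nu> powr - (3/4)) * indicator {0<..1} \<nu>) * (ennreal (\<omega> * gstar \<omega>) * indicator {0<..} \<omega> / gstar_mass)
        + \<beta> * indicator {0<..1} \<nu> * (ennreal (\<omega> * gstar \<omega> * (1 - exp (- \<omega> * T))) * indicator {0<..} \<omega> / gstar_mass) \<partial>lborel \<partial>lborel)"
    unfolding scattering_def prod.case
  proof (intro nn_integral_mono)
    fix \<nu> \<omega> :: real
    let ?r = "7 * \<alpha> * (ennreal (\<nu> powr - (3/4)) * indicator {0<..1} \<nu>) * (ennreal (\<omega> * gstar \<omega>) * indicator {0<..} \<omega> / gstar_mass)
        + \<beta> * indicator {0<..1} \<nu> * (ennreal (\<omega> * gstar \<omega> * (1 - exp (- \<omega> * T))) * indicator {0<..} \<omega> / gstar_mass)"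
    let ?S = "\<lambda>(x, t). \<alpha> * ennreal (x powr - (1/4)) + \<beta>"
    show "indicator ({0<..1} \<times> {0<..}) (\<nu>, \<omega>) * (ennreal (\<omega> * (\<omega> * gstar \<omega>)) / (2 * gstar_mass) *
       (gain T ?S x \<nu> \<omega> t + gain T ?S (2 - x) \<nu> \<omega> t)) \<le> ?r"
    proof (cases "\<nu> \<in> {0<..1} \<and> \<omega> \<in> {0<..}")
      case True
      let ?b = "\<alpha> * ennreal (7 * \<nu> powr - (3/4) / \<omega>) + \<beta> * ennreal ((1 - exp (- \<omega> * T)) / \<omega>)"
      have "indicator ({0<..1} \<times> {0<..}) (\<nu>, \<omega>) * (ennreal (\<omega> * (\<omega> * gstar \<omega>)) / (2 * gstar_mass) *
         (gain T ?S x \<nu> \<omega> t + gain T ?S (2 - x) \<nu> \<omega> t))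
        \<le> ennreal (\<omega> * (\<omega> * gstar \<omega>)) / (2 * gstar_mass) * (?b + ?b)"
      proof -
        have ind: "indicator ({0<..1} \<times> {0<..}) (\<nu>, \<omega>) = (1 :: ennreal)" using True by simp
        show ?thesis
          unfolding ind mult_1_left using True assms by (intro mult_left_mono add_mono gle) auto
      qed
      also have "\<dots> = (\<alpha> * (ennreal (\<omega> * (\<omega> * gstar \<omega>)) * ennreal (7 * \<nu> powr - (3/4) / \<omega>))
          + \<beta> * (ennreal (\<omega> * (\<omega> * gstar \<omega>)) * ennreal ((1 - exp (- \<omega> * T)) / \<omega>))) / gstar_mass"
      proof -
        have i: "inverse (2 * gstar_mass) * 2 = inverse gstar_mass"
          by (rule inverse_double_ennreal) (use gstar_mass_pos gstar_mass_less_top in auto)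
        have "a / (2 * gstar_mass) * (b + b) = a * b / gstar_mass" for a b :: ennreal
          by (simp add: divide_ennreal_def mult_2[symmetric] i[symmetric] mult_ac)
        then have "ennreal (\<omega> * (\<omega> * gstar \<omega>)) / (2 * gstar_mass) * (?b + ?b) = ennreal (\<omega> * (\<omega> * gstar \<omega>)) * ?b / gstar_mass" .
        then show ?thesis by (simp only: distrib_left mult.left_commute)
      qed
      also have "ennreal (\<omega> * (\<omega> * gstar \<omega>)) * ennreal (7 * \<nu> powr - (3/4) / \<omega>) = 7 * (ennreal (\<nu> powr - (3/4)) * ennreal (\<omega> * gstar \<omega>))"
        using True gstar_nonneg[of \<omega>] by (simp add: ennreal_mult[symmetric] mult_ac flip: ennreal_numeral)
      also have "ennreal (\<omega> * (\<omega> * gstar \<omega>)) * ennreal ((1 - exp (- \<omega> * T)) / \<omega>) = ennreal (\<omega> * gstar \<omega> * (1 - exp (- \<omega> * T)))"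
        using True assms(2) gstar_nonneg[of \<omega>] by (subst ennreal_mult[symmetric]) auto
      finally show ?thesis using True by (simp add: divide_ennreal_def distrib_left distrib_right mult_ac)
    next
      case False
      then have "indicator ({0<..1} \<times> {0<..}) (\<nu>, \<omega>) = (0 :: ennreal)" by auto
      then show ?thesis by simp
    qed
  qed
  also have "\<dots> = 7 * \<alpha> * 4 * (gstar_mass / gstar_mass) + \<beta> * kappa T"
    unfolding kappa_def
    by (simp add: nn_integral_add nn_integral_cmult nn_integral_multc nn_integral_divide ennreal_quarter_integral flip: gstar_mass_def)
  also have "gstar_mass / gstar_mass = 1" using gstar_mass_pos gstar_mass_less_top by (simp add: ennreal_divide_self)
  finally show ?thesis by (simp add: mult_ac)
qed

subsection \<open>Transport along characteristics\<close>

abbreviation scattering_rate :: real where "scattering_rate \<equiv> \<langle>\<lambda>\<mu> \<omega>. \<omega> * gstar \<omega>\<rangle>"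

lemma scattering_rate_eq: "ennreal scattering_rate = 2 * gstar_mass" and scattering_rate_pos: "0 < scattering_rate"
proof -
  have "(LINT \<omega>:{0<..}|lborel. \<omega> * gstar \<omega>) = enn2real (\<integral>\<^sup>+\<omega>. ennreal (indicator {0<..} \<omega> * (\<omega> * gstar \<omega>)) \<partial>lborel)"
    unfolding set_lebesgue_integral_def real_scaleR_def
    using gstar_nonneg by (intro integral_eq_nn_integral) (auto split: split_indicator)
  also have "(\<integral>\<^sup>+\<omega>. ennreal (indicator {0<..} \<omega> * (\<omega> * gstar \<omega>)) \<partial>lborel) = gstar_mass"
    unfolding gstar_mass_def by (intro nn_integral_cong) (auto split: split_indicator)
  finally have "scattering_rate = 2 * enn2real gstar_mass"
    by (simp add: bracket_def set_lebesgue_integral_def)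
  then show "ennreal scattering_rate = 2 * gstar_mass"
    using gstar_mass_less_top by (simp add: ennreal_mult enn2real_nonneg)
  with gstar_mass_pos show "0 < scattering_rate"
    by (metis ennreal_zero_less_mult_iff ennreal_less_zero_iff zero_less_numeral)
qed

text \<open>Extension by zero, so that all integrals run over the whole line and need no domain
  restrictions.\<close>

definition modulus :: "real \<Rightarrow> (real \<Rightarrow> real \<Rightarrow> real \<Rightarrow> real \<Rightarrow> real) \<Rightarrow> real \<times> real \<times> real \<times> real \<Rightarrow> ennreal" where
  "modulus T f = (\<lambda>(x, \<mu>, \<omega>, t). indicator ({0..1} \<times> {-1..1} \<times> {0<..} \<times> {0..T}) (x, \<mu>, \<omega>, t) * ennreal \<bar>f x \<mu> \<omega> t\<bar>)"

definition intensity :: "real \<Rightarrow> (real \<Rightarrow> real \<Rightarrow> real \<Rightarrow> real \<Rightarrow> real) \<Rightarrow> real \<times> real \<Rightarrow> ennreal" where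
  "intensity T f = (\<lambda>(x, t). \<integral>\<^sup>+\<mu>. \<integral>\<^sup>+\<omega>. ennreal \<omega> * modulus T f (x, \<mu>, \<omega>, t) \<partial>lborel \<partial>lborel)"

text \<open>The content of \<open>mild_transport\<close> on a single characteristic, isolated so
  that null-set arguments concern the parameter \<open>c\<close> only.\<close>

definition mild_on_line ::
    "real \<Rightarrow> (real \<Rightarrow> real \<Rightarrow> real \<Rightarrow> real \<Rightarrow> real) \<Rightarrow> (real \<Rightarrow> real \<Rightarrow> real \<Rightarrow> real \<Rightarrow> real) \<Rightarrow> real \<Rightarrow> real \<Rightarrow> real \<Rightarrow> bool" where
  "mild_on_line T f q \<mu> \<omega> c \<longleftrightarrow> (\<forall>t1 t2. 0 \<le> t1 \<and> t1 \<le> t2 \<and> t2 \<le> T \<and>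
      c + \<mu> * \<omega> * t1 \<in> {0..1} \<and> c + \<mu> * \<omega> * t2 \<in> {0..1} \<longrightarrow>
      set_integrable lborel {t1..t2} (\<lambda>t. q (c + \<mu> * \<omega> * t) \<mu> \<omega> t) \<and>
      f (c + \<mu> * \<omega> * t2) \<mu> \<omega> t2 - f (c + \<mu> * \<omega> * t1) \<mu> \<omega> t1 =
        (LINT t:{t1..t2}|lborel. q (c + \<mu> * \<omega> * t) \<mu> \<omega> t))"

text \<open>Both end points lie in the slab, hence by convexity the whole segment does, and the
  scattering term can be replaced by its majorant \<open>E\<close> all along it before Duhamel's
  formula is read off.\<close>

lemma mild_on_line_bound:
  assumes "mild_on_line T f (\<lambda>x \<mu> \<omega> t. - \<omega> * f x \<mu> \<omega> t + \<omega> * gstar \<omega> / scattering_rate * r x t) \<mu> \<omega> c"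
    and "0 < \<omega>" "0 \<le> t1" "t1 \<le> t2" "t2 \<le> T" "c + \<mu> * \<omega> * t1 \<in> {0..1}" "c + \<mu> * \<omega> * t2 \<in> {0..1}"
    and rE: "\<And>x t. x \<in> {0..1} \<Longrightarrow> t \<in> {0..T} \<Longrightarrow> ennreal \<bar>r x t\<bar> \<le> E (x, t)"
  shows "ennreal \<bar>f (c + \<mu> * \<omega> * t2) \<mu> \<omega> t2\<bar>
    \<le> ennreal (exp (- \<omega> * (t2 - t1))) * ennreal \<bar>f (c + \<mu> * \<omega> * t1) \<mu> \<omega> t1\<bar>
      + (\<integral>\<^sup>+s. ennreal (\<omega> * gstar \<omega>) / (2 * gstar_mass) * (ennreal (exp (- \<omega> * (t2 - s))) * indicator {t1..t2} s * E (c + \<mu> * \<omega> * s, s)) \<partial>lborel)"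
proof -
  have in01: "c + \<mu> * \<omega> * t \<in> {0..1}" if "t \<in> {t1..t2}" for t
  proof -
    have "\<mu> * \<omega> * t1 \<le> \<mu> * \<omega> * t \<and> \<mu> * \<omega> * t \<le> \<mu> * \<omega> * t2 \<or> \<mu> * \<omega> * t2 \<le> \<mu> * \<omega> * t \<and> \<mu> * \<omega> * t \<le> \<mu> * \<omega> * t1"
      using that by (cases "0 \<le> \<mu> * \<omega>") (auto intro: mult_left_mono mult_left_mono_neg)
    then show ?thesis using assms(6,7) by auto
  qed
  have "ennreal \<bar>f (c + \<mu> * \<omega> * t2) \<mu> \<omega> t2\<bar>
    \<le> ennreal (exp (- \<omega> * (t2 - t1))) * ennreal \<bar>f (c + \<mu> * \<omega> * t1) \<mu> \<omega> t1\<bar>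
      + (\<integral>\<^sup>+s. ennreal (exp (- \<omega> * (t2 - s)) * \<bar>\<omega> * gstar \<omega> / scattering_rate * r (c + \<mu> * \<omega> * s) s\<bar>) * indicator {t1..t2} s \<partial>lborel)"
    using assms(1-7) in01 unfolding mild_on_line_def
    by (intro duhamel_bound[where q="\<lambda>t. - \<omega> * f (c + \<mu> * \<omega> * t) \<mu> \<omega> t + \<omega> * gstar \<omega> / scattering_rate * r (c + \<mu> * \<omega> * t) t"]) auto
  also have "(\<integral>\<^sup>+s. ennreal (exp (- \<omega> * (t2 - s)) * \<bar>\<omega> * gstar \<omega> / scattering_rate * r (c + \<mu> * \<omega> * s) s\<bar>) * indicator {t1..t2} s \<partial>lborel)
    \<le> (\<integral>\<^sup>+s. ennreal (\<omega> * gstar \<omega>) / (2 * gstar_mass) * (ennreal (exp (- \<omega> * (t2 - s))) * indicator {t1..t2} s * E (c + \<mu> * \<omega> * s, s)) \<partial>lborel)"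
  proof (intro nn_integral_mono)
    fix s
    show "ennreal (exp (- \<omega> * (t2 - s)) * \<bar>\<omega> * gstar \<omega> / scattering_rate * r (c + \<mu> * \<omega> * s) s\<bar>) * indicator {t1..t2} s
      \<le> ennreal (\<omega> * gstar \<omega>) / (2 * gstar_mass) * (ennreal (exp (- \<omega> * (t2 - s))) * indicator {t1..t2} s * E (c + \<mu> * \<omega> * s, s))"
    proof (cases "s \<in> {t1..t2}")
      case True
      have "ennreal (exp (- \<omega> * (t2 - s)) * \<bar>\<omega> * gstar \<omega> / scattering_rate * r (c + \<mu> * \<omega> * s) s\<bar>)
        = ennreal (\<omega> * gstar \<omega> / scattering_rate) * (ennreal (exp (- \<omega> * (t2 - s))) * ennreal \<bar>r (c + \<mu> * \<omega> * s) s\<bar>)"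
        using scattering_rate_pos assms(2) gstar_nonneg[of \<omega>] by (simp add: ennreal_mult[symmetric] abs_mult mult_ac)
      also have "ennreal (\<omega> * gstar \<omega> / scattering_rate) = ennreal (\<omega> * gstar \<omega>) / (2 * gstar_mass)"
        using scattering_rate_pos assms(2) gstar_nonneg[of \<omega>] by (simp add: divide_ennreal[symmetric] scattering_rate_eq)
      also have "ennreal (\<omega> * gstar \<omega>) / (2 * gstar_mass) * (ennreal (exp (- \<omega> * (t2 - s))) * ennreal \<bar>r (c + \<mu> * \<omega> * s) s\<bar>)
        \<le> ennreal (\<omega> * gstar \<omega>) / (2 * gstar_mass) * (ennreal (exp (- \<omega> * (t2 - s))) * E (c + \<mu> * \<omega> * s, s))"
        using in01[OF True] True assms(3,5) by (intro mult_left_mono rE) auto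
      finally show ?thesis using True by simp
    qed simp
  qed
  finally show ?thesis by (simp add: add_left_mono)
qed

lemma unfold_reflection_return:
  assumes "y \<in> {1..2}" "t \<in> {0..T}"
  shows "unfold_reflection T E (y, t) = E (2 - y, t)"
  using assms by (auto simp: unfold_reflection_def)

text \<open>In absolute time the integrand depends on \<open>t\<close> only through the exponential
  and the upper limit, so a line can be cut at any intermediate time and the pieces glued
  again.\<close>

lemma gain_on_line:
  assumes [measurable]: "E \<in> borel_measurable (borel \<Otimes>\<^sub>M borel)"
  shows "gain T E (c + \<nu> * \<omega> * t) \<nu> \<omega> t =
    (\<integral>\<^sup>+s. ennreal (exp (- \<omega> * (t - s))) * indicator {..t} s * unfold_reflection T E (c + \<nu> * \<omega> * s, s) \<partial>lborel)"
proof -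
  define F where "F s = ennreal (exp (- \<omega> * (t - s))) * indicator {..t} s * unfold_reflection T E (c + \<nu> * \<omega> * s, s)" for s
  have [measurable]: "F \<in> borel_measurable borel" unfolding F_def by measurable
  have "gain T E (c + \<nu> * \<omega> * t) \<nu> \<omega> t = (\<integral>\<^sup>+s. F (t - s) \<partial>lborel)"
    unfolding gain_def F_def
    by (intro nn_integral_cong) (auto simp: right_diff_distrib add_diff_eq split: split_indicator)
  then show ?thesis by (simp add: nn_integral_flip) (simp add: F_def)
qed

text \<open>
  Contribution at \<open>y > 1\<close> of a defect \<open>j\<close> in the reflection law, picked up when the line crossed \<open>y = 1\<close>.
\<close>

definition reflected_source :: "(real \<times> real \<times> real \<Rightarrow> ennreal) \<Rightarrow> real \<Rightarrow> real \<Rightarrow> real \<Rightarrow> real \<Rightarrow> ennreal" where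
  "reflected_source j y \<nu> \<omega> t = ennreal (exp (- (y - 1) / \<nu>)) *
     (indicator {0..} (t - (y - 1) / (\<nu> * \<omega>)) * j (\<nu>, \<omega>, t - (y - 1) / (\<nu> * \<omega>)))"

lemma unfolded_line_bound:
  fixes f :: "real \<Rightarrow> real \<Rightarrow> real \<Rightarrow> real \<Rightarrow> real" and b :: ennreal
  defines "q r \<equiv> (\<lambda>x \<mu> \<omega> t. - \<omega> * f x \<mu> \<omega> t + \<omega> * gstar \<omega> / scattering_rate * r x t)"
  assumes pos: "0 < \<nu>" "0 < \<omega>" and t: "t \<in> {0..T}"
    and [measurable]: "E \<in> borel_measurable (borel \<Otimes>\<^sub>M borel)"
    and rE: "\<And>x t. x \<in> {0..1} \<Longrightarrow> t \<in> {0..T} \<Longrightarrow> ennreal \<bar>r x t\<bar> \<le> E (x, t)"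
    and out: "mild_on_line T f (q r) \<nu> \<omega> c" and ret: "mild_on_line T f (q r) (- \<nu>) \<omega> (2 - c)"
    and init_out: "c \<in> {0..1} \<Longrightarrow> f c \<nu> \<omega> 0 = 0"
    and init_ret: "2 - c \<in> {0..1} \<Longrightarrow> f (2 - c) (- \<nu>) \<omega> 0 = 0"
    and inflow: "- c / (\<nu> * \<omega>) \<in> {0..T} \<Longrightarrow> ennreal \<bar>f 0 \<nu> \<omega> (- c / (\<nu> * \<omega>))\<bar> \<le> ennreal (1 / \<nu>) * b"
    and reflection: "(1 - c) / (\<nu> * \<omega>) \<in> {0..T} \<Longrightarrow> ennreal \<bar>f 1 (- \<nu>) \<omega> ((1 - c) / (\<nu> * \<omega>))\<bar>
       \<le> ennreal \<bar>f 1 \<nu> \<omega> ((1 - c) / (\<nu> * \<omega>))\<bar> + j (\<nu>, \<omega>, (1 - c) / (\<nu> * \<omega>))"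
  shows "c + \<nu> * \<omega> * t \<in> {0..1} \<Longrightarrow> ennreal \<bar>f (c + \<nu> * \<omega> * t) \<nu> \<omega> t\<bar>
      \<le> ennreal (exp (- (c + \<nu> * \<omega> * t) / \<nu>) / \<nu>) * b
        + ennreal (\<omega> * gstar \<omega>) / (2 * gstar_mass) * gain T E (c + \<nu> * \<omega> * t) \<nu> \<omega> t"
    and "c + \<nu> * \<omega> * t \<in> {1..2} \<Longrightarrow> ennreal \<bar>f (2 - (c + \<nu> * \<omega> * t)) (- \<nu>) \<omega> t\<bar>
      \<le> ennreal (exp (- (c + \<nu> * \<omega> * t) / \<nu>) / \<nu>) * b + reflected_source j (c + \<nu> * \<omega> * t) \<nu> \<omega> t
        + ennreal (\<omega> * gstar \<omega>) / (2 * gstar_mass) * gain T E (c + \<nu> * \<omega> * t) \<nu> \<omega> t"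
proof -
  let ?K = "ennreal (\<omega> * gstar \<omega>) / (2 * gstar_mass)"
  let ?U = "unfold_reflection T E"
  let ?y = "\<lambda>t. c + \<nu> * \<omega> * t"
  have vpos: "0 < \<nu> * \<omega>" using pos by simp
  have leg1: "ennreal \<bar>f (?y t) \<nu> \<omega> t\<bar> \<le> ennreal (exp (- ?y t / \<nu>) / \<nu>) * b + ?K * gain T E (?y t) \<nu> \<omega> t"
    if t: "t \<in> {0..T}" and y: "?y t \<in> {0..1}" for t
  proof -
    \<comment> \<open>The starting time of the outgoing leg: either the initial time, where
      \<open>f\<close> vanishes, or the time of entry through x = 0, where the inflow bound
      holds.\<close>
    define t0 where "t0 = max 0 (- c / (\<nu> * \<omega>))"
    have t0: "0 \<le> t0" "t0 \<le> t"
      using t y vpos by (auto simp: t0_def field_simps)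
    have y0: "?y t0 \<in> {0..1}"
    proof -
      have "\<nu> * \<omega> * t0 \<le> \<nu> * \<omega> * t" using t0 vpos by (intro mult_left_mono) auto
      moreover have "0 \<le> ?y t0" using vpos by (auto simp: t0_def max_def field_simps)
      ultimately show ?thesis using y by auto
    qed
    have start: "ennreal (exp (- \<omega> * (t - t0))) * ennreal \<bar>f (?y t0) \<nu> \<omega> t0\<bar> \<le> ennreal (exp (- ?y t / \<nu>) / \<nu>) * b"
    proof (cases "0 \<le> c")
      case True
      then have "t0 = 0" using vpos by (simp add: t0_def max_def divide_le_0_iff)
      then show ?thesis using init_out y0 by simp
    next
      case False
      then have t0eq: "t0 = - c / (\<nu> * \<omega>)" using vpos by (auto simp: t0_def max_def field_simps)
      then have yt0: "?y t0 = 0" using vpos pos by simp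
      have "- \<omega> * (t - t0) = - ?y t / \<nu>" using pos unfolding t0eq by (simp add: field_simps)
      then have "ennreal (exp (- \<omega> * (t - t0))) * ennreal \<bar>f (?y t0) \<nu> \<omega> t0\<bar>
          \<le> ennreal (exp (- ?y t / \<nu>)) * (ennreal (1 / \<nu>) * b)"
        unfolding yt0 using inflow t0 t unfolding t0eq by (intro mult_mono) auto
      then show ?thesis using pos by (simp add: mult.assoc[symmetric] ennreal_mult[symmetric])
    qed
    have "ennreal \<bar>f (?y t) \<nu> \<omega> t\<bar> \<le> ennreal (exp (- \<omega> * (t - t0))) * ennreal \<bar>f (?y t0) \<nu> \<omega> t0\<bar>
      + (\<integral>\<^sup>+s. ?K * (ennreal (exp (- \<omega> * (t - s))) * indicator {t0..t} s * E (?y s, s)) \<partial>lborel)"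
      using out t t0 y y0 pos unfolding q_def by (intro mild_on_line_bound) (auto intro!: rE)
    also have "(\<integral>\<^sup>+s. ?K * (ennreal (exp (- \<omega> * (t - s))) * indicator {t0..t} s * E (?y s, s)) \<partial>lborel)
      \<le> (\<integral>\<^sup>+s. ?K * (ennreal (exp (- \<omega> * (t - s))) * indicator {..t} s * ?U (?y s, s)) \<partial>lborel)"
    proof (intro nn_integral_mono mult_left_mono)
      fix s
      show "ennreal (exp (- \<omega> * (t - s))) * indicator {t0..t} s * E (?y s, s)
        \<le> ennreal (exp (- \<omega> * (t - s))) * indicator {..t} s * ?U (?y s, s)"
      proof (cases "s \<in> {t0..t}")
        case True
        then have "\<nu> * \<omega> * t0 \<le> \<nu> * \<omega> * s" "\<nu> * \<omega> * s \<le> \<nu> * \<omega> * t"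
          using vpos by (auto intro!: mult_left_mono)
        then have "?y s \<in> {0..1}" using y y0 by auto
        then show ?thesis using True t t0 by (auto simp: unfold_reflection_def)
      qed simp
    qed simp
    also have "\<dots> = ?K * gain T E (?y t) \<nu> \<omega> t"
      unfolding gain_on_line[OF assms(5)] by (rule nn_integral_cmult) measurable
    finally show ?thesis
      using start by (meson add_mono_thms_linordered_semiring(1) order_refl order_trans add_right_mono)
  qed
  then show "?y t \<in> {0..1} \<Longrightarrow> ennreal \<bar>f (?y t) \<nu> \<omega> t\<bar> \<le> ennreal (exp (- ?y t / \<nu>) / \<nu>) * b + ?K * gain T E (?y t) \<nu> \<omega> t"
    using t by blast
  assume y: "?y t \<in> {1..2}"
  \<comment> \<open>The starting time of the returning leg: either the initial time or the time of
    reflection at y = 1.\<close>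
  define t1 where "t1 = max 0 ((1 - c) / (\<nu> * \<omega>))"
  have t1: "0 \<le> t1" "t1 \<le> t"
    using t y vpos by (auto simp: t1_def field_simps)
  have y1: "?y t1 \<in> {1..2}"
  proof -
    have "\<nu> * \<omega> * t1 \<le> \<nu> * \<omega> * t" using t1 vpos by (intro mult_left_mono) auto
    moreover have "1 \<le> ?y t1"
    proof -
      have "\<nu> * \<omega> * ((1 - c) / (\<nu> * \<omega>)) \<le> \<nu> * \<omega> * t1"
        using vpos by (intro mult_left_mono) (auto simp: t1_def)
      moreover have "\<nu> * \<omega> * ((1 - c) / (\<nu> * \<omega>)) = 1 - c" using pos by simp
      ultimately show ?thesis by linarith
    qed
    ultimately show ?thesis using y by auto
  qed
  have ret_eq: "2 - c + (- \<nu>) * \<omega> * s = 2 - ?y s" for s by simp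
  let ?tail = "\<integral>\<^sup>+s. ?K * (ennreal (exp (- \<omega> * (t - s))) * indicator {t1..t} s * ?U (?y s, s)) \<partial>lborel"
  have "ennreal \<bar>f (2 - c + (- \<nu>) * \<omega> * t) (- \<nu>) \<omega> t\<bar>
    \<le> ennreal (exp (- \<omega> * (t - t1))) * ennreal \<bar>f (2 - c + (- \<nu>) * \<omega> * t1) (- \<nu>) \<omega> t1\<bar>
    + (\<integral>\<^sup>+s. ?K * (ennreal (exp (- \<omega> * (t - s))) * indicator {t1..t} s * E (2 - c + (- \<nu>) * \<omega> * s, s)) \<partial>lborel)"
    using ret t t1 y y1 pos unfolding q_def by (intro mild_on_line_bound) (auto intro!: rE)
  then have "ennreal \<bar>f (2 - ?y t) (- \<nu>) \<omega> t\<bar>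
    \<le> ennreal (exp (- \<omega> * (t - t1))) * ennreal \<bar>f (2 - ?y t1) (- \<nu>) \<omega> t1\<bar>
    + (\<integral>\<^sup>+s. ?K * (ennreal (exp (- \<omega> * (t - s))) * indicator {t1..t} s * E (2 - ?y s, s)) \<partial>lborel)"
    unfolding ret_eq .
  also have "(\<integral>\<^sup>+s. ?K * (ennreal (exp (- \<omega> * (t - s))) * indicator {t1..t} s * E (2 - ?y s, s)) \<partial>lborel) \<le> ?tail"
  proof (rule nn_integral_mono, rule mult_left_mono)
    fix s
    show "ennreal (exp (- \<omega> * (t - s))) * indicator {t1..t} s * E (2 - ?y s, s)
      \<le> ennreal (exp (- \<omega> * (t - s))) * indicator {t1..t} s * ?U (?y s, s)"
    proof (cases "s \<in> {t1..t}")
      case True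
      then have "\<nu> * \<omega> * t1 \<le> \<nu> * \<omega> * s" "\<nu> * \<omega> * s \<le> \<nu> * \<omega> * t"
        using vpos by (auto intro!: mult_left_mono)
      then have "?y s \<in> {1..2}" using y y1 by auto
      then have "?U (?y s, s) = E (2 - ?y s, s)"
        using True t t1 by (intro unfold_reflection_return) auto
      then show ?thesis by simp
    qed simp
  qed simp
  finally have step: "ennreal \<bar>f (2 - ?y t) (- \<nu>) \<omega> t\<bar>
    \<le> ennreal (exp (- \<omega> * (t - t1))) * ennreal \<bar>f (2 - ?y t1) (- \<nu>) \<omega> t1\<bar> + ?tail"
    by (simp add: add_left_mono)
  show "ennreal \<bar>f (2 - ?y t) (- \<nu>) \<omega> t\<bar>
      \<le> ennreal (exp (- ?y t / \<nu>) / \<nu>) * b + reflected_source j (?y t) \<nu> \<omega> t + ?K * gain T E (?y t) \<nu> \<omega> t"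
  proof (cases "1 \<le> c")
    \<comment> \<open>The line starts on the returning sheet, so it carries zero initial data and
      sees neither the inflow nor the reflection.\<close>
    case True
    then have "(1 - c) / (\<nu> * \<omega>) \<le> 0" using vpos by (intro divide_nonpos_pos) auto
    then have "t1 = 0" unfolding t1_def by (rule max_absorb1)
    then have "f (2 - ?y t1) (- \<nu>) \<omega> t1 = 0" using init_ret y1 by simp
    moreover have "?tail \<le> (\<integral>\<^sup>+s. ?K * (ennreal (exp (- \<omega> * (t - s))) * indicator {..t} s * ?U (?y s, s)) \<partial>lborel)"
      by (intro nn_integral_mono mult_left_mono) (auto split: split_indicator)
    moreover have "\<dots> = ?K * gain T E (?y t) \<nu> \<omega> t"
      unfolding gain_on_line[OF assms(5)] by (rule nn_integral_cmult) measurable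
    ultimately have "ennreal \<bar>f (2 - ?y t) (- \<nu>) \<omega> t\<bar> \<le> ?K * gain T E (?y t) \<nu> \<omega> t"
      using step by simp
    then show ?thesis by (simp add: add_increasing)
  next
    case False
    then have t1eq: "t1 = (1 - c) / (\<nu> * \<omega>)" using vpos by (auto simp: t1_def max_def field_simps)
    then have yt1: "?y t1 = 1" using vpos pos by simp
    have e1: "- \<omega> * (t - t1) = - (?y t - 1) / \<nu>" using pos unfolding t1eq by (simp add: field_simps)
    have tau: "t - (?y t - 1) / (\<nu> * \<omega>) = t1" using pos unfolding t1eq by (simp add: field_simps)
    have src: "reflected_source j (?y t) \<nu> \<omega> t = ennreal (exp (- \<omega> * (t - t1))) * j (\<nu>, \<omega>, t1)"
      unfolding reflected_source_def tau e1 using t1 by simp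
    let ?x = "ennreal (exp (- \<omega> * (t - t1)))"
    have "?x * ennreal \<bar>f 1 (- \<nu>) \<omega> t1\<bar>
      \<le> ?x * (ennreal (exp (- 1 / \<nu>) / \<nu>) * b + ?K * gain T E (?y t1) \<nu> \<omega> t1 + j (\<nu>, \<omega>, t1))"
    proof (intro mult_left_mono)
      have "ennreal \<bar>f 1 (- \<nu>) \<omega> t1\<bar> \<le> ennreal \<bar>f 1 \<nu> \<omega> t1\<bar> + j (\<nu>, \<omega>, t1)"
        using reflection t t1 unfolding t1eq by auto
      also have "ennreal \<bar>f 1 \<nu> \<omega> t1\<bar> \<le> ennreal (exp (- 1 / \<nu>) / \<nu>) * b + ?K * gain T E (?y t1) \<nu> \<omega> t1"
        using leg1[of t1] t t1 yt1 by simp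
      finally show "ennreal \<bar>f 1 (- \<nu>) \<omega> t1\<bar> \<le> ennreal (exp (- 1 / \<nu>) / \<nu>) * b + ?K * gain T E (?y t1) \<nu> \<omega> t1 + j (\<nu>, \<omega>, t1)"
        by (simp add: add_right_mono)
    qed simp
    also have "\<dots> = ennreal (exp (- ?y t / \<nu>) / \<nu>) * b + reflected_source j (?y t) \<nu> \<omega> t + ?x * (?K * gain T E (?y t1) \<nu> \<omega> t1)"
    proof -
      have "exp (- \<omega> * (t - t1)) * (exp (- 1 / \<nu>) / \<nu>) = exp (- ?y t / \<nu>) / \<nu>"
      proof -
        have "exp (- (y - 1) / \<nu>) * (exp (- 1 / \<nu>) / \<nu>) = exp (- y / \<nu>) / \<nu>" for y
        proof -
          have "- (y - 1) / \<nu> + - 1 / \<nu> = - y / \<nu>" using pos by (simp add: field_simps)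
          then show ?thesis by (metis exp_add times_divide_eq_right)
        qed
        then show ?thesis unfolding e1 .
      qed
      then have "?x * (ennreal (exp (- 1 / \<nu>) / \<nu>) * b) = ennreal (exp (- ?y t / \<nu>) / \<nu>) * b"
        using pos by (simp add: mult.assoc[symmetric] ennreal_mult[symmetric])
      then show ?thesis unfolding src by (simp add: distrib_left add_ac)
    qed
    finally have A: "?x * ennreal \<bar>f 1 (- \<nu>) \<omega> t1\<bar> \<le> ennreal (exp (- ?y t / \<nu>) / \<nu>) * b + reflected_source j (?y t) \<nu> \<omega> t + ?x * (?K * gain T E (?y t1) \<nu> \<omega> t1)" .
    \<comment> \<open>Multiplication by \<open>?x\<close> moves the gain collected up to
      \<open>t1\<close> to the time \<open>t\<close>. It then covers {..t1} and the tail covers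
      {t1..t}; they overlap in the null set {t1} and form the full gain at \<open>t\<close>.\<close>
    have B: "?x * (?K * gain T E (?y t1) \<nu> \<omega> t1) + ?tail \<le> ?K * gain T E (?y t) \<nu> \<omega> t"
    proof -
      have head: "?x * (?K * gain T E (?y t1) \<nu> \<omega> t1) = (\<integral>\<^sup>+s. ?K * (ennreal (exp (- \<omega> * (t - s))) * indicator {..t1} s * ?U (?y s, s)) \<partial>lborel)"
      proof -
        have e: "?x * ennreal (exp (- \<omega> * (t1 - s))) = ennreal (exp (- \<omega> * (t - s)))" for s
        proof -
          have "- \<omega> * (t - t1) + - \<omega> * (t1 - s) = - \<omega> * (t - s)" by (simp add: algebra_simps)
          then show ?thesis by (simp only: ennreal_mult[symmetric] exp_ge_zero exp_add[symmetric])
        qed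
        have "?K * (ennreal (exp (- \<omega> * (t - s))) * indicator {..t1} s * ?U (?y s, s))
          = ?x * (?K * (ennreal (exp (- \<omega> * (t1 - s))) * indicator {..t1} s * ?U (?y s, s)))" for s
          by (subst e[of s, symmetric]) (simp only: mult_ac)
        then show ?thesis
          unfolding gain_on_line[OF assms(5)] by (simp add: nn_integral_cmult)
      qed
      have "?x * (?K * gain T E (?y t1) \<nu> \<omega> t1) + ?tail = (\<integral>\<^sup>+s. ?K * (ennreal (exp (- \<omega> * (t - s))) * indicator {..t1} s * ?U (?y s, s))
          + ?K * (ennreal (exp (- \<omega> * (t - s))) * indicator {t1..t} s * ?U (?y s, s)) \<partial>lborel)"
        unfolding head by (rule nn_integral_add[symmetric]) measurable
      also have "\<dots> \<le> (\<integral>\<^sup>+s. ?K * (ennreal (exp (- \<omega> * (t - s))) * indicator {..t} s * ?U (?y s, s)) \<partial>lborel)"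
        using t1 by (intro nn_integral_mono_AE eventually_mono[OF AE_lborel_singleton[of t1]]) (auto split: split_indicator)
      also have "\<dots> = ?K * gain T E (?y t) \<nu> \<omega> t"
        unfolding gain_on_line[OF assms(5)] by (rule nn_integral_cmult) measurable
      finally show ?thesis .
    qed
    have "ennreal \<bar>f (2 - ?y t) (- \<nu>) \<omega> t\<bar> \<le> ?x * ennreal \<bar>f 1 (- \<nu>) \<omega> t1\<bar> + ?tail"
      using step unfolding yt1 by simp
    also have "\<dots> \<le> ennreal (exp (- ?y t / \<nu>) / \<nu>) * b + reflected_source j (?y t) \<nu> \<omega> t + (?x * (?K * gain T E (?y t1) \<nu> \<omega> t1) + ?tail)"
      using add_right_mono[OF A, of ?tail] by (simp add: add.assoc)
    also have "\<dots> \<le> ennreal (exp (- ?y t / \<nu>) / \<nu>) * b + reflected_source j (?y t) \<nu> \<omega> t + ?K * gain T E (?y t) \<nu> \<omega> t"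
      using B by (rule add_left_mono)
    finally show ?thesis .
  qed
qed

subsection \<open>Bounds for the intensity and the outgoing traces\<close>

text \<open>A measurable property holds almost everywhere iff the iterated integral of the indicator
  of its failure is zero, and such integrals may be taken in any order.\<close>

lemma AE_swap3:
  fixes P :: "real \<times> real \<times> real \<Rightarrow> bool"
  assumes [measurable]: "Measurable.pred (borel \<Otimes>\<^sub>M borel \<Otimes>\<^sub>M borel) P"
    and "AE x in lborel. AE y in lborel. AE z in lborel. P (x, y, z)"
  shows "AE z in lborel. AE x in lborel. AE y in lborel. P (x, y, z)"
proof -
  define F :: "real \<times> real \<times> real \<Rightarrow> ennreal" where "F w = (if P w then 0 else 1)" for w
  have [measurable]: "F \<in> borel_measurable (borel \<Otimes>\<^sub>M borel \<Otimes>\<^sub>M borel)" unfolding F_def by measurable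
  have F0: "F w = 0 \<longleftrightarrow> P w" for w by (simp add: F_def)
  have "(\<integral>\<^sup>+x. \<integral>\<^sup>+y. \<integral>\<^sup>+z. F (x, y, z) \<partial>lborel \<partial>lborel \<partial>lborel) = 0"
    using assms(2) by (simp add: nn_integral_0_iff_AE F0)
  also have "(\<integral>\<^sup>+x. \<integral>\<^sup>+y. \<integral>\<^sup>+z. F (x, y, z) \<partial>lborel \<partial>lborel \<partial>lborel)
    = (\<integral>\<^sup>+x. \<integral>\<^sup>+z. \<integral>\<^sup>+y. F (x, y, z) \<partial>lborel \<partial>lborel \<partial>lborel)"
    by (intro nn_integral_cong lborel_pair.Fubini') measurable
  also have "\<dots> = (\<integral>\<^sup>+z. \<integral>\<^sup>+x. \<integral>\<^sup>+y. F (x, y, z) \<partial>lborel \<partial>lborel \<partial>lborel)"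
    by (intro lborel_pair.Fubini') measurable
  finally show ?thesis by (simp add: nn_integral_0_iff_AE F0)
qed

lemma AE_swap3_left:
  fixes P :: "real \<times> real \<times> real \<Rightarrow> bool"
  assumes [measurable]: "Measurable.pred (borel \<Otimes>\<^sub>M borel \<Otimes>\<^sub>M borel) P"
    and "AE x in lborel. AE y in lborel. AE z in lborel. P (x, y, z)"
  shows "AE y in lborel. AE x in lborel. AE z in lborel. P (x, y, z)"
proof -
  define F :: "real \<times> real \<times> real \<Rightarrow> ennreal" where "F w = (if P w then 0 else 1)" for w
  have [measurable]: "F \<in> borel_measurable (borel \<Otimes>\<^sub>M borel \<Otimes>\<^sub>M borel)" unfolding F_def by measurable
  have F0: "F w = 0 \<longleftrightarrow> P w" for w by (simp add: F_def)
  have "(\<integral>\<^sup>+x. \<integral>\<^sup>+y. \<integral>\<^sup>+z. F (x, y, z) \<partial>lborel \<partial>lborel \<partial>lborel) = 0"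
    using assms(2) by (simp add: nn_integral_0_iff_AE F0)
  also have "(\<integral>\<^sup>+x. \<integral>\<^sup>+y. \<integral>\<^sup>+z. F (x, y, z) \<partial>lborel \<partial>lborel \<partial>lborel)
    = (\<integral>\<^sup>+y. \<integral>\<^sup>+x. \<integral>\<^sup>+z. F (x, y, z) \<partial>lborel \<partial>lborel \<partial>lborel)"
    by (intro lborel_pair.Fubini') measurable
  finally show ?thesis by (simp add: nn_integral_0_iff_AE F0)
qed

lemma nn_integral_symmetric_interval:
  fixes h :: "real \<Rightarrow> ennreal"
  assumes [measurable]: "h \<in> borel_measurable borel" and "\<And>\<mu>. \<mu> \<notin> {-1..1} \<Longrightarrow> h \<mu> = 0"
  shows "(\<integral>\<^sup>+\<mu>. h \<mu> \<partial>lborel) = (\<integral>\<^sup>+\<nu>. indicator {0<..1} \<nu> * (h \<nu> + h (- \<nu>)) \<partial>lborel)"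
proof -
  have "(\<integral>\<^sup>+\<mu>. h \<mu> \<partial>lborel) = (\<integral>\<^sup>+\<mu>. indicator {0<..1} \<mu> * h \<mu> + indicator {0<..1} (- \<mu>) * h \<mu> \<partial>lborel)"
    using assms(2)
    by (intro nn_integral_cong_AE eventually_mono[OF AE_lborel_singleton[of 0]]) (auto split: split_indicator)
  also have "\<dots> = (\<integral>\<^sup>+\<mu>. indicator {0<..1} \<mu> * h \<mu> \<partial>lborel) + (\<integral>\<^sup>+\<mu>. indicator {0<..1} (- \<mu>) * h \<mu> \<partial>lborel)"
    by (rule nn_integral_add) measurable
  also have "(\<integral>\<^sup>+\<mu>. indicator {0<..1} (- \<mu>) * h \<mu> \<partial>lborel) = (\<integral>\<^sup>+\<nu>. indicator {0<..1} \<nu> * h (- \<nu>) \<partial>lborel)"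
    using nn_integral_flip[of "\<lambda>\<nu>. indicator {0<..1} \<nu> * h (- \<nu>)" 0] by simp
  finally show ?thesis by (simp add: nn_integral_add[symmetric] distrib_left)
qed

text \<open>Serves two purposes. For one solution, \<open>r\<close> is its moment, \<open>E\<close>
  its intensity and \<open>j\<close> = 0; for the difference of two solutions with the same datum,
  \<open>b\<close> = 0 and \<open>j\<close> is the defect in the reflection law. \<open>E\<close> is
  a measurable majorant of the scattering term and may be infinite at some points.\<close>

locale transport =
  fixes T :: real and f :: "real \<Rightarrow> real \<Rightarrow> real \<Rightarrow> real \<Rightarrow> real" and r :: "real \<Rightarrow> real \<Rightarrow> real"
    and E :: "real \<times> real \<Rightarrow> ennreal" and b :: "real \<Rightarrow> ennreal" and j :: "real \<times> real \<times> real \<Rightarrow> ennreal"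
  assumes T_pos: "0 < T"
    and modulus_measurable [measurable]: "modulus T f \<in> borel_measurable (borel \<Otimes>\<^sub>M borel \<Otimes>\<^sub>M borel \<Otimes>\<^sub>M borel)"
    and E_measurable [measurable]: "E \<in> borel_measurable (borel \<Otimes>\<^sub>M borel)"
    and b_measurable [measurable]: "b \<in> borel_measurable borel"
    and j_measurable [measurable]: "j \<in> borel_measurable (borel \<Otimes>\<^sub>M borel \<Otimes>\<^sub>M borel)"
    and mild: "AE \<mu> in lborel. AE \<omega> in lborel. AE c in lborel. \<mu> \<in> {-1..1} \<and> 0 < \<omega> \<longrightarrow>
       mild_on_line T f (\<lambda>x \<mu> \<omega> t. - \<omega> * f x \<mu> \<omega> t + \<omega> * gstar \<omega> / scattering_rate * r x t) \<mu> \<omega> c"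
    and rE: "\<And>x t. x \<in> {0..1} \<Longrightarrow> t \<in> {0..T} \<Longrightarrow> ennreal \<bar>r x t\<bar> \<le> E (x, t)"
    and initial: "AE \<mu> in lborel. AE \<omega> in lborel. AE x in lborel.
       x \<in> {0..1} \<and> \<mu> \<in> {-1..1} \<and> 0 < \<omega> \<longrightarrow> f x \<mu> \<omega> 0 = 0"
    and inflow: "AE \<nu> in lborel. AE \<omega> in lborel. AE t in lborel.
       \<nu> \<in> {0<..1} \<and> 0 < \<omega> \<and> t \<in> {0..T} \<longrightarrow> ennreal \<bar>f 0 \<nu> \<omega> t\<bar> \<le> ennreal (1 / \<nu>) * b \<omega>"
    and reflection: "AE \<nu> in lborel. AE \<omega> in lborel. AE t in lborel.
       \<nu> \<in> {0<..1} \<and> 0 < \<omega> \<and> t \<in> {0..T} \<longrightarrow>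
       ennreal \<bar>f 1 (- \<nu>) \<omega> t\<bar> \<le> ennreal \<bar>f 1 \<nu> \<omega> t\<bar> + j (\<nu>, \<omega>, t)"
begin

definition source :: "real \<Rightarrow> real \<Rightarrow> real \<Rightarrow> real \<Rightarrow> ennreal" where
  "source y \<nu> \<omega> t = ennreal (exp (- y / \<nu>) / \<nu>) * b \<omega> + ennreal (\<omega> * gstar \<omega>) / (2 * gstar_mass) * gain T E y \<nu> \<omega> t"

lemma source_measurable [measurable]:
  assumes [measurable]: "a1 \<in> borel_measurable M" "a2 \<in> borel_measurable M" "a3 \<in> borel_measurable M" "a4 \<in> borel_measurable M"
  shows "(\<lambda>z. source (a1 z) (a2 z) (a3 z) (a4 z)) \<in> borel_measurable M"
  unfolding source_def by measurable

lemma reflected_source_measurable [measurable]: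
  assumes [measurable]: "a1 \<in> borel_measurable M" "a2 \<in> borel_measurable M" "a3 \<in> borel_measurable M" "a4 \<in> borel_measurable M"
  shows "(\<lambda>z. reflected_source j (a1 z) (a2 z) (a3 z) (a4 z)) \<in> borel_measurable M"
  unfolding reflected_source_def by measurable

text \<open>For almost every line the bounds hold at all its times simultaneously; the quantifier
  over \<open>t\<close> inside is what later allows an exchange of \<open>c\<close> against
  \<open>t\<close>.\<close>

lemma AE_lines:
  "AE \<nu> in lborel. AE \<omega> in lborel. AE c in lborel. \<nu> \<in> {0<..1} \<and> 0 < \<omega> \<longrightarrow> (\<forall>t\<in>{0..T}.
     (c + \<nu> * \<omega> * t \<in> {0..1} \<longrightarrow> ennreal \<bar>f (c + \<nu> * \<omega> * t) \<nu> \<omega> t\<bar> \<le> source (c + \<nu> * \<omega> * t) \<nu> \<omega> t) \<and>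
     (c + \<nu> * \<omega> * t \<in> {1..2} \<longrightarrow> ennreal \<bar>f (2 - (c + \<nu> * \<omega> * t)) (- \<nu>) \<omega> t\<bar>
        \<le> reflected_source j (c + \<nu> * \<omega> * t) \<nu> \<omega> t + source (c + \<nu> * \<omega> * t) \<nu> \<omega> t))"
proof -
  let ?m = "\<lambda>\<mu> \<omega> c. mild_on_line T f (\<lambda>x \<mu> \<omega> t. - \<omega> * f x \<mu> \<omega> t + \<omega> * gstar \<omega> / scattering_rate * r x t) \<mu> \<omega> c"
  note mild' = AE_lborel_uminus[OF mild] and initial' = AE_lborel_uminus[OF initial]
  show ?thesis
    using mild mild' initial initial' inflow reflection
  proof eventually_elim
    case (elim \<nu>)
    show ?case
      using elim
    proof eventually_elim
      case (elim \<omega>)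
      show ?case
      proof (cases "\<nu> \<in> {0<..1} \<and> 0 < \<omega>")
        case True
        then have v: "1 / (\<nu> * \<omega>) \<noteq> 0" by simp
        \<comment> \<open>The returning leg uses the line with parameter 2 - c, and the boundary
          conditions are used at the times -c/(\<nu>\<omega>) and (1 - c)/(\<nu>\<omega>). All of
          these are affine in \<open>c\<close> with nonzero slope, so the given null sets pull back
          to null sets of lines.\<close>
        note ret = AE_lborel_reflect[OF elim(2), of 2] and init_ret = AE_lborel_reflect[OF elim(4), of 2]
        have infl: "AE c in lborel. \<nu> \<in> {0<..1} \<and> 0 < \<omega> \<and> - c / (\<nu> * \<omega>) \<in> {0..T} \<longrightarrow>
            ennreal \<bar>f 0 \<nu> \<omega> (- c / (\<nu> * \<omega>))\<bar> \<le> ennreal (1 / \<nu>) * b \<omega>"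
          using AE_lborel_affine[OF _ elim(5), of "- (1 / (\<nu> * \<omega>))" 0] v by simp
        have refl: "AE c in lborel. \<nu> \<in> {0<..1} \<and> 0 < \<omega> \<and> (1 - c) / (\<nu> * \<omega>) \<in> {0..T} \<longrightarrow>
            ennreal \<bar>f 1 (- \<nu>) \<omega> ((1 - c) / (\<nu> * \<omega>))\<bar>
              \<le> ennreal \<bar>f 1 \<nu> \<omega> ((1 - c) / (\<nu> * \<omega>))\<bar> + j (\<nu>, \<omega>, (1 - c) / (\<nu> * \<omega>))"
          using AE_lborel_affine[OF _ elim(6), of "- (1 / (\<nu> * \<omega>))" "1 / (\<nu> * \<omega>)"] v
          by (simp add: diff_divide_distrib)
        show ?thesis
          using elim(1) ret elim(3) init_ret infl refl
        proof eventually_elim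
          case (elim c)
          have bound: "(c + \<nu> * \<omega> * t \<in> {0..1} \<longrightarrow> ennreal \<bar>f (c + \<nu> * \<omega> * t) \<nu> \<omega> t\<bar> \<le> source (c + \<nu> * \<omega> * t) \<nu> \<omega> t) \<and>
            (c + \<nu> * \<omega> * t \<in> {1..2} \<longrightarrow> ennreal \<bar>f (2 - (c + \<nu> * \<omega> * t)) (- \<nu>) \<omega> t\<bar>
            \<le> reflected_source j (c + \<nu> * \<omega> * t) \<nu> \<omega> t + source (c + \<nu> * \<omega> * t) \<nu> \<omega> t)" if t: "t \<in> {0..T}" for t
          proof (intro conjI impI)
            assume "c + \<nu> * \<omega> * t \<in> {0..1}"
            then show "ennreal \<bar>f (c + \<nu> * \<omega> * t) \<nu> \<omega> t\<bar> \<le> source (c + \<nu> * \<omega> * t) \<nu> \<omega> t"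
              unfolding source_def using True t elim
              by (intro unfolded_line_bound(1)[where r=r and j=j] rE E_measurable) auto
          next
            assume "c + \<nu> * \<omega> * t \<in> {1..2}"
            then have "ennreal \<bar>f (2 - (c + \<nu> * \<omega> * t)) (- \<nu>) \<omega> t\<bar>
              \<le> ennreal (exp (- (c + \<nu> * \<omega> * t) / \<nu>) / \<nu>) * b \<omega> + reflected_source j (c + \<nu> * \<omega> * t) \<nu> \<omega> t
              + ennreal (\<omega> * gstar \<omega>) / (2 * gstar_mass) * gain T E (c + \<nu> * \<omega> * t) \<nu> \<omega> t"
              using True t elim
              by (intro unfolded_line_bound(2)[where r=r and j=j] rE E_measurable) auto
            then show "ennreal \<bar>f (2 - (c + \<nu> * \<omega> * t)) (- \<nu>) \<omega> t\<bar>
              \<le> reflected_source j (c + \<nu> * \<omega> * t) \<nu> \<omega> t + source (c + \<nu> * \<omega> * t) \<nu> \<omega> t"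
              unfolding source_def by (simp add: add_ac)
          qed
          then show ?case by blast
        qed
      qed auto
    qed
  qed
qed

text \<open>Through (y, t) passes the line with c = y - \<nu>\<omega>t. For fixed y this is affine
  in t, so almost every line means almost every time: traces at a fixed position, in particular at
  the walls, are controlled.\<close>

lemma modulus_out_le:
  assumes "y \<in> {0..1}"
  shows "AE \<nu> in lborel. AE \<omega> in lborel. AE t in lborel. \<nu> \<in> {0<..1} \<longrightarrow> modulus T f (y, \<nu>, \<omega>, t) \<le> source y \<nu> \<omega> t"
  using AE_lines
proof eventually_elim
  case (elim \<nu>)
  show ?case using elim
  proof eventually_elim
    case (elim \<omega>)
    show ?case
    proof (cases "\<nu> \<in> {0<..1} \<and> 0 < \<omega>")
      case True
      have nz: "- (\<nu> * \<omega>) \<noteq> 0" using True by simp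
      have "AE t in lborel. modulus T f (y, \<nu>, \<omega>, t) \<le> source y \<nu> \<omega> t"
        using AE_lborel_affine[OF nz elim, of y]
      proof eventually_elim
        case (elim t)
        have z: "y + - (\<nu> * \<omega>) * t + \<nu> * \<omega> * t = y" by simp
        show ?case
        proof (cases "t \<in> {0..T}")
          case t: True
          show ?thesis using bspec[OF mp[OF elim True] t] assms unfolding z by (auto simp: modulus_def split: split_indicator)
        qed (auto simp: modulus_def)
      qed
      then show ?thesis by auto
    qed (auto simp: modulus_def)
  qed
qed

lemma modulus_return_le:
  assumes "x \<in> {0..1}"
  shows "AE \<nu> in lborel. AE \<omega> in lborel. AE t in lborel. \<nu> \<in> {0<..1} \<longrightarrow>
    modulus T f (x, - \<nu>, \<omega>, t) \<le> reflected_source j (2 - x) \<nu> \<omega> t + source (2 - x) \<nu> \<omega> t"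
  using AE_lines
proof eventually_elim
  case (elim \<nu>)
  show ?case using elim
  proof eventually_elim
    case (elim \<omega>)
    show ?case
    proof (cases "\<nu> \<in> {0<..1} \<and> 0 < \<omega>")
      case True
      define y where "y = 2 - x"
      have y: "y \<in> {1..2}" "2 - y = x" using assms by (auto simp: y_def)
      have nz: "- (\<nu> * \<omega>) \<noteq> 0" using True by simp
      have "AE t in lborel. modulus T f (x, - \<nu>, \<omega>, t) \<le> reflected_source j y \<nu> \<omega> t + source y \<nu> \<omega> t"
        using AE_lborel_affine[OF nz elim, of y]
      proof eventually_elim
        case (elim t)
        have z: "y + - (\<nu> * \<omega>) * t + \<nu> * \<omega> * t = y" by simp
        show ?case
        proof (cases "t \<in> {0..T}")
          case t: True
          show ?thesis using bspec[OF mp[OF elim True] t] y(1) unfolding z y(2) by (auto simp: modulus_def split: split_indicator)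
        qed (auto simp: modulus_def)
      qed
      then show ?thesis unfolding y_def by auto
    qed (auto simp: modulus_def)
  qed
qed

lemma intensity_split:
  "intensity T f (x, t) = (\<integral>\<^sup>+\<nu>. \<integral>\<^sup>+\<omega>. indicator ({0<..1} \<times> {0<..}) (\<nu>, \<omega>) *
     (ennreal \<omega> * (modulus T f (x, \<nu>, \<omega>, t) + modulus T f (x, - \<nu>, \<omega>, t))) \<partial>lborel \<partial>lborel)"
proof -
  define h where "h \<mu> = (\<integral>\<^sup>+\<omega>. ennreal \<omega> * modulus T f (x, \<mu>, \<omega>, t) \<partial>lborel)" for \<mu>
  have [measurable]: "h \<in> borel_measurable borel" unfolding h_def by measurable
  have "intensity T f (x, t) = (\<integral>\<^sup>+\<mu>. h \<mu> \<partial>lborel)" by (simp add: intensity_def h_def)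
  also have "\<dots> = (\<integral>\<^sup>+\<nu>. indicator {0<..1} \<nu> * (h \<nu> + h (- \<nu>)) \<partial>lborel)"
  proof (rule nn_integral_symmetric_interval)
    fix \<mu> :: real assume "\<mu> \<notin> {-1..1}"
    then have "modulus T f (x, \<mu>, \<omega>, t) = 0" for \<omega> by (auto simp: modulus_def)
    then show "h \<mu> = 0" by (simp add: h_def)
  qed measurable
  also have "\<dots> = (\<integral>\<^sup>+\<nu>. \<integral>\<^sup>+\<omega>. indicator {0<..1} \<nu> * (ennreal \<omega> * (modulus T f (x, \<nu>, \<omega>, t) + modulus T f (x, - \<nu>, \<omega>, t))) \<partial>lborel \<partial>lborel)"
    unfolding h_def by (simp add: nn_integral_cmult nn_integral_add distrib_left)
  also have "\<dots> = (\<integral>\<^sup>+\<nu>. \<integral>\<^sup>+\<omega>. indicator ({0<..1} \<times> {0<..}) (\<nu>, \<omega>) *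
     (ennreal \<omega> * (modulus T f (x, \<nu>, \<omega>, t) + modulus T f (x, - \<nu>, \<omega>, t))) \<partial>lborel \<partial>lborel)"
    by (intro nn_integral_cong) (auto simp: modulus_def split: split_indicator)
  finally show ?thesis .
qed

definition reflected_intensity :: "real \<times> real \<Rightarrow> ennreal" where
  "reflected_intensity = (\<lambda>(x, t). \<integral>\<^sup>+\<nu>. \<integral>\<^sup>+\<omega>. indicator ({0<..1} \<times> {0<..}) (\<nu>, \<omega>) *
     (ennreal \<omega> * reflected_source j (2 - x) \<nu> \<omega> t) \<partial>lborel \<partial>lborel)"

lemma reflected_intensity_measurable [measurable]: "reflected_intensity \<in> borel_measurable (borel \<Otimes>\<^sub>M borel)"
  unfolding reflected_intensity_def by measurable

lemma intensity_measurable [measurable]: "intensity T f \<in> borel_measurable (borel \<Otimes>\<^sub>M borel)"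
  unfolding intensity_def by measurable

text \<open>The direct and the returning unscattered parts have travelled the distances x and 2 - x
  \<ge> x, so both obey the separated bound with x^(-1/4). The constant is 8 = 2 * 4, two sheets
  times the integral of \<nu>^(-3/4).\<close>

lemma intensity_le:
  assumes x: "x \<in> {0<..1}"
  shows "AE t in lborel. intensity T f (x, t) \<le>
    8 * (\<integral>\<^sup>+\<omega>. ennreal \<omega> * b \<omega> * indicator {0<..} \<omega> \<partial>lborel) * ennreal (x powr - (1/4))
    + reflected_intensity (x, t) + scattering T E (x, t)"
proof -
  let ?W = "\<integral>\<^sup>+\<omega>. ennreal \<omega> * b \<omega> * indicator {0<..} \<omega> \<partial>lborel"
  define F where "F = (\<lambda>(\<nu>, \<omega>, t). modulus T f (x, \<nu>, \<omega>, t) + modulus T f (x, - \<nu>, \<omega>, t))"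
  define H where "H = (\<lambda>(\<nu>, \<omega>, t). source x \<nu> \<omega> t + (reflected_source j (2 - x) \<nu> \<omega> t + source (2 - x) \<nu> \<omega> t))"
  define P where "P w \<longleftrightarrow> (fst w \<in> {0<..1} \<longrightarrow> F w \<le> H w)" for w :: "real \<times> real \<times> real"
  have F_meas [measurable]: "F \<in> borel_measurable (borel \<Otimes>\<^sub>M borel \<Otimes>\<^sub>M borel)" unfolding F_def by measurable
  have H_meas [measurable]: "H \<in> borel_measurable (borel \<Otimes>\<^sub>M borel \<Otimes>\<^sub>M borel)" unfolding H_def by measurable
  have P_meas: "Measurable.pred (borel \<Otimes>\<^sub>M borel \<Otimes>\<^sub>M borel) P" unfolding P_def by measurable
  have "AE \<nu> in lborel. AE \<omega> in lborel. AE t in lborel. P (\<nu>, \<omega>, t)"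
  proof -
    have x': "x \<in> {0..1}" using x by auto
    show ?thesis
      using modulus_out_le[OF x'] modulus_return_le[OF x']
    proof eventually_elim
      case (elim \<nu>)
      show ?case using elim
      proof eventually_elim
        case (elim \<omega>)
        show ?case using elim by eventually_elim (auto simp: P_def F_def H_def intro: add_mono)
      qed
    qed
  qed
  \<comment> \<open>The intensity integrates over \<nu> and \<omega> at fixed (x, t), so
    \<open>t\<close> has to become the outermost variable.\<close>
  from AE_swap3[OF P_meas this]
  have "AE t in lborel. AE \<nu> in lborel. AE \<omega> in lborel. \<nu> \<in> {0<..1} \<longrightarrow>
    modulus T f (x, \<nu>, \<omega>, t) + modulus T f (x, - \<nu>, \<omega>, t)
      \<le> source x \<nu> \<omega> t + (reflected_source j (2 - x) \<nu> \<omega> t + source (2 - x) \<nu> \<omega> t)"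
    unfolding P_def F_def H_def prod.case fst_conv .
  then show ?thesis
  proof eventually_elim
    case (elim t)
    let ?i = "\<lambda>\<nu> \<omega>. indicator ({0<..1} \<times> {0<..}) (\<nu>, \<omega>) :: ennreal"
    let ?K = "\<lambda>\<omega>. ennreal (\<omega> * gstar \<omega>) / (2 * gstar_mass)"
    have "intensity T f (x, t) \<le> (\<integral>\<^sup>+\<nu>. \<integral>\<^sup>+\<omega>. ?i \<nu> \<omega> * (ennreal \<omega> *
      (source x \<nu> \<omega> t + (reflected_source j (2 - x) \<nu> \<omega> t + source (2 - x) \<nu> \<omega> t))) \<partial>lborel \<partial>lborel)"
      unfolding intensity_split
    proof (rule nn_integral_mono_AE)
      show "AE \<nu> in lborel. (\<integral>\<^sup>+\<omega>. ?i \<nu> \<omega> * (ennreal \<omega> * (modulus T f (x, \<nu>, \<omega>, t) + modulus T f (x, - \<nu>, \<omega>, t))) \<partial>lborel)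
        \<le> (\<integral>\<^sup>+\<omega>. ?i \<nu> \<omega> * (ennreal \<omega> * (source x \<nu> \<omega> t + (reflected_source j (2 - x) \<nu> \<omega> t + source (2 - x) \<nu> \<omega> t))) \<partial>lborel)"
        using elim
      proof eventually_elim
        case (elim \<nu>)
        then show ?case
          by (intro nn_integral_mono_AE) (auto elim!: eventually_mono split: split_indicator intro!: mult_left_mono)
      qed
    qed
    also have "\<dots> \<le> (\<integral>\<^sup>+\<nu>. \<integral>\<^sup>+\<omega>. (2 * ennreal (x powr - (1/4)) * (ennreal (\<nu> powr - (3/4)) * indicator {0<..1} \<nu>)) * (ennreal \<omega> * b \<omega> * indicator {0<..} \<omega>)
      + ?i \<nu> \<omega> * (ennreal \<omega> * reflected_source j (2 - x) \<nu> \<omega> t)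
      + ?i \<nu> \<omega> * (ennreal (\<omega> * (\<omega> * gstar \<omega>)) / (2 * gstar_mass) * (gain T E x \<nu> \<omega> t + gain T E (2 - x) \<nu> \<omega> t)) \<partial>lborel \<partial>lborel)"
    proof (intro nn_integral_mono)
      fix \<nu> \<omega> :: real
      show "?i \<nu> \<omega> * (ennreal \<omega> * (source x \<nu> \<omega> t + (reflected_source j (2 - x) \<nu> \<omega> t + source (2 - x) \<nu> \<omega> t)))
        \<le> (2 * ennreal (x powr - (1/4)) * (ennreal (\<nu> powr - (3/4)) * indicator {0<..1} \<nu>)) * (ennreal \<omega> * b \<omega> * indicator {0<..} \<omega>)
        + ?i \<nu> \<omega> * (ennreal \<omega> * reflected_source j (2 - x) \<nu> \<omega> t)
        + ?i \<nu> \<omega> * (ennreal (\<omega> * (\<omega> * gstar \<omega>)) / (2 * gstar_mass) * (gain T E x \<nu> \<omega> t + gain T E (2 - x) \<nu> \<omega> t))"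
      proof (cases "\<nu> \<in> {0<..1} \<and> 0 < \<omega>")
        case True
        have K: "ennreal \<omega> * ?K \<omega> = ennreal (\<omega> * (\<omega> * gstar \<omega>)) / (2 * gstar_mass)"
          using True gstar_nonneg[of \<omega>] by (simp add: ennreal_mult divide_ennreal_def mult.assoc)
        let ?p = "ennreal (x powr - (1/4)) * ennreal (\<nu> powr - (3/4))"
        have p: "ennreal (exp (- y / \<nu>) / \<nu>) \<le> ?p" if "x \<le> y" for y
        proof -
          have "exp (- y / \<nu>) / \<nu> \<le> exp (- x / \<nu>) / \<nu>"
            using True that by (auto intro!: divide_right_mono)
          also have "\<dots> \<le> x powr - (1/4) * \<nu> powr - (3/4)" using exp_div_le_powr[of x \<nu>] True x by auto
          finally show ?thesis by (simp add: ennreal_mult[symmetric] ennreal_leI)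
        qed
        have "ennreal \<omega> * (source x \<nu> \<omega> t + (reflected_source j (2 - x) \<nu> \<omega> t + source (2 - x) \<nu> \<omega> t))
          = (ennreal (exp (- x / \<nu>) / \<nu>) + ennreal (exp (- (2 - x) / \<nu>) / \<nu>)) * (ennreal \<omega> * b \<omega>)
            + ennreal \<omega> * reflected_source j (2 - x) \<nu> \<omega> t
            + (ennreal \<omega> * ?K \<omega>) * (gain T E x \<nu> \<omega> t + gain T E (2 - x) \<nu> \<omega> t)"
          unfolding source_def by (simp only: distrib_left distrib_right mult_ac add_ac)
        also have "\<dots> \<le> (?p + ?p) * (ennreal \<omega> * b \<omega>) + ennreal \<omega> * reflected_source j (2 - x) \<nu> \<omega> t
            + (ennreal \<omega> * ?K \<omega>) * (gain T E x \<nu> \<omega> t + gain T E (2 - x) \<nu> \<omega> t)"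
          using x by (intro add_mono mult_right_mono p order_refl) auto
        finally show ?thesis unfolding K using True by (simp add: mult_2[symmetric] mult.assoc)
      qed auto
    qed
    also have "\<dots> = 2 * ennreal (x powr - (1/4)) * 4 * ?W + reflected_intensity (x, t) + scattering T E (x, t)"
      unfolding reflected_intensity_def scattering_def
      by (simp add: nn_integral_add nn_integral_cmult nn_integral_multc ennreal_quarter_integral)
    finally show ?case by (simp add: mult_ac)
  qed
qed

lemma mass_mono_AE:
  assumes "\<And>x. x \<in> {0<..1} \<Longrightarrow> AE t in lborel. t \<in> {0..T} \<longrightarrow> F (x, t) \<le> H (x, t)"
  shows "mass T F \<le> mass T H"
  unfolding mass_def
proof (rule nn_integral_mono_AE, rule eventually_mono[OF AE_lborel_singleton[of 0]])
  fix x :: real assume "x \<noteq> 0"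
  show "(\<integral>\<^sup>+t. indicator ({0..1} \<times> {0..T}) (x, t) * F (x, t) \<partial>lborel) \<le> (\<integral>\<^sup>+t. indicator ({0..1} \<times> {0..T}) (x, t) * H (x, t) \<partial>lborel)"
  proof (cases "x \<in> {0<..1}")
    case True
    from assms[OF True] show ?thesis
      by (intro nn_integral_mono_AE) (auto elim!: eventually_mono split: split_indicator)
  next
    case False
    with \<open>x \<noteq> 0\<close> have "indicator ({0..1} \<times> {0..T}) (x, t) = (0 :: ennreal)" for t by auto
    then show ?thesis by simp
  qed
qed

text \<open>Shifting time back to the moment of reflection decouples \<open>j\<close> from x. The
  attenuation exp(-(1 - x)/\<nu>) then integrates over x \<le> 1 to \<nu>, so the mass is bounded by
  the flux of the defect through the wall, with weight \<nu>\<omega>.\<close>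

lemma mass_reflected_intensity:
  "mass T reflected_intensity \<le> (\<integral>\<^sup>+\<nu>. \<integral>\<^sup>+\<omega>. \<integral>\<^sup>+t. indicator ({0<..1} \<times> {0<..} \<times> {0..T}) (\<nu>, \<omega>, t) * (ennreal (\<nu> * \<omega>) * j (\<nu>, \<omega>, t)) \<partial>lborel \<partial>lborel \<partial>lborel)"
proof -
  let ?i = "\<lambda>\<nu> \<omega>. indicator ({0<..1} \<times> {0<..}) (\<nu>, \<omega>) :: ennreal"
  have "mass T reflected_intensity = (\<integral>\<^sup>+x. \<integral>\<^sup>+t. \<integral>\<^sup>+\<nu>. \<integral>\<^sup>+\<omega>. indicator ({0..1} \<times> {0..T}) (x, t) * (?i \<nu> \<omega> * (ennreal \<omega> * reflected_source j (2 - x) \<nu> \<omega> t)) \<partial>lborel \<partial>lborel \<partial>lborel \<partial>lborel)"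
    unfolding mass_def reflected_intensity_def by (simp add: nn_integral_cmult)
  also have "\<dots> = (\<integral>\<^sup>+\<nu>. \<integral>\<^sup>+\<omega>. \<integral>\<^sup>+x. \<integral>\<^sup>+t. indicator ({0..1} \<times> {0..T}) (x, t) * (?i \<nu> \<omega> * (ennreal \<omega> * reflected_source j (2 - x) \<nu> \<omega> t)) \<partial>lborel \<partial>lborel \<partial>lborel \<partial>lborel)"
    using nn_integral_swap4[of "\<lambda>(x, t, \<nu>, \<omega>). indicator ({0..1} \<times> {0..T}) (x, t) * (?i \<nu> \<omega> * (ennreal \<omega> * reflected_source j (2 - x) \<nu> \<omega> t))"]
    by simp
  also have "\<dots> \<le> (\<integral>\<^sup>+\<nu>. \<integral>\<^sup>+\<omega>. \<integral>\<^sup>+t. indicator ({0<..1} \<times> {0<..} \<times> {0..T}) (\<nu>, \<omega>, t) * (ennreal (\<nu> * \<omega>) * j (\<nu>, \<omega>, t)) \<partial>lborel \<partial>lborel \<partial>lborel)"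
  proof (rule nn_integral_mono, rule nn_integral_mono)
    fix \<nu> \<omega> :: real
    define J where "J = (\<integral>\<^sup>+t. indicator {0..T} t * j (\<nu>, \<omega>, t) \<partial>lborel)"
    show "(\<integral>\<^sup>+x. \<integral>\<^sup>+t. indicator ({0..1} \<times> {0..T}) (x, t) * (?i \<nu> \<omega> * (ennreal \<omega> * reflected_source j (2 - x) \<nu> \<omega> t)) \<partial>lborel \<partial>lborel)
      \<le> (\<integral>\<^sup>+t. indicator ({0<..1} \<times> {0<..} \<times> {0..T}) (\<nu>, \<omega>, t) * (ennreal (\<nu> * \<omega>) * j (\<nu>, \<omega>, t)) \<partial>lborel)"
    proof (cases "\<nu> \<in> {0<..1} \<and> 0 < \<omega>")
      case True
      have inner: "(\<integral>\<^sup>+t. indicator ({0..1} \<times> {0..T}) (x, t) * (?i \<nu> \<omega> * (ennreal \<omega> * reflected_source j (2 - x) \<nu> \<omega> t)) \<partial>lborel)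
        \<le> ennreal \<omega> * J * (ennreal (exp (- (1 / \<nu>) * (1 - x))) * indicator {0..} (1 - x))" for x
      proof (cases "x \<in> {0..1}")
        case x: True
        define a where "a = (2 - x - 1) / (\<nu> * \<omega>)"
        have "0 \<le> a" using x True by (simp add: a_def)
        have "(\<integral>\<^sup>+t. indicator ({0..1} \<times> {0..T}) (x, t) * (?i \<nu> \<omega> * (ennreal \<omega> * reflected_source j (2 - x) \<nu> \<omega> t)) \<partial>lborel)
          \<le> (\<integral>\<^sup>+t. (ennreal \<omega> * ennreal (exp (- (2 - x - 1) / \<nu>))) * (indicator {0..T} (t - a) * j (\<nu>, \<omega>, t - a)) \<partial>lborel)"
          using \<open>0 \<le> a\<close> unfolding reflected_source_def a_def[symmetric]
          by (intro nn_integral_mono) (auto split: split_indicator simp: mult_ac)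
        also have "\<dots> = (ennreal \<omega> * ennreal (exp (- (2 - x - 1) / \<nu>))) * (\<integral>\<^sup>+t. indicator {0..T} (t - a) * j (\<nu>, \<omega>, t - a) \<partial>lborel)"
          by (rule nn_integral_cmult) measurable
        also have "(\<integral>\<^sup>+t. indicator {0..T} (t - a) * j (\<nu>, \<omega>, t - a) \<partial>lborel) = J"
          unfolding J_def by (rule nn_integral_shift) measurable
        finally have "(\<integral>\<^sup>+t. indicator ({0..1} \<times> {0..T}) (x, t) * (?i \<nu> \<omega> * (ennreal \<omega> * reflected_source j (2 - x) \<nu> \<omega> t)) \<partial>lborel)
          \<le> ennreal \<omega> * ennreal (exp (- (2 - x - 1) / \<nu>)) * J" .
        moreover have "- (2 - x - 1) / \<nu> = - (1 / \<nu>) * (1 - x)" using True by (simp add: field_simps)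
        moreover have "indicator {0..} (1 - x) = (1 :: ennreal)" using x by simp
        ultimately show ?thesis by (simp only: mult_1_right mult.assoc mult.commute[of J])
      qed auto
      have "(\<integral>\<^sup>+x. \<integral>\<^sup>+t. indicator ({0..1} \<times> {0..T}) (x, t) * (?i \<nu> \<omega> * (ennreal \<omega> * reflected_source j (2 - x) \<nu> \<omega> t)) \<partial>lborel \<partial>lborel)
        \<le> (\<integral>\<^sup>+x. ennreal \<omega> * J * (ennreal (exp (- (1 / \<nu>) * (1 - x))) * indicator {0..} (1 - x)) \<partial>lborel)"
        by (rule nn_integral_mono) (rule inner)
      also have "\<dots> = ennreal \<omega> * J * (\<integral>\<^sup>+x. ennreal (exp (- (1 / \<nu>) * (1 - x))) * indicator {0..} (1 - x) \<partial>lborel)"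
        by (rule nn_integral_cmult) measurable
      also have "(\<integral>\<^sup>+x. ennreal (exp (- (1 / \<nu>) * (1 - x))) * indicator {0..} (1 - x) \<partial>lborel) = ennreal \<nu>"
        using nn_integral_flip[of "\<lambda>x. ennreal (exp (- (1 / \<nu>) * x)) * indicator {0..} x" 1] nn_integral_exp_Ici[of "1 / \<nu>"] True by simp
      also have "ennreal \<omega> * J * ennreal \<nu> = (\<integral>\<^sup>+t. ennreal (\<nu> * \<omega>) * (indicator {0..T} t * j (\<nu>, \<omega>, t)) \<partial>lborel)"
        unfolding J_def using True by (subst nn_integral_cmult) (auto simp: ennreal_mult mult_ac)
      also have "\<dots> \<le> (\<integral>\<^sup>+t. indicator ({0<..1} \<times> {0<..} \<times> {0..T}) (\<nu>, \<omega>, t) * (ennreal (\<nu> * \<omega>) * j (\<nu>, \<omega>, t)) \<partial>lborel)"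
        using True by (intro nn_integral_mono) (auto split: split_indicator)
      finally show ?thesis .
    qed auto
  qed
  finally show ?thesis .
qed

end

section \<open>Absorption and geometric sums in the extended nonnegative reals\<close>

lemma ennreal_contraction:
  fixes a c k :: ennreal
  assumes "a \<le> c + k * a" "a < \<infinity>" "k < 1"
  shows "a \<le> c / (1 - k)"
proof (cases "c = \<infinity>")
  case True
  have "1 - k \<noteq> \<infinity>" by (simp add: ennreal_minus_eq_top)
  then show ?thesis using True by (simp add: ennreal_top_divide)
next
  case False
  \<comment> \<open>Subtracting k * a from both sides is legitimate only for finite
    \<open>a\<close>; for a = \<infinity> the assumed inequality can hold vacuously.\<close>
  obtain a' where a: "a = ennreal a'" "0 \<le> a'" using assms(2) by (cases a) auto
  obtain k' where k: "k = ennreal k'" "0 \<le> k'" "k' < 1"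
    using assms(3) by (cases k) (auto simp flip: ennreal_1 simp: ennreal_less_iff)
  obtain c' where c: "c = ennreal c'" "0 \<le> c'" using False by (cases c) auto
  have "a' \<le> c' + k' * a'"
    using assms(1) a k c by (simp add: ennreal_mult[symmetric] ennreal_plus[symmetric] del: ennreal_plus)
  then have "a' \<le> c' / (1 - k')" using k by (simp add: field_simps)
  moreover have "1 - k = ennreal (1 - k')" using k by (simp add: ennreal_minus flip: ennreal_1)
  ultimately show ?thesis using a c k by (simp add: divide_ennreal ennreal_leI)
qed

text \<open>This is the fixed-point equation for the constant \<beta> of the supersolution, with a =
  28\<alpha> and k = \<kappa>.\<close>

lemma ennreal_geometric_sum:
  fixes a k :: ennreal
  assumes "k < 1"
  shows "a + a / (1 - k) * k = a / (1 - k)"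
proof (cases "a = \<infinity>")
  case True
  have "1 - k \<noteq> \<infinity>" by (simp add: ennreal_minus_eq_top)
  then show ?thesis using True by (simp add: ennreal_top_divide)
next
  case False
  obtain k' where k: "k = ennreal k'" "0 \<le> k'" "k' < 1"
    using assms by (cases k) (auto simp flip: ennreal_1 simp: ennreal_less_iff)
  obtain a' where a: "a = ennreal a'" "0 \<le> a'" using False by (cases a) auto
  have "1 - k = ennreal (1 - k')" using k by (simp add: ennreal_minus flip: ennreal_1)
  moreover have "a' + a' / (1 - k') * k' = a' / (1 - k')" using k by (simp add: field_simps)
  ultimately show ?thesis
    using a k by (simp add: divide_ennreal ennreal_mult[symmetric] ennreal_plus[symmetric] del: ennreal_plus)
qed

lemma ennreal_geometric_finite:
  fixes a k :: ennreal
  assumes "k < 1" "a < \<infinity>"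
  shows "a / (1 - k) < \<infinity>"
proof -
  obtain k' where k: "k = ennreal k'" "0 \<le> k'" "k' < 1"
    using assms by (cases k) (auto simp flip: ennreal_1 simp: ennreal_less_iff)
  obtain a' where a: "a = ennreal a'" "0 \<le> a'" using assms by (cases a) auto
  have "1 - k = ennreal (1 - k')" using k by (simp add: ennreal_minus flip: ennreal_1)
  then show ?thesis using a k by (simp add: divide_ennreal)
qed

lemma mass_add:
  assumes [measurable]: "F \<in> borel_measurable (borel \<Otimes>\<^sub>M borel)" "H \<in> borel_measurable (borel \<Otimes>\<^sub>M borel)"
  shows "mass T (\<lambda>z. F z + H z) = mass T F + mass T H"
  unfolding mass_def by (simp add: distrib_left nn_integral_add)

lemma scattering_add:
  assumes [measurable]: "E \<in> borel_measurable (borel \<Otimes>\<^sub>M borel)" "E' \<in> borel_measurable (borel \<Otimes>\<^sub>M borel)"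
  shows "scattering T (\<lambda>z. E z + E' z) z = scattering T E z + scattering T E' z"
proof (cases z)
  case (Pair x t)
  have eq: "indicator ({0<..1} \<times> {0<..}) (\<nu>, \<omega>) * (ennreal (\<omega> * (\<omega> * gstar \<omega>)) / (2 * gstar_mass) * (gain T (\<lambda>z. E z + E' z) x \<nu> \<omega> t + gain T (\<lambda>z. E z + E' z) (2 - x) \<nu> \<omega> t))
    = indicator ({0<..1} \<times> {0<..}) (\<nu>, \<omega>) * (ennreal (\<omega> * (\<omega> * gstar \<omega>)) / (2 * gstar_mass) * (gain T E x \<nu> \<omega> t + gain T E (2 - x) \<nu> \<omega> t))
     + indicator ({0<..1} \<times> {0<..}) (\<nu>, \<omega>) * (ennreal (\<omega> * (\<omega> * gstar \<omega>)) / (2 * gstar_mass) * (gain T E' x \<nu> \<omega> t + gain T E' (2 - x) \<nu> \<omega> t))"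
    for \<nu> \<omega> by (simp add: gain_add distrib_left add_ac)
  show ?thesis unfolding Pair scattering_def prod.case eq by (simp add: nn_integral_add)
qed

lemma scattering_mono:
  assumes "\<And>x t. x \<in> {0..1} \<Longrightarrow> t \<in> {0..T} \<Longrightarrow> E (x, t) \<le> E' (x, t)"
  shows "scattering T E z \<le> scattering T E' z"
  unfolding scattering_def
  by (cases z) (auto intro!: nn_integral_mono mult_left_mono add_mono gain_mono assms)

text \<open>
  The value is \<open>(7\<alpha> + \<beta>)/W\<close> for the supersolution \<open>\<alpha> x powr - (1/4) + \<beta>\<close> with \<open>\<alpha> = 8W\<close> and
  \<open>\<beta> = 28\<alpha>/(1 - \<kappa>)\<close>, where \<open>W\<close> is the total weighted inflow.
\<close>

definition trace_constant :: "real \<Rightarrow> ennreal" where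
  "trace_constant T = 56 + 224 / (1 - kappa T)"

context transport
begin

text \<open>Without inflow the intensity is the reflected defect plus one scattering of
  \<open>E\<close>. The mass of the latter is at most \<kappa> times the left-hand side and is
  absorbed.\<close>

lemma mass_le_of_zero_inflow:
  assumes b0: "b = (\<lambda>_. 0)" and E: "mass T E \<le> mass T (intensity T f)" and fin: "mass T (intensity T f) < \<infinity>"
  shows "mass T (intensity T f) \<le>
    (\<integral>\<^sup>+\<nu>. \<integral>\<^sup>+\<omega>. \<integral>\<^sup>+t. indicator ({0<..1} \<times> {0<..} \<times> {0..T}) (\<nu>, \<omega>, t) * (ennreal (\<nu> * \<omega>) * j (\<nu>, \<omega>, t)) \<partial>lborel \<partial>lborel \<partial>lborel)
    / (1 - kappa T)"
proof (rule ennreal_contraction[OF _ fin kappa_less_1[OF T_pos]])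
  let ?J = "\<integral>\<^sup>+\<nu>. \<integral>\<^sup>+\<omega>. \<integral>\<^sup>+t. indicator ({0<..1} \<times> {0<..} \<times> {0..T}) (\<nu>, \<omega>, t) * (ennreal (\<nu> * \<omega>) * j (\<nu>, \<omega>, t)) \<partial>lborel \<partial>lborel \<partial>lborel"
  have "mass T (intensity T f) \<le> mass T (\<lambda>z. reflected_intensity z + scattering T E z)"
  proof (rule mass_mono_AE)
    fix x :: real assume "x \<in> {0<..1}"
    from intensity_le[OF this] show "AE t in lborel. t \<in> {0..T} \<longrightarrow> intensity T f (x, t) \<le> reflected_intensity (x, t) + scattering T E (x, t)"
      by (auto simp: b0 elim!: eventually_mono)
  qed
  also have "\<dots> = mass T reflected_intensity + mass T (scattering T E)"
    by (rule mass_add) measurable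
  also have "\<dots> \<le> ?J + kappa T * mass T (intensity T f)"
    using mass_reflected_intensity mass_scattering_le[OF E_measurable T_pos] mult_left_mono[OF E, of "kappa T"]
    by (intro add_mono) (auto intro: order_trans)
  finally show "mass T (intensity T f) \<le> ?J + kappa T * mass T (intensity T f)" .
qed

text \<open>Before the reflection the defect \<open>j\<close> acts only through \<open>E\<close>, so
  with zero inflow the trace consists of gain alone. In the flux estimate the collision factor
  \<omega> cancels 1/\<omega> and leaves \<open>gstar \<omega> / \<nu>\<close>, precisely the
  reciprocal of the weight in the derivative up to \<omega>.\<close>

lemma out_trace_time_integral:
  assumes b0: "b = (\<lambda>_. 0)"
  shows "AE \<nu> in lborel. AE \<omega> in lborel. \<nu> \<in> {0<..1} \<and> 0 < \<omega> \<longrightarrow>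
    (\<integral>\<^sup>+t. modulus T f (1, \<nu>, \<omega>, t) \<partial>lborel) \<le> ennreal (gstar \<omega> / \<nu>) / gstar_mass * mass T E"
  using modulus_out_le[of 1, simplified]
proof eventually_elim
  case (elim \<nu>)
  show ?case
  proof (cases "\<nu> \<in> {0<..1}")
    case True
    with elim have "AE \<omega> in lborel. AE t in lborel. modulus T f (1, \<nu>, \<omega>, t) \<le> source 1 \<nu> \<omega> t" by simp
    then show ?thesis
    proof eventually_elim
      case (elim \<omega>)
      show ?case
      proof
        assume pos: "\<nu> \<in> {0<..1} \<and> 0 < \<omega>"
        let ?K = "ennreal (\<omega> * gstar \<omega>) / (2 * gstar_mass)"
        have "(\<integral>\<^sup>+t. modulus T f (1, \<nu>, \<omega>, t) \<partial>lborel) \<le> (\<integral>\<^sup>+t. ?K * gain T E 1 \<nu> \<omega> t \<partial>lborel)"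
          using elim[unfolded source_def] by (intro nn_integral_mono_AE) (simp add: b0)
        also have "\<dots> = ?K * (\<integral>\<^sup>+t. gain T E 1 \<nu> \<omega> t \<partial>lborel)" by (rule nn_integral_cmult) measurable
        also have "\<dots> \<le> ?K * (ennreal (1 / (\<nu> * \<omega>)) * (2 * mass T E))"
          using pos by (intro mult_left_mono gain_time_integral_le) auto
        also have "\<dots> = (ennreal (\<omega> * gstar \<omega>) * ennreal (1 / (\<nu> * \<omega>))) * (inverse (2 * gstar_mass) * 2) * mass T E"
          by (simp add: divide_ennreal_def mult_ac)
        also have "inverse (2 * gstar_mass) * 2 = inverse gstar_mass" by (rule inverse_double_ennreal[OF gstar_mass_pos gstar_mass_less_top])
        also have "ennreal (\<omega> * gstar \<omega>) * ennreal (1 / (\<nu> * \<omega>)) = ennreal (gstar \<omega> / \<nu>)"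
          using pos gstar_nonneg[of \<omega>] by (simp add: ennreal_mult[symmetric])
        finally show "(\<integral>\<^sup>+t. modulus T f (1, \<nu>, \<omega>, t) \<partial>lborel) \<le> ennreal (gstar \<omega> / \<nu>) / gstar_mass * mass T E"
          by (simp add: divide_ennreal_def)
      qed
    qed
  qed auto
qed

text \<open>
  Comparison: \<open>S = \<alpha> x powr - (1/4) + \<beta>\<close> is a supersolution of the integral equation for the intensity,
  so the excess \<open>e\<close> of the intensity over \<open>S\<close> satisfies \<open>e \<le> scattering e\<close>, and the contraction property in
  \<open>L\<^sup>1\<close> forces \<open>e = 0\<close>. The power \<open>- 1/4\<close> is integrable even after squaring and dominates the logarithmic
  singularity at \<open>x = 0\<close> that the datum \<open>1/\<mu>\<close> produces.
\<close>

lemma out_trace_bound: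
  assumes j0: "j = (\<lambda>_. 0)" and E: "E = intensity T f" and fin: "mass T (intensity T f) < \<infinity>"
    and W: "(\<integral>\<^sup>+\<omega>. ennreal \<omega> * b \<omega> * indicator {0<..} \<omega> \<partial>lborel) < \<infinity>"
  shows "AE \<nu> in lborel. AE \<omega> in lborel. AE t in lborel. \<nu> \<in> {0<..1} \<longrightarrow>
    modulus T f (1, \<nu>, \<omega>, t) \<le> ennreal (\<nu> powr - (3/4)) *
      (b \<omega> + ennreal (gstar \<omega>) / (2 * gstar_mass) * (trace_constant T * (\<integral>\<^sup>+\<omega>. ennreal \<omega> * b \<omega> * indicator {0<..} \<omega> \<partial>lborel)))"
proof -
  define W where "W = (\<integral>\<^sup>+\<omega>. ennreal \<omega> * b \<omega> * indicator {0<..} \<omega> \<partial>lborel)"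
  define \<alpha> where "\<alpha> = 8 * W"
  define \<beta> where "\<beta> = 28 * \<alpha> / (1 - kappa T)"
  define S where "S = (\<lambda>(x, t::real). \<alpha> * ennreal (x powr - (1/4)) + \<beta>)"
  \<comment> \<open>Subtraction in \<open>ennreal\<close> is truncated, so \<open>e\<close> is the
    positive part of the excess.\<close>
  define e where "e z = intensity T f z - S z" for z
  have S_meas [measurable]: "S \<in> borel_measurable (borel \<Otimes>\<^sub>M borel)" unfolding S_def by measurable
  have e_meas [measurable]: "e \<in> borel_measurable (borel \<Otimes>\<^sub>M borel)" unfolding e_def by measurable
  have S_fin: "S z < \<infinity>" for z
    using W ennreal_geometric_finite[OF kappa_less_1[OF T_pos], of "28 * \<alpha>"]
    by (cases z) (auto simp: S_def W_def \<alpha>_def \<beta>_def ennreal_mult_less_top)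
  have dSe: "intensity T f z \<le> S z + e z" for z
    unfolding e_def using ennreal_minus_le_iff[of "intensity T f z" "S z" "intensity T f z - S z"] by simp
  have "reflected_intensity z = 0" for z
    unfolding reflected_intensity_def reflected_source_def by (cases z) (simp add: j0)
  note r0 = this
  have "mass T e \<le> mass T (scattering T e)"
  proof (rule mass_mono_AE)
    fix x :: real assume x: "x \<in> {0<..1}"
    from intensity_le[OF x]
    show "AE t in lborel. t \<in> {0..T} \<longrightarrow> e (x, t) \<le> scattering T e (x, t)"
    proof eventually_elim
      case (elim t)
      show ?case
      proof
        assume t: "t \<in> {0..T}"
        have "scattering T (intensity T f) (x, t) \<le> scattering T (\<lambda>z. S z + e z) (x, t)"
          by (intro scattering_mono dSe)
        also have "\<dots> = scattering T S (x, t) + scattering T e (x, t)"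
          by (rule scattering_add) measurable
        also have "scattering T S (x, t) \<le> 28 * \<alpha> + \<beta> * kappa T"
          unfolding S_def using x t by (intro scattering_supersolution) auto
        \<comment> \<open>\<beta> is chosen so that scattering of \<open>S\<close> returns at most
          \<beta>; the unscattered inflow supplies the remaining summand \<alpha> x^(-1/4) of
          \<open>S\<close>.\<close>
        also have "28 * \<alpha> + \<beta> * kappa T = \<beta>"
          unfolding \<beta>_def by (rule ennreal_geometric_sum[OF kappa_less_1[OF T_pos]])
        finally have sc: "scattering T (intensity T f) (x, t) \<le> \<beta> + scattering T e (x, t)"
          by (simp add: add_right_mono)
        have "intensity T f (x, t) \<le> \<alpha> * ennreal (x powr - (1/4)) + scattering T (intensity T f) (x, t)"
          using elim by (simp add: r0 E W_def \<alpha>_def)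
        also have "\<dots> \<le> S (x, t) + scattering T e (x, t)"
          using add_left_mono[OF sc, of "\<alpha> * ennreal (x powr - (1/4))"] by (simp add: S_def add.assoc)
        finally show "e (x, t) \<le> scattering T e (x, t)"
          unfolding e_def using S_fin[of "(x, t)"] by (auto simp: ennreal_minus_le_iff)
      qed
    qed
  qed
  also have "\<dots> \<le> 0 + kappa T * mass T e"
    using mass_scattering_le[OF e_meas T_pos] by simp
  finally have "mass T e \<le> 0 / (1 - kappa T)"
  proof (rule ennreal_contraction[OF _ _ kappa_less_1[OF T_pos]])
    have "mass T e \<le> mass T (intensity T f)"
      by (rule mass_mono_AE) (simp add: e_def diff_le_self_ennreal)
    then show "mass T e < \<infinity>" using fin by (rule le_less_trans)
  qed
  then have e0: "mass T e = 0" by simp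
  \<comment> \<open>Zero mass says nothing about \<open>e\<close> on an individual line, but the
    time integral of its gain at y = 1 is bounded by the mass. Hence \<open>S\<close> may replace
    the intensity in the trace at almost every time.\<close>
  have gain0: "AE t in lborel. gain T e 1 \<nu> \<omega> t = 0" if "0 < \<nu>" "0 < \<omega>" for \<nu> \<omega>
    using gain_time_integral_le[OF e_meas that(2,1), of T 1] by (simp add: e0 nn_integral_0_iff_AE)
  have W7: "7 * \<alpha> + \<beta> = trace_constant T * W"
  proof -
    have "7 * \<alpha> = 56 * W" "28 * \<alpha> = 224 * W" unfolding \<alpha>_def by (simp_all add: mult.assoc[symmetric])
    then show ?thesis
      unfolding \<beta>_def trace_constant_def by (simp add: distrib_left distrib_right divide_ennreal_def mult_ac)
  qed
  show ?thesis
    using modulus_out_le[of 1, simplified]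
  proof eventually_elim
    case (elim \<nu>)
    show ?case
    proof (cases "\<nu> \<in> {0<..1}")
      case True
      with elim have "AE \<omega> in lborel. AE t in lborel. modulus T f (1, \<nu>, \<omega>, t) \<le> source 1 \<nu> \<omega> t" by simp
      then show ?thesis
      proof eventually_elim
        case (elim \<omega>)
        show ?case
        proof (cases "0 < \<omega>")
          case om: True
          have "AE t in lborel. gain T e 1 \<nu> \<omega> t = 0" using True om by (intro gain0) auto
          with elim show ?thesis
          proof eventually_elim
            case (elim t)
            show ?case
            proof (cases "t \<in> {0..T}")
              case t: True
              let ?K = "ennreal (\<omega> * gstar \<omega>) / (2 * gstar_mass)"
              let ?p = "ennreal (\<nu> powr - (3/4))"
              \<comment> \<open>Since \<nu> \<le> 1, the \<nu>-independent contribution of \<beta>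
                can also be written with the factor \<nu>^(-3/4).\<close>
              have "1 powr - (3/4) \<le> \<nu> powr - (3/4)"
                using True by (intro powr_mono2') auto
              then have p1: "1 \<le> ?p" by simp
              have "gain T E 1 \<nu> \<omega> t \<le> gain T (\<lambda>z. S z + e z) 1 \<nu> \<omega> t"
                unfolding E by (intro gain_mono dSe)
              also have "\<dots> = gain T S 1 \<nu> \<omega> t"
                using elim(2) by (simp add: gain_add)
              also have "\<dots> = gain T (\<lambda>z. \<alpha> * (case z of (x, t) \<Rightarrow> ennreal (x powr - (1/4))) + \<beta>) 1 \<nu> \<omega> t"
                by (rule arg_cong[where f="\<lambda>E. gain T E 1 \<nu> \<omega> t"]) (auto simp: S_def)
              also have "\<dots> = \<alpha> * gain T (\<lambda>(x, t). ennreal (x powr - (1/4))) 1 \<nu> \<omega> t + gain T (\<lambda>_. \<beta>) 1 \<nu> \<omega> t"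
                by (subst gain_add) (auto simp: gain_cmult)
              also have "\<dots> \<le> \<alpha> * ennreal (7 * \<nu> powr - (3/4) / \<omega>) + \<beta> * ennreal ((1 - exp (- \<omega> * T)) / \<omega>)"
                using om True t by (intro add_mono mult_left_mono gain_powr_le gain_const_le) auto
              finally have "?K * gain T E 1 \<nu> \<omega> t \<le> ?K * (\<alpha> * ennreal (7 * \<nu> powr - (3/4) / \<omega>) + \<beta> * ennreal ((1 - exp (- \<omega> * T)) / \<omega>))"
                by (rule mult_left_mono) simp
              also have "\<dots> = (\<alpha> * (ennreal (\<omega> * gstar \<omega>) * ennreal (7 * \<nu> powr - (3/4) / \<omega>))
                 + \<beta> * (ennreal (\<omega> * gstar \<omega>) * ennreal ((1 - exp (- \<omega> * T)) / \<omega>))) * inverse (2 * gstar_mass)"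
                by (simp only: divide_ennreal_def distrib_left distrib_right mult_ac)
              also have "\<dots> \<le> (\<alpha> * (7 * (?p * ennreal (gstar \<omega>))) + \<beta> * (?p * ennreal (gstar \<omega>))) * inverse (2 * gstar_mass)"
              proof (intro mult_right_mono add_mono mult_left_mono)
                show "ennreal (\<omega> * gstar \<omega>) * ennreal (7 * \<nu> powr - (3/4) / \<omega>) \<le> 7 * (?p * ennreal (gstar \<omega>))"
                  using om gstar_nonneg[of \<omega>] by (simp add: ennreal_mult[symmetric] mult_ac flip: ennreal_numeral)
                have "ennreal (\<omega> * gstar \<omega>) * ennreal ((1 - exp (- \<omega> * T)) / \<omega>) = ennreal (gstar \<omega> * (1 - exp (- \<omega> * T)))"
                  using om T_pos gstar_nonneg[of \<omega>] by (subst ennreal_mult[symmetric]) auto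
                also have "\<dots> \<le> ennreal (gstar \<omega>)"
                  using gstar_nonneg[of \<omega>] by (intro ennreal_leI) (simp add: mult_left_le)
                also have "\<dots> \<le> ?p * ennreal (gstar \<omega>)"
                  using mult_right_mono[OF p1, of "ennreal (gstar \<omega>)"] by simp
                finally show "ennreal (\<omega> * gstar \<omega>) * ennreal ((1 - exp (- \<omega> * T)) / \<omega>) \<le> ?p * ennreal (gstar \<omega>)" .
              qed auto
              also have "\<dots> = ?p * (ennreal (gstar \<omega>) / (2 * gstar_mass) * (7 * \<alpha> + \<beta>))"
                by (simp only: divide_ennreal_def distrib_left distrib_right mult_ac)
              finally have K: "?K * gain T E 1 \<nu> \<omega> t \<le> ?p * (ennreal (gstar \<omega>) / (2 * gstar_mass) * (trace_constant T * W))"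
                unfolding W7 .
              have "ennreal (exp (- 1 / \<nu>) / \<nu>) * b \<omega> \<le> ?p * b \<omega>"
                using exp_div_le_powr[of 1 \<nu>] True by (intro mult_right_mono ennreal_leI) auto
              from add_mono[OF this K] elim(1) show ?thesis
                unfolding source_def W_def[symmetric] by (auto simp: distrib_left intro: order_trans)
            qed (simp add: modulus_def)
          qed
        qed (simp add: modulus_def)
      qed
    qed auto
  qed
qed

end

section \<open>Moments of signed functions and their intensities\<close>

lemma iterated_integral_eq:
  fixes K :: "real \<times> real \<Rightarrow> real"
  assumes [measurable]: "K \<in> borel_measurable (borel \<Otimes>\<^sub>M borel)"
    and "(\<integral>\<^sup>+x. \<integral>\<^sup>+y. ennreal \<bar>K (x, y)\<bar> \<partial>lborel \<partial>lborel) < \<infinity>"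
  shows "integrable (lborel \<Otimes>\<^sub>M lborel) K"
    and "(\<integral>x. \<integral>y. K (x, y) \<partial>lborel \<partial>lborel) = integral\<^sup>L (lborel \<Otimes>\<^sub>M lborel) K"
proof -
  show "integrable (lborel \<Otimes>\<^sub>M lborel) K"
  proof (rule integrableI_bounded)
    show "K \<in> borel_measurable (lborel \<Otimes>\<^sub>M lborel)" by simp
    have "(\<integral>\<^sup>+z. ennreal (norm (K z)) \<partial>(lborel \<Otimes>\<^sub>M lborel)) = (\<integral>\<^sup>+x. \<integral>\<^sup>+y. ennreal \<bar>K (x, y)\<bar> \<partial>lborel \<partial>lborel)"
      by (subst lborel.nn_integral_fst[symmetric]) auto
    then show "(\<integral>\<^sup>+z. ennreal (norm (K z)) \<partial>(lborel \<Otimes>\<^sub>M lborel)) < \<infinity>" using assms(2) by simp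
  qed
  from lborel_pair.integral_fst'[OF this]
  show "(\<integral>x. \<integral>y. K (x, y) \<partial>lborel \<partial>lborel) = integral\<^sup>L (lborel \<Otimes>\<^sub>M lborel) K" .
qed

text \<open>Iterated Bochner integrals have the default value 0 where integrability fails, so
  linearity is obtained by passing to the product measure, for which the two finiteness conditions
  are needed.\<close>

lemma iterated_integral_diff_le:
  fixes K1 K2 :: "real \<times> real \<Rightarrow> real"
  assumes [measurable]: "K1 \<in> borel_measurable (borel \<Otimes>\<^sub>M borel)" "K2 \<in> borel_measurable (borel \<Otimes>\<^sub>M borel)"
    and fin: "(\<integral>\<^sup>+x. \<integral>\<^sup>+y. ennreal \<bar>K1 (x, y)\<bar> \<partial>lborel \<partial>lborel) < \<infinity>"
      "(\<integral>\<^sup>+x. \<integral>\<^sup>+y. ennreal \<bar>K2 (x, y)\<bar> \<partial>lborel \<partial>lborel) < \<infinity>"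
  shows "ennreal \<bar>(\<integral>x. \<integral>y. K1 (x, y) \<partial>lborel \<partial>lborel) - (\<integral>x. \<integral>y. K2 (x, y) \<partial>lborel \<partial>lborel)\<bar>
    \<le> (\<integral>\<^sup>+x. \<integral>\<^sup>+y. ennreal \<bar>K1 (x, y) - K2 (x, y)\<bar> \<partial>lborel \<partial>lborel)"
proof -
  note i1 = iterated_integral_eq[OF assms(1) fin(1)] and i2 = iterated_integral_eq[OF assms(2) fin(2)]
  have "ennreal \<bar>(\<integral>x. \<integral>y. K1 (x, y) \<partial>lborel \<partial>lborel) - (\<integral>x. \<integral>y. K2 (x, y) \<partial>lborel \<partial>lborel)\<bar>
    = ennreal (norm (integral\<^sup>L (lborel \<Otimes>\<^sub>M lborel) (\<lambda>z. K1 z - K2 z)))"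
    unfolding i1(2) i2(2) using i1(1) i2(1) by simp
  also have "\<dots> \<le> (\<integral>\<^sup>+z. ennreal (norm (K1 z - K2 z)) \<partial>(lborel \<Otimes>\<^sub>M lborel))"
    by (rule integral_norm_bound_ennreal) (use i1(1) i2(1) in simp)
  also have "\<dots> = (\<integral>\<^sup>+x. \<integral>\<^sup>+y. ennreal \<bar>K1 (x, y) - K2 (x, y)\<bar> \<partial>lborel \<partial>lborel)"
    by (subst lborel.nn_integral_fst[symmetric]) auto
  finally show ?thesis .
qed

lemma ennreal_abs_integral_le:
  fixes f :: "'a \<Rightarrow> real"
  shows "ennreal \<bar>integral\<^sup>L M f\<bar> \<le> (\<integral>\<^sup>+x. ennreal \<bar>f x\<bar> \<partial>M)"
proof (cases "integrable M f")
  case True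
  from integral_norm_bound_ennreal[OF this] show ?thesis by simp
qed (simp add: not_integrable_integral_eq)

text \<open>The signed counterpart of \<open>modulus\<close>. Measurability is only available for
  this restriction to phase space, not for \<open>f\<close> itself.\<close>

definition truncation :: "real \<Rightarrow> (real \<Rightarrow> real \<Rightarrow> real \<Rightarrow> real \<Rightarrow> real) \<Rightarrow> real \<times> real \<times> real \<times> real \<Rightarrow> real" where
  "truncation T f = (\<lambda>(x, \<mu>, \<omega>, t). indicator ({0..1} \<times> {-1..1} \<times> {0<..} \<times> {0..T}) (x, \<mu>, \<omega>, t) * f x \<mu> \<omega> t)"

lemma modulus_truncation: "modulus T f z = ennreal \<bar>truncation T f z\<bar>"
  by (cases z) (auto simp: modulus_def truncation_def split: split_indicator)

abbreviation moment :: "(real \<Rightarrow> real \<Rightarrow> real \<Rightarrow> real \<Rightarrow> real) \<Rightarrow> real \<Rightarrow> real \<Rightarrow> real" where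
  "moment f x t \<equiv> \<langle>\<lambda>\<mu> \<omega>. \<omega> * f x \<mu> \<omega> t\<rangle>"

lemma moment_truncation:
  assumes "x \<in> {0..1}" "t \<in> {0..T}"
  shows "moment f x t = (\<integral>\<mu>. \<integral>\<omega>. \<omega> * truncation T f (x, \<mu>, \<omega>, t) \<partial>lborel \<partial>lborel)"
proof -
  have "moment f x t = (\<integral>\<mu>. \<integral>\<omega>. indicator {-1..1} \<mu> * (indicator {0<..} \<omega> * (\<omega> * f x \<mu> \<omega> t)) \<partial>lborel \<partial>lborel)"
    by (simp add: bracket_def set_lebesgue_integral_def)
  also have "\<dots> = (\<integral>\<mu>. \<integral>\<omega>. \<omega> * truncation T f (x, \<mu>, \<omega>, t) \<partial>lborel \<partial>lborel)"
    using assms by (intro Bochner_Integration.integral_cong) (auto simp: truncation_def split: split_indicator)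
  finally show ?thesis .
qed

lemma abs_weighted_truncation:
  "ennreal \<bar>\<omega> * truncation T f (x, \<mu>, \<omega>, t)\<bar> = ennreal \<omega> * modulus T f (x, \<mu>, \<omega>, t)"
  by (cases "0 < \<omega>") (auto simp: modulus_truncation abs_mult ennreal_mult truncation_def)

lemma moment_le_intensity:
  assumes "x \<in> {0..1}" "t \<in> {0..T}"
  shows "ennreal \<bar>moment f x t\<bar> \<le> intensity T f (x, t)"
proof -
  have "ennreal \<bar>moment f x t\<bar> \<le> (\<integral>\<^sup>+\<mu>. ennreal \<bar>\<integral>\<omega>. \<omega> * truncation T f (x, \<mu>, \<omega>, t) \<partial>lborel\<bar> \<partial>lborel)"
    unfolding moment_truncation[OF assms] by (rule ennreal_abs_integral_le)
  also have "\<dots> \<le> (\<integral>\<^sup>+\<mu>. \<integral>\<^sup>+\<omega>. ennreal \<bar>\<omega> * truncation T f (x, \<mu>, \<omega>, t)\<bar> \<partial>lborel \<partial>lborel)"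
    by (intro nn_integral_mono ennreal_abs_integral_le)
  also have "\<dots> = intensity T f (x, t)"
    unfolding intensity_def by (simp add: abs_weighted_truncation)
  finally show ?thesis .
qed

abbreviation pointwise_diff ::
    "(real \<Rightarrow> real \<Rightarrow> real \<Rightarrow> real \<Rightarrow> real) \<Rightarrow> (real \<Rightarrow> real \<Rightarrow> real \<Rightarrow> real \<Rightarrow> real) \<Rightarrow> real \<Rightarrow> real \<Rightarrow> real \<Rightarrow> real \<Rightarrow> real" where
  "pointwise_diff f1 f2 \<equiv> (\<lambda>x \<mu> \<omega> t. f1 x \<mu> \<omega> t - f2 x \<mu> \<omega> t)"

lemma truncation_diff: "truncation T (pointwise_diff f1 f2) z = truncation T f1 z - truncation T f2 z"
  by (cases z) (simp add: truncation_def right_diff_distrib)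

text \<open>The moment of a difference is the difference of the moments only where both are genuine
  integrals, which the finiteness of the two intensities ensures.\<close>

lemma moment_diff_le:
  assumes [measurable]: "truncation T f1 \<in> borel_measurable (borel \<Otimes>\<^sub>M borel \<Otimes>\<^sub>M borel \<Otimes>\<^sub>M borel)"
    "truncation T f2 \<in> borel_measurable (borel \<Otimes>\<^sub>M borel \<Otimes>\<^sub>M borel \<Otimes>\<^sub>M borel)"
    and xt: "x \<in> {0..1}" "t \<in> {0..T}" and "intensity T f1 (x, t) < \<infinity>" "intensity T f2 (x, t) < \<infinity>"
  shows "ennreal \<bar>moment f1 x t - moment f2 x t\<bar> \<le> intensity T (pointwise_diff f1 f2) (x, t)"
proof -
  have "ennreal \<bar>moment f1 x t - moment f2 x t\<bar> \<le>
    (\<integral>\<^sup>+\<mu>. \<integral>\<^sup>+\<omega>. ennreal \<bar>\<omega> * truncation T f1 (x, \<mu>, \<omega>, t) - \<omega> * truncation T f2 (x, \<mu>, \<omega>, t)\<bar> \<partial>lborel \<partial>lborel)"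
    unfolding moment_truncation[OF xt]
    using iterated_integral_diff_le[of "\<lambda>(\<mu>, \<omega>). \<omega> * truncation T f1 (x, \<mu>, \<omega>, t)" "\<lambda>(\<mu>, \<omega>). \<omega> * truncation T f2 (x, \<mu>, \<omega>, t)"]
      assms(5,6) by (simp add: abs_weighted_truncation intensity_def)
  also have "\<dots> = intensity T (pointwise_diff f1 f2) (x, t)"
    unfolding intensity_def
    by (simp add: abs_weighted_truncation[symmetric] truncation_diff right_diff_distrib)
  finally show ?thesis .
qed

text \<open>The common form of the forward and the reversed adjoint problem: inflow at x = 0 for
  \<nu> > 0, with null sets in iterated form, direction and frequency outermost and the line
  parameter, position or time innermost.\<close>

definition reflecting_solution ::
    "real \<Rightarrow> (real \<Rightarrow> real \<Rightarrow> real \<Rightarrow> real) \<Rightarrow> (real \<Rightarrow> real) \<Rightarrow> (real \<Rightarrow> real \<Rightarrow> real \<Rightarrow> real \<Rightarrow> real) \<Rightarrow> bool" where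
  "reflecting_solution T \<phi> \<eta> f \<longleftrightarrow>
     truncation T f \<in> borel_measurable (borel \<Otimes>\<^sub>M borel \<Otimes>\<^sub>M borel \<Otimes>\<^sub>M borel) \<and>
     mass T (intensity T f) < \<infinity> \<and>
     (AE \<mu> in lborel. AE \<omega> in lborel. AE c in lborel. \<mu> \<in> {-1..1} \<and> 0 < \<omega> \<longrightarrow>
       mild_on_line T f (\<lambda>x \<mu> \<omega> t. - \<omega> * f x \<mu> \<omega> t + \<omega> * gstar \<omega> / scattering_rate * moment f x t) \<mu> \<omega> c) \<and>
     (AE \<mu> in lborel. AE \<omega> in lborel. AE x in lborel.
       x \<in> {0..1} \<and> \<mu> \<in> {-1..1} \<and> 0 < \<omega> \<longrightarrow> f x \<mu> \<omega> 0 = 0) \<and>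
     (AE \<nu> in lborel. AE \<omega> in lborel. AE t in lborel.
       \<nu> \<in> {0<..1} \<and> 0 < \<omega> \<and> t \<in> {0..T} \<longrightarrow> f 0 \<nu> \<omega> t = \<phi> \<nu> \<omega> t) \<and>
     (AE \<nu> in lborel. AE \<omega> in lborel. AE t in lborel.
       \<nu> \<in> {0<..1} \<and> 0 < \<omega> \<and> t \<in> {0..T} \<longrightarrow> f 1 (- \<nu>) \<omega> t = \<eta> \<omega> * f 1 \<nu> \<omega> t)"

lemma modulus_measurable_of_truncation:
  assumes [measurable]: "truncation T f \<in> borel_measurable (borel \<Otimes>\<^sub>M borel \<Otimes>\<^sub>M borel \<Otimes>\<^sub>M borel)"
  shows "modulus T f \<in> borel_measurable (borel \<Otimes>\<^sub>M borel \<Otimes>\<^sub>M borel \<Otimes>\<^sub>M borel)"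
  unfolding modulus_truncation[abs_def] by measurable

lemma intensity_measurable_of_truncation:
  assumes "truncation T f \<in> borel_measurable (borel \<Otimes>\<^sub>M borel \<Otimes>\<^sub>M borel \<Otimes>\<^sub>M borel)"
  shows "intensity T f \<in> borel_measurable (borel \<Otimes>\<^sub>M borel)"
proof -
  note [measurable] = modulus_measurable_of_truncation[OF assms]
  show ?thesis unfolding intensity_def by measurable
qed

text \<open>A reflection coefficient at most 1 does not increase the modulus, so the reflection law
  has no defect and the bound is independent of \<eta>.\<close>

lemma solution_trace_bound:
  assumes "0 < T" and sol: "reflecting_solution T \<phi> \<eta> f" and eta: "reflection_coefficient \<eta>"
    and [measurable]: "b \<in> borel_measurable borel"
    and datum: "AE \<nu> in lborel. AE \<omega> in lborel. AE t in lborel.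
       \<nu> \<in> {0<..1} \<and> 0 < \<omega> \<and> t \<in> {0..T} \<longrightarrow> ennreal \<bar>\<phi> \<nu> \<omega> t\<bar> \<le> ennreal (1 / \<nu>) * b \<omega>"
    and W: "(\<integral>\<^sup>+\<omega>. ennreal \<omega> * b \<omega> * indicator {0<..} \<omega> \<partial>lborel) < \<infinity>"
  shows "AE \<nu> in lborel. AE \<omega> in lborel. AE t in lborel. \<nu> \<in> {0<..1} \<longrightarrow>
    modulus T f (1, \<nu>, \<omega>, t) \<le> ennreal (\<nu> powr - (3/4)) *
      (b \<omega> + ennreal (gstar \<omega>) / (2 * gstar_mass) * (trace_constant T * (\<integral>\<^sup>+\<omega>. ennreal \<omega> * b \<omega> * indicator {0<..} \<omega> \<partial>lborel)))"
proof -
  note S = sol[unfolded reflecting_solution_def]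
  have "transport T f (moment f) (intensity T f) b (\<lambda>_. 0)"
  proof
    show "0 < T" by fact
    show "modulus T f \<in> borel_measurable (borel \<Otimes>\<^sub>M borel \<Otimes>\<^sub>M borel \<Otimes>\<^sub>M borel)"
      using S modulus_measurable_of_truncation by blast
    show "intensity T f \<in> borel_measurable (borel \<Otimes>\<^sub>M borel)"
      using S intensity_measurable_of_truncation by blast
    show "AE \<nu> in lborel. AE \<omega> in lborel. AE t in lborel.
       \<nu> \<in> {0<..1} \<and> 0 < \<omega> \<and> t \<in> {0..T} \<longrightarrow> ennreal \<bar>f 0 \<nu> \<omega> t\<bar> \<le> ennreal (1 / \<nu>) * b \<omega>"
    proof -
      have "AE \<nu> in lborel. AE \<omega> in lborel. AE t in lborel. \<nu> \<in> {0<..1} \<and> 0 < \<omega> \<and> t \<in> {0..T} \<longrightarrow> f 0 \<nu> \<omega> t = \<phi> \<nu> \<omega> t"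
        using S by blast
      then show ?thesis using datum
      proof eventually_elim
        case (elim \<nu>) then show ?case
        proof eventually_elim
          case (elim \<omega>) then show ?case by eventually_elim auto
        qed
      qed
    qed
    show "AE \<nu> in lborel. AE \<omega> in lborel. AE t in lborel. \<nu> \<in> {0<..1} \<and> 0 < \<omega> \<and> t \<in> {0..T} \<longrightarrow>
       ennreal \<bar>f 1 (- \<nu>) \<omega> t\<bar> \<le> ennreal \<bar>f 1 \<nu> \<omega> t\<bar> + 0"
    proof -
      have "AE \<nu> in lborel. AE \<omega> in lborel. AE t in lborel. \<nu> \<in> {0<..1} \<and> 0 < \<omega> \<and> t \<in> {0..T} \<longrightarrow> f 1 (- \<nu>) \<omega> t = \<eta> \<omega> * f 1 \<nu> \<omega> t"
        using S by blast
      then show ?thesis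
      proof eventually_elim
        case (elim \<nu>) then show ?case
        proof eventually_elim
          case (elim \<omega>) then show ?case
          proof eventually_elim
            case (elim t)
            show ?case
            proof
              assume A: "\<nu> \<in> {0<..1} \<and> 0 < \<omega> \<and> t \<in> {0..T}"
              with eta have "0 \<le> \<eta> \<omega>" "\<eta> \<omega> \<le> 1" by (auto simp: reflection_coefficient_def)
              then have "\<bar>\<eta> \<omega> * f 1 \<nu> \<omega> t\<bar> \<le> \<bar>f 1 \<nu> \<omega> t\<bar>"
                by (simp add: abs_mult mult_left_le_one_le)
              then show "ennreal \<bar>f 1 (- \<nu>) \<omega> t\<bar> \<le> ennreal \<bar>f 1 \<nu> \<omega> t\<bar> + 0"
                using elim A by (simp add: ennreal_leI)
            qed
          qed
        qed
      qed
    qed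
  qed (use S in \<open>auto intro: moment_le_intensity\<close>)
  then interpret transport T f "moment f" "intensity T f" b "\<lambda>_. 0" .
  show ?thesis using out_trace_bound[OF refl refl conjunct1[OF conjunct2[OF S]] W] .
qed

text \<open>The inflows cancel, so the difference is driven only by the defect
  \<open>\<delta> \<omega>\<close> times the outgoing trace of \<open>f2\<close>, which is bounded
  pointwise by \<open>c\<close>. Thus \<eta>1 - \<eta>2 enters linearly, integrated against the
  profile \<omega>c.\<close>

lemma solution_difference:
  assumes T: "0 < T" and sol1: "reflecting_solution T \<phi> \<eta>1 f1" and sol2: "reflecting_solution T \<phi> \<eta>2 f2"
    and eta1: "reflection_coefficient \<eta>1"
    and \<delta>_meas [measurable]: "\<delta> \<in> borel_measurable borel"
    and \<delta>: "\<And>\<omega>. 0 < \<omega> \<Longrightarrow> \<delta> \<omega> = ennreal \<bar>\<eta>1 \<omega> - \<eta>2 \<omega>\<bar>"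
    and c_meas [measurable]: "c \<in> borel_measurable borel"
    and trace: "AE \<nu> in lborel. AE \<omega> in lborel. AE t in lborel. \<nu> \<in> {0<..1} \<longrightarrow>
        modulus T f2 (1, \<nu>, \<omega>, t) \<le> ennreal (\<nu> powr - (3/4)) * c \<omega>"
  defines "M \<equiv> mass T (intensity T (pointwise_diff f1 f2))"
  shows "M \<le> ennreal T * (\<integral>\<^sup>+\<omega>. \<delta> \<omega> * (ennreal \<omega> * c \<omega>) * indicator {0<..} \<omega> \<partial>lborel) / (1 - kappa T)"
    and "AE \<nu> in lborel. AE \<omega> in lborel. \<nu> \<in> {0<..1} \<and> 0 < \<omega> \<longrightarrow>
      (\<integral>\<^sup>+t. modulus T (pointwise_diff f1 f2) (1, \<nu>, \<omega>, t) \<partial>lborel) \<le> ennreal (gstar \<omega> / \<nu>) / gstar_mass * M"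
proof -
  define d where "d = pointwise_diff f1 f2"
  note S1 = sol1[unfolded reflecting_solution_def] and S2 = sol2[unfolded reflecting_solution_def]
  have t1 [measurable]: "truncation T f1 \<in> borel_measurable (borel \<Otimes>\<^sub>M borel \<Otimes>\<^sub>M borel \<Otimes>\<^sub>M borel)"
    and t2 [measurable]: "truncation T f2 \<in> borel_measurable (borel \<Otimes>\<^sub>M borel \<Otimes>\<^sub>M borel \<Otimes>\<^sub>M borel)"
    using S1 S2 by auto
  have td [measurable]: "truncation T d \<in> borel_measurable (borel \<Otimes>\<^sub>M borel \<Otimes>\<^sub>M borel \<Otimes>\<^sub>M borel)"
    unfolding d_def truncation_diff[abs_def] by measurable
  note [measurable] = modulus_measurable_of_truncation[OF t2] modulus_measurable_of_truncation[OF td]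
    intensity_measurable_of_truncation[OF t1] intensity_measurable_of_truncation[OF t2] intensity_measurable_of_truncation[OF td]
  \<comment> \<open>Where an intensity is infinite, the difference of the moments is not controlled
    by the intensity of the difference, so the majorant is set to \<infinity>. This happens on a
    null set of the slab and costs no mass.\<close>
  define E where "E z = (if intensity T f1 z < \<infinity> \<and> intensity T f2 z < \<infinity> then intensity T d z else \<infinity>)" for z
  define j where "j = (\<lambda>(\<nu>, \<omega>, t). \<delta> \<omega> * modulus T f2 (1, \<nu>, \<omega>, t))"
  have E_meas [measurable]: "E \<in> borel_measurable (borel \<Otimes>\<^sub>M borel)" unfolding E_def by measurable
  have massE: "mass T E \<le> mass T (intensity T d)"
  proof -
    have fin: "AE x in lborel. AE t in lborel. indicator ({0..1} \<times> {0..T}) (x, t) * intensity T f (x, t) \<noteq> \<infinity>"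
      if "mass T (intensity T f) < \<infinity>" and [measurable]: "intensity T f \<in> borel_measurable (borel \<Otimes>\<^sub>M borel)" for f
    proof -
      have "AE x in lborel. (\<integral>\<^sup>+t. indicator ({0..1} \<times> {0..T}) (x, t) * intensity T f (x, t) \<partial>lborel) \<noteq> \<infinity>"
        using that unfolding mass_def by (intro nn_integral_PInf_AE) auto
      then show ?thesis
        by eventually_elim (rule nn_integral_PInf_AE, auto)
    qed
    have "AE x in lborel. AE t in lborel. indicator ({0..1} \<times> {0..T}) (x, t) * E (x, t) = indicator ({0..1} \<times> {0..T}) (x, t) * intensity T d (x, t)"
      using fin[OF conjunct1[OF conjunct2[OF S1]] intensity_measurable_of_truncation[OF t1]]
        fin[OF conjunct1[OF conjunct2[OF S2]] intensity_measurable_of_truncation[OF t2]]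
    proof eventually_elim
      case (elim x)
      then show ?case by eventually_elim (auto simp: E_def less_top[symmetric] split: split_indicator)
    qed
    then show ?thesis unfolding mass_def
      by (intro nn_integral_mono_AE) (auto elim!: eventually_mono intro!: nn_integral_mono_AE)
  qed
  have "transport T d (\<lambda>x t. moment f1 x t - moment f2 x t) E (\<lambda>_. 0) j"
  proof
    show "0 < T" by fact
    show "modulus T d \<in> borel_measurable (borel \<Otimes>\<^sub>M borel \<Otimes>\<^sub>M borel \<Otimes>\<^sub>M borel)" by measurable
    show "E \<in> borel_measurable (borel \<Otimes>\<^sub>M borel)" by measurable
    show "(\<lambda>_. 0) \<in> borel_measurable borel" by measurable
    show "j \<in> borel_measurable (borel \<Otimes>\<^sub>M borel \<Otimes>\<^sub>M borel)" unfolding j_def by measurable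
    show "ennreal \<bar>moment f1 x t - moment f2 x t\<bar> \<le> E (x, t)" if "x \<in> {0..1}" "t \<in> {0..T}" for x t
      unfolding E_def d_def using that by (auto intro!: moment_diff_le)
    show "AE \<mu> in lborel. AE \<omega> in lborel. AE c in lborel. \<mu> \<in> {-1..1} \<and> 0 < \<omega> \<longrightarrow>
       mild_on_line T d (\<lambda>x \<mu> \<omega> t. - \<omega> * d x \<mu> \<omega> t + \<omega> * gstar \<omega> / scattering_rate * (moment f1 x t - moment f2 x t)) \<mu> \<omega> c"
    proof -
      let ?q = "\<lambda>f x \<mu> \<omega> t. - \<omega> * f x \<mu> \<omega> t + \<omega> * gstar \<omega> / scattering_rate * moment f x t"
      have q: "(\<lambda>x \<mu> \<omega> t. - \<omega> * d x \<mu> \<omega> t + \<omega> * gstar \<omega> / scattering_rate * (moment f1 x t - moment f2 x t)) = pointwise_diff (?q f1) (?q f2)"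
        unfolding d_def by (intro ext) (simp add: algebra_simps)
      have line: "mild_on_line T d (pointwise_diff (?q f1) (?q f2)) \<mu> \<omega> c"
        if "mild_on_line T f1 (?q f1) \<mu> \<omega> c" "mild_on_line T f2 (?q f2) \<mu> \<omega> c" for \<mu> \<omega> c
        unfolding mild_on_line_def
      proof (intro allI impI)
        fix a b assume ab: "0 \<le> a \<and> a \<le> b \<and> b \<le> T \<and> c + \<mu> * \<omega> * a \<in> {0..1} \<and> c + \<mu> * \<omega> * b \<in> {0..1}"
        note L1 = that(1)[unfolded mild_on_line_def, rule_format, OF ab]
        note L2 = that(2)[unfolded mild_on_line_def, rule_format, OF ab]
        show "set_integrable lborel {a..b} (\<lambda>t. ?q f1 (c + \<mu> * \<omega> * t) \<mu> \<omega> t - ?q f2 (c + \<mu> * \<omega> * t) \<mu> \<omega> t) \<and>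
          d (c + \<mu> * \<omega> * b) \<mu> \<omega> b - d (c + \<mu> * \<omega> * a) \<mu> \<omega> a =
          (LINT t:{a..b}|lborel. ?q f1 (c + \<mu> * \<omega> * t) \<mu> \<omega> t - ?q f2 (c + \<mu> * \<omega> * t) \<mu> \<omega> t)"
        proof
          show "set_integrable lborel {a..b} (\<lambda>t. ?q f1 (c + \<mu> * \<omega> * t) \<mu> \<omega> t - ?q f2 (c + \<mu> * \<omega> * t) \<mu> \<omega> t)"
            by (rule set_integral_diff(1)[OF conjunct1[OF L1] conjunct1[OF L2]])
          show "d (c + \<mu> * \<omega> * b) \<mu> \<omega> b - d (c + \<mu> * \<omega> * a) \<mu> \<omega> a =
            (LINT t:{a..b}|lborel. ?q f1 (c + \<mu> * \<omega> * t) \<mu> \<omega> t - ?q f2 (c + \<mu> * \<omega> * t) \<mu> \<omega> t)"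
            unfolding set_integral_diff(2)[OF conjunct1[OF L1] conjunct1[OF L2]]
              conjunct2[OF L1, symmetric] conjunct2[OF L2, symmetric] by (simp add: d_def)
        qed
      qed
      have m1: "AE \<mu> in lborel. AE \<omega> in lborel. AE c in lborel. \<mu> \<in> {-1..1} \<and> 0 < \<omega> \<longrightarrow> mild_on_line T f1 (?q f1) \<mu> \<omega> c"
        and m2: "AE \<mu> in lborel. AE \<omega> in lborel. AE c in lborel. \<mu> \<in> {-1..1} \<and> 0 < \<omega> \<longrightarrow> mild_on_line T f2 (?q f2) \<mu> \<omega> c"
        using S1 S2 by blast+
      show ?thesis unfolding q using m1 m2
      proof eventually_elim
        case (elim \<mu>) then show ?case
        proof eventually_elim
          case (elim \<omega>) then show ?case by eventually_elim (blast intro: line)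
        qed
      qed
    qed
    show "AE \<mu> in lborel. AE \<omega> in lborel. AE x in lborel. x \<in> {0..1} \<and> \<mu> \<in> {-1..1} \<and> 0 < \<omega> \<longrightarrow> d x \<mu> \<omega> 0 = 0"
    proof -
      have m1: "AE \<mu> in lborel. AE \<omega> in lborel. AE x in lborel. x \<in> {0..1} \<and> \<mu> \<in> {-1..1} \<and> 0 < \<omega> \<longrightarrow> f1 x \<mu> \<omega> 0 = 0"
        and m2: "AE \<mu> in lborel. AE \<omega> in lborel. AE x in lborel. x \<in> {0..1} \<and> \<mu> \<in> {-1..1} \<and> 0 < \<omega> \<longrightarrow> f2 x \<mu> \<omega> 0 = 0"
        using S1 S2 by blast+
      show ?thesis using m1 m2
      proof eventually_elim
        case (elim \<mu>) then show ?case
        proof eventually_elim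
          case (elim \<omega>) then show ?case by eventually_elim (auto simp: d_def)
        qed
      qed
    qed
    show "AE \<nu> in lborel. AE \<omega> in lborel. AE t in lborel.
       \<nu> \<in> {0<..1} \<and> 0 < \<omega> \<and> t \<in> {0..T} \<longrightarrow> ennreal \<bar>d 0 \<nu> \<omega> t\<bar> \<le> ennreal (1 / \<nu>) * 0"
    proof -
      have m1: "AE \<nu> in lborel. AE \<omega> in lborel. AE t in lborel. \<nu> \<in> {0<..1} \<and> 0 < \<omega> \<and> t \<in> {0..T} \<longrightarrow> f1 0 \<nu> \<omega> t = \<phi> \<nu> \<omega> t"
        and m2: "AE \<nu> in lborel. AE \<omega> in lborel. AE t in lborel. \<nu> \<in> {0<..1} \<and> 0 < \<omega> \<and> t \<in> {0..T} \<longrightarrow> f2 0 \<nu> \<omega> t = \<phi> \<nu> \<omega> t"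
        using S1 S2 by blast+
      show ?thesis using m1 m2
      proof eventually_elim
        case (elim \<nu>) then show ?case
        proof eventually_elim
          case (elim \<omega>) then show ?case by eventually_elim (auto simp: d_def)
        qed
      qed
    qed
    show "AE \<nu> in lborel. AE \<omega> in lborel. AE t in lborel. \<nu> \<in> {0<..1} \<and> 0 < \<omega> \<and> t \<in> {0..T} \<longrightarrow>
       ennreal \<bar>d 1 (- \<nu>) \<omega> t\<bar> \<le> ennreal \<bar>d 1 \<nu> \<omega> t\<bar> + j (\<nu>, \<omega>, t)"
    proof -
      have m1: "AE \<nu> in lborel. AE \<omega> in lborel. AE t in lborel. \<nu> \<in> {0<..1} \<and> 0 < \<omega> \<and> t \<in> {0..T} \<longrightarrow> f1 1 (- \<nu>) \<omega> t = \<eta>1 \<omega> * f1 1 \<nu> \<omega> t"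
        and m2: "AE \<nu> in lborel. AE \<omega> in lborel. AE t in lborel. \<nu> \<in> {0<..1} \<and> 0 < \<omega> \<and> t \<in> {0..T} \<longrightarrow> f2 1 (- \<nu>) \<omega> t = \<eta>2 \<omega> * f2 1 \<nu> \<omega> t"
        using S1 S2 by blast+
      show ?thesis using m1 m2
      proof eventually_elim
        case (elim \<nu>) then show ?case
        proof eventually_elim
          case (elim \<omega>) then show ?case
          proof eventually_elim
            case (elim t)
            show ?case
            proof
              assume A: "\<nu> \<in> {0<..1} \<and> 0 < \<omega> \<and> t \<in> {0..T}"
              with eta1 have e: "0 \<le> \<eta>1 \<omega>" "\<eta>1 \<omega> \<le> 1" by (auto simp: reflection_coefficient_def)
              \<comment> \<open>The splitting keeps \<eta>1 with the difference, where it is bounded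
                by 1, and leaves the defect multiplied by the trace of \<open>f2\<close>
                only.\<close>
              have "d 1 (- \<nu>) \<omega> t = \<eta>1 \<omega> * d 1 \<nu> \<omega> t + (\<eta>1 \<omega> - \<eta>2 \<omega>) * f2 1 \<nu> \<omega> t"
                using elim A by (simp add: d_def algebra_simps)
              then have "\<bar>d 1 (- \<nu>) \<omega> t\<bar> \<le> \<bar>\<eta>1 \<omega> * d 1 \<nu> \<omega> t\<bar> + \<bar>(\<eta>1 \<omega> - \<eta>2 \<omega>) * f2 1 \<nu> \<omega> t\<bar>" by linarith
              also have "\<bar>\<eta>1 \<omega> * d 1 \<nu> \<omega> t\<bar> \<le> \<bar>d 1 \<nu> \<omega> t\<bar>"
                using e by (simp add: abs_mult mult_left_le_one_le)
              finally have "ennreal \<bar>d 1 (- \<nu>) \<omega> t\<bar> \<le> ennreal (\<bar>d 1 \<nu> \<omega> t\<bar> + \<bar>\<eta>1 \<omega> - \<eta>2 \<omega>\<bar> * \<bar>f2 1 \<nu> \<omega> t\<bar>)"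
                by (intro ennreal_leI) (simp add: abs_mult)
              also have "\<dots> = ennreal \<bar>d 1 \<nu> \<omega> t\<bar> + j (\<nu>, \<omega>, t)"
                using A \<delta>[of \<omega>] by (simp add: j_def modulus_def ennreal_mult)
              finally show "ennreal \<bar>d 1 (- \<nu>) \<omega> t\<bar> \<le> ennreal \<bar>d 1 \<nu> \<omega> t\<bar> + j (\<nu>, \<omega>, t)" .
            qed
          qed
        qed
      qed
    qed
  qed
  then interpret transport T d "\<lambda>x t. moment f1 x t - moment f2 x t" E "\<lambda>_. 0" j .
  have fin: "mass T (intensity T d) < \<infinity>"
  proof -
    have "intensity T d z \<le> intensity T f1 z + intensity T f2 z" for z
    proof (cases z)
      case (Pair x t)
      note [measurable] = modulus_measurable_of_truncation[OF t1]
      have "intensity T d (x, t) \<le> (\<integral>\<^sup>+\<mu>. \<integral>\<^sup>+\<omega>. ennreal \<omega> * modulus T f1 (x, \<mu>, \<omega>, t) + ennreal \<omega> * modulus T f2 (x, \<mu>, \<omega>, t) \<partial>lborel \<partial>lborel)"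
        unfolding intensity_def prod.case distrib_left[symmetric]
      proof (intro nn_integral_mono mult_left_mono)
        fix \<mu> \<omega>
        show "modulus T d (x, \<mu>, \<omega>, t) \<le> modulus T f1 (x, \<mu>, \<omega>, t) + modulus T f2 (x, \<mu>, \<omega>, t)"
          unfolding modulus_truncation d_def truncation_diff
          by (subst ennreal_plus[symmetric], simp, simp, rule ennreal_leI, linarith)
      qed simp
      also have "\<dots> = intensity T f1 (x, t) + intensity T f2 (x, t)"
        unfolding intensity_def by (simp add: nn_integral_add)
      finally show ?thesis using Pair by simp
    qed
    then have "mass T (intensity T d) \<le> mass T (\<lambda>z. intensity T f1 z + intensity T f2 z)"
      by (intro mass_mono_AE) simp
    also have "\<dots> = mass T (intensity T f1) + mass T (intensity T f2)" by (rule mass_add) measurable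
    also have "\<dots> < \<infinity>" using S1 S2 by simp
    finally show ?thesis .
  qed
  have M: "M = mass T (intensity T d)" by (simp add: M_def d_def)
  let ?J = "\<integral>\<^sup>+\<nu>. \<integral>\<^sup>+\<omega>. \<integral>\<^sup>+t. indicator ({0<..1} \<times> {0<..} \<times> {0..T}) (\<nu>, \<omega>, t) * (ennreal (\<nu> * \<omega>) * j (\<nu>, \<omega>, t)) \<partial>lborel \<partial>lborel \<partial>lborel"
  have "M \<le> ?J / (1 - kappa T)"
    unfolding M by (rule mass_le_of_zero_inflow[OF refl massE fin])
  also have "?J \<le> (\<integral>\<^sup>+\<nu>. \<integral>\<^sup>+\<omega>. \<integral>\<^sup>+t. indicator {0<..1::real} \<nu> * ((\<delta> \<omega> * (ennreal \<omega> * c \<omega>) * indicator {0<..} \<omega>) * indicator {0..T} t) \<partial>lborel \<partial>lborel \<partial>lborel)"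
  proof (rule nn_integral_mono_AE, use trace in eventually_elim)
    fix \<nu> assume tr: "AE \<omega> in lborel. AE t in lborel. \<nu> \<in> {0<..1} \<longrightarrow> modulus T f2 (1, \<nu>, \<omega>, t) \<le> ennreal (\<nu> powr - (3/4)) * c \<omega>"
    show "(\<integral>\<^sup>+\<omega>. \<integral>\<^sup>+t. indicator ({0<..1} \<times> {0<..} \<times> {0..T}) (\<nu>, \<omega>, t) * (ennreal (\<nu> * \<omega>) * j (\<nu>, \<omega>, t)) \<partial>lborel \<partial>lborel)
      \<le> (\<integral>\<^sup>+\<omega>. \<integral>\<^sup>+t. indicator {0<..1} \<nu> * ((\<delta> \<omega> * (ennreal \<omega> * c \<omega>) * indicator {0<..} \<omega>) * indicator {0..T} t) \<partial>lborel \<partial>lborel)"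
    proof (rule nn_integral_mono_AE, use tr in eventually_elim)
      fix \<omega> assume tr: "AE t in lborel. \<nu> \<in> {0<..1} \<longrightarrow> modulus T f2 (1, \<nu>, \<omega>, t) \<le> ennreal (\<nu> powr - (3/4)) * c \<omega>"
      show "(\<integral>\<^sup>+t. indicator ({0<..1} \<times> {0<..} \<times> {0..T}) (\<nu>, \<omega>, t) * (ennreal (\<nu> * \<omega>) * j (\<nu>, \<omega>, t)) \<partial>lborel)
        \<le> (\<integral>\<^sup>+t. indicator {0<..1} \<nu> * ((\<delta> \<omega> * (ennreal \<omega> * c \<omega>) * indicator {0<..} \<omega>) * indicator {0..T} t) \<partial>lborel)"
      proof (rule nn_integral_mono_AE, use tr in eventually_elim)
        fix t assume tr: "\<nu> \<in> {0<..1} \<longrightarrow> modulus T f2 (1, \<nu>, \<omega>, t) \<le> ennreal (\<nu> powr - (3/4)) * c \<omega>"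
        show "indicator ({0<..1} \<times> {0<..} \<times> {0..T}) (\<nu>, \<omega>, t) * (ennreal (\<nu> * \<omega>) * j (\<nu>, \<omega>, t))
          \<le> indicator {0<..1} \<nu> * ((\<delta> \<omega> * (ennreal \<omega> * c \<omega>) * indicator {0<..} \<omega>) * indicator {0..T} t)"
        proof (cases "\<nu> \<in> {0<..1} \<and> 0 < \<omega> \<and> t \<in> {0..T}")
          case True
          \<comment> \<open>The flux weight \<nu> absorbs the grazing singularity \<nu>^(-3/4) of
            the trace.\<close>
          have p: "ennreal (\<nu> * \<nu> powr - (3/4)) \<le> 1" using True mult_powr_le_1[of \<nu>] by simp
          have "ennreal (\<nu> * \<omega>) * j (\<nu>, \<omega>, t) \<le> ennreal (\<nu> * \<omega>) * (\<delta> \<omega> * (ennreal (\<nu> powr - (3/4)) * c \<omega>))"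
            unfolding j_def prod.case using tr True by (intro mult_left_mono) auto
          also have "\<dots> = ennreal (\<nu> * \<nu> powr - (3/4)) * (\<delta> \<omega> * (ennreal \<omega> * c \<omega>))"
            using True by (simp add: ennreal_mult mult_ac)
          also have "\<dots> \<le> 1 * (\<delta> \<omega> * (ennreal \<omega> * c \<omega>))"
            using p by (rule mult_right_mono) simp
          finally show ?thesis using True by simp
        next
          case False
          then have "indicator ({0<..1} \<times> {0<..} \<times> {0..T}) (\<nu>, \<omega>, t) = (0 :: ennreal)" by auto
          then show ?thesis by simp
        qed
      qed
    qed
  qed
  also have "\<dots> = ennreal T * (\<integral>\<^sup>+\<omega>. \<delta> \<omega> * (ennreal \<omega> * c \<omega>) * indicator {0<..} \<omega> \<partial>lborel)"
    using T by (simp add: nn_integral_cmult nn_integral_multc mult.commute)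
  finally show "M \<le> ennreal T * (\<integral>\<^sup>+\<omega>. \<delta> \<omega> * (ennreal \<omega> * c \<omega>) * indicator {0<..} \<omega> \<partial>lborel) / (1 - kappa T)"
    by (simp add: divide_right_mono_ennreal)
  show "AE \<nu> in lborel. AE \<omega> in lborel. \<nu> \<in> {0<..1} \<and> 0 < \<omega> \<longrightarrow>
      (\<integral>\<^sup>+t. modulus T (pointwise_diff f1 f2) (1, \<nu>, \<omega>, t) \<partial>lborel) \<le> ennreal (gstar \<omega> / \<nu>) / gstar_mass * M"
    using out_trace_time_integral[OF refl]
  proof eventually_elim
    case (elim \<nu>) then show ?case
    proof eventually_elim
      case (elim \<omega>)
      show ?case
      proof
        assume "\<nu> \<in> {0<..1} \<and> 0 < \<omega>"
        with elim have "(\<integral>\<^sup>+t. modulus T d (1, \<nu>, \<omega>, t) \<partial>lborel) \<le> ennreal (gstar \<omega> / \<nu>) / gstar_mass * mass T E" by simp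
        also have "\<dots> \<le> ennreal (gstar \<omega> / \<nu>) / gstar_mass * M" unfolding M using massE by (rule mult_left_mono) simp
        finally show "(\<integral>\<^sup>+t. modulus T (pointwise_diff f1 f2) (1, \<nu>, \<omega>, t) \<partial>lborel) \<le> ennreal (gstar \<omega> / \<nu>) / gstar_mass * M"
          by (simp add: d_def)
      qed
    qed
  qed
qed

subsection \<open>Forward and adjoint solutions\<close>

lemma nn_integral_lborel_Pair:
  fixes f :: "'a::euclidean_space \<times> 'b::euclidean_space \<Rightarrow> ennreal"
  assumes "f \<in> borel_measurable borel"
  shows "(\<integral>\<^sup>+z. f z \<partial>lborel) = (\<integral>\<^sup>+x. \<integral>\<^sup>+y. f (x, y) \<partial>lborel \<partial>lborel)"
proof -
  have [measurable]: "f \<in> borel_measurable (borel \<Otimes>\<^sub>M borel)"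
    using assms by (simp add: borel_prod)
  have "(\<integral>\<^sup>+z. f z \<partial>lborel) = (\<integral>\<^sup>+z. f z \<partial>(lborel \<Otimes>\<^sub>M lborel))"
    by (simp only: lborel_prod)
  also have "\<dots> = (\<integral>\<^sup>+x. \<integral>\<^sup>+y. f (x, y) \<partial>lborel \<partial>lborel)"
    by (rule lborel.nn_integral_fst[symmetric]) measurable
  finally show ?thesis .
qed

lemma phase_integrable_truncation:
  assumes "phase_integrable T f"
  shows "truncation T f \<in> borel_measurable (borel \<Otimes>\<^sub>M borel \<Otimes>\<^sub>M borel \<Otimes>\<^sub>M borel)"
    and "mass T (intensity T f) < \<infinity>"
proof -
  define R where "R = (\<lambda>z. indicator ({0..1} \<times> {-1..1} \<times> {0<..} \<times> {0..T}) z * (case z of (x, \<mu>, \<omega>, t) \<Rightarrow> \<omega> * f x \<mu> \<omega> t))"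
  have int: "integrable lborel R"
    using assms by (simp add: phase_integrable_def set_integrable_def R_def)
  then have R_borel [measurable]: "R \<in> borel_measurable borel" by auto
  then have R_meas [measurable]: "R \<in> borel_measurable (borel \<Otimes>\<^sub>M borel \<Otimes>\<^sub>M borel \<Otimes>\<^sub>M borel)"
    by (simp add: borel_prod)
  \<comment> \<open>Integrability is assumed for \<omega>f; division by \<omega> recovers the
    measurability of \<open>f\<close>. For \<omega> \<le> 0 the function \<open>R\<close> is zero,
    so the quotient is zero there as well.\<close>
  have "truncation T f = (\<lambda>(x, \<mu>, \<omega>, t). R (x, \<mu>, \<omega>, t) / \<omega>)"
    by (auto simp: truncation_def R_def split: split_indicator)
  then show meas: "truncation T f \<in> borel_measurable (borel \<Otimes>\<^sub>M borel \<Otimes>\<^sub>M borel \<Otimes>\<^sub>M borel)" by simp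
  have R: "ennreal \<omega> * modulus T f (x, \<mu>, \<omega>, t) = ennreal \<bar>R (x, \<mu>, \<omega>, t)\<bar>" for x \<mu> \<omega> t
    by (cases "0 < \<omega>") (auto simp: modulus_def R_def abs_mult ennreal_mult split: split_indicator)
  have "mass T (intensity T f) \<le> (\<integral>\<^sup>+x. \<integral>\<^sup>+t. \<integral>\<^sup>+\<mu>. \<integral>\<^sup>+\<omega>. ennreal \<bar>R (x, \<mu>, \<omega>, t)\<bar> \<partial>lborel \<partial>lborel \<partial>lborel \<partial>lborel)"
    unfolding mass_def intensity_def prod.case R
    by (intro nn_integral_mono) (auto split: split_indicator)
  also have "\<dots> = (\<integral>\<^sup>+x. \<integral>\<^sup>+\<mu>. \<integral>\<^sup>+t. \<integral>\<^sup>+\<omega>. ennreal \<bar>R (x, \<mu>, \<omega>, t)\<bar> \<partial>lborel \<partial>lborel \<partial>lborel \<partial>lborel)"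
    by (intro nn_integral_cong lborel_pair.Fubini') measurable
  also have "\<dots> = (\<integral>\<^sup>+x. \<integral>\<^sup>+\<mu>. \<integral>\<^sup>+\<omega>. \<integral>\<^sup>+t. ennreal \<bar>R (x, \<mu>, \<omega>, t)\<bar> \<partial>lborel \<partial>lborel \<partial>lborel \<partial>lborel)"
    by (intro nn_integral_cong lborel_pair.Fubini') measurable
  also have "\<dots> = (\<integral>\<^sup>+z. ennreal \<bar>R z\<bar> \<partial>lborel)"
    by (simp add: nn_integral_lborel_Pair R_borel)
  also have "\<dots> < \<infinity>" using int by (simp add: integrable_iff_bounded)
  finally show "mass T (intensity T f) < \<infinity>" .
qed

lemma forward_reflecting_solution:
  assumes "forward_solution T \<phi> \<eta> g"
  shows "reflecting_solution T \<phi> \<eta> g"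
  unfolding reflecting_solution_def
proof (intro conjI)
  note S = assms[unfolded forward_solution_def mild_transport_def collision_def]
  show "truncation T g \<in> borel_measurable (borel \<Otimes>\<^sub>M borel \<Otimes>\<^sub>M borel \<Otimes>\<^sub>M borel)" "mass T (intensity T g) < \<infinity>"
    using S phase_integrable_truncation by blast+
  show "AE \<mu> in lborel. AE \<omega> in lborel. AE c in lborel. \<mu> \<in> {-1..1} \<and> 0 < \<omega> \<longrightarrow>
    mild_on_line T g (\<lambda>x \<mu> \<omega> t. - \<omega> * g x \<mu> \<omega> t + \<omega> * gstar \<omega> / scattering_rate * moment g x t) \<mu> \<omega> c"
    unfolding mild_on_line_def by (rule AE_lborel_prod3) (use S in simp)
  show "AE \<mu> in lborel. AE \<omega> in lborel. AE x in lborel. x \<in> {0..1} \<and> \<mu> \<in> {-1..1} \<and> 0 < \<omega> \<longrightarrow> g x \<mu> \<omega> 0 = 0"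
    by (rule AE_rotate) (use S in simp)
  show "AE \<nu> in lborel. AE \<omega> in lborel. AE t in lborel. \<nu> \<in> {0<..1} \<and> 0 < \<omega> \<and> t \<in> {0..T} \<longrightarrow> g 0 \<nu> \<omega> t = \<phi> \<nu> \<omega> t"
    by (rule AE_lborel_prod3) (use S in simp)
  have "AE \<mu> in lborel. AE \<omega> in lborel. AE t in lborel. \<mu> \<in> {-1..<0} \<and> 0 < \<omega> \<and> t \<in> {0..T} \<longrightarrow> g 1 \<mu> \<omega> t = \<eta> \<omega> * g 1 (- \<mu>) \<omega> t"
    by (rule AE_lborel_prod3) (use S in simp)
  from AE_lborel_uminus[OF this]
  show "AE \<nu> in lborel. AE \<omega> in lborel. AE t in lborel. \<nu> \<in> {0<..1} \<and> 0 < \<omega> \<and> t \<in> {0..T} \<longrightarrow> g 1 (- \<nu>) \<omega> t = \<eta> \<omega> * g 1 \<nu> \<omega> t"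
    by (simp add: conj_commute[of "_ < _" "_ \<le> _"])
qed

abbreviation reversed :: "real \<Rightarrow> (real \<Rightarrow> real \<Rightarrow> real \<Rightarrow> real \<Rightarrow> real) \<Rightarrow> real \<Rightarrow> real \<Rightarrow> real \<Rightarrow> real \<Rightarrow> real" where
  "reversed T h \<equiv> (\<lambda>x \<mu> \<omega> t. h x (- \<mu>) \<omega> (T - t))"

lemma truncation_reversed: "truncation T (reversed T h) (x, \<mu>, \<omega>, t) = truncation T h (x, - \<mu>, \<omega>, T - t)"
  by (auto simp: truncation_def split: split_indicator)

lemma intensity_reversed:
  assumes "truncation T h \<in> borel_measurable (borel \<Otimes>\<^sub>M borel \<Otimes>\<^sub>M borel \<Otimes>\<^sub>M borel)"
  shows "intensity T (reversed T h) (x, t) = intensity T h (x, T - t)"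
proof -
  note [measurable] = modulus_measurable_of_truncation[OF assms]
  have "modulus T (reversed T h) (x, \<mu>, \<omega>, t) = modulus T h (x, - \<mu>, \<omega>, T - t)" for \<mu> \<omega>
    by (simp only: modulus_truncation truncation_reversed)
  then show ?thesis
    unfolding intensity_def
    using nn_integral_flip[of "\<lambda>\<mu>. \<integral>\<^sup>+\<omega>. ennreal \<omega> * modulus T h (x, \<mu>, \<omega>, T - t) \<partial>lborel" 0] by simp
qed

lemma mass_reversed:
  assumes "truncation T h \<in> borel_measurable (borel \<Otimes>\<^sub>M borel \<Otimes>\<^sub>M borel \<Otimes>\<^sub>M borel)"
  shows "mass T (intensity T (reversed T h)) = mass T (intensity T h)"
proof -
  note [measurable] = intensity_measurable_of_truncation[OF assms]
  have "mass T (intensity T (reversed T h))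
    = (\<integral>\<^sup>+x. \<integral>\<^sup>+t. indicator ({0..1} \<times> {0..T}) (x, T - t) * intensity T h (x, T - t) \<partial>lborel \<partial>lborel)"
    unfolding mass_def intensity_reversed[OF assms]
    by (intro nn_integral_cong) (auto split: split_indicator)
  also have "\<dots> = mass T (intensity T h)"
    unfolding mass_def
    by (intro nn_integral_cong nn_integral_flip[of "\<lambda>t. indicator ({0..1} \<times> {0..T}) (_, t) * intensity T h (_, t)" T]) measurable
  finally show ?thesis .
qed

lemma moment_reversed: "moment (reversed T h) x t = moment h x (T - t)"
proof -
  define k where "k \<mu> = (LINT \<omega>:{0<..}|lborel. \<omega> * h x \<mu> \<omega> (T - t))" for \<mu>
  have "moment (reversed T h) x t = (\<integral>\<mu>. indicator {-1..1} (0 + (-1) * \<mu>) * k (0 + (-1) * \<mu>) \<partial>lborel)"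
    unfolding bracket_def k_def set_lebesgue_integral_def[of lborel "{-1..1}"]
    by (intro Bochner_Integration.integral_cong) (auto split: split_indicator)
  also have "\<dots> = (\<integral>\<mu>. indicator {-1..1} \<mu> * k \<mu> \<partial>lborel)"
    using lborel_integral_real_affine[of "-1" "\<lambda>\<mu>. indicator {-1..1} \<mu> * k \<mu>" 0] by simp
  also have "\<dots> = moment h x (T - t)"
    unfolding bracket_def k_def set_lebesgue_integral_def[of lborel "{-1..1}"] by simp
  finally show ?thesis .
qed

text \<open>Reversing time and direction together changes the sign of the whole transport operator,
  so the right-hand side turns from minus the collision operator into plus it. The final condition
  becomes the initial one, and \<mu> = -\<nu> in the datum produces the minus sign.\<close>

lemma adjoint_reflecting_solution:
  assumes "adjoint_solution T \<psi> \<eta> h"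
  shows "reflecting_solution T (\<lambda>\<nu> \<omega> t. - \<psi> (T - t) * gstar \<omega> / \<nu>) \<eta> (reversed T h)"
  unfolding reflecting_solution_def
proof (intro conjI)
  note S = assms[unfolded adjoint_solution_def mild_transport_def collision_def]
  have tr [measurable]: "truncation T h \<in> borel_measurable (borel \<Otimes>\<^sub>M borel \<Otimes>\<^sub>M borel \<Otimes>\<^sub>M borel)"
    and fin: "mass T (intensity T h) < \<infinity>"
    using S phase_integrable_truncation by blast+
  have "truncation T (reversed T h) = (\<lambda>(x, \<mu>, \<omega>, t). truncation T h (x, - \<mu>, \<omega>, T - t))"
    by (auto simp: truncation_reversed)
  then show "truncation T (reversed T h) \<in> borel_measurable (borel \<Otimes>\<^sub>M borel \<Otimes>\<^sub>M borel \<Otimes>\<^sub>M borel)" by simp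
  show "mass T (intensity T (reversed T h)) < \<infinity>" using fin by (simp only: mass_reversed[OF tr])
  let ?q = "\<lambda>x \<mu> \<omega> t. - \<omega> * h x \<mu> \<omega> t + \<omega> * gstar \<omega> / scattering_rate * moment h x t"
  have mild: "AE \<mu> in lborel. AE \<omega> in lborel. AE c in lborel. \<mu> \<in> {-1..1} \<and> 0 < \<omega> \<longrightarrow> mild_on_line T h (\<lambda>x \<mu> \<omega> t. - ?q x \<mu> \<omega> t) \<mu> \<omega> c"
    unfolding mild_on_line_def by (rule AE_lborel_prod3) (use S in simp)
  have q: "(\<lambda>x \<mu> \<omega> t. - \<omega> * reversed T h x \<mu> \<omega> t + \<omega> * gstar \<omega> / scattering_rate * moment (reversed T h) x t) = reversed T ?q"
    by (simp add: moment_reversed)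
  \<comment> \<open>At time t the reversed solution on the line \<open>c\<close> sees
    \<open>h\<close> at time T - t, on the line in direction -\<mu> that has parameter c +
    \<mu>\<omega>T.\<close>
  have line: "mild_on_line T (reversed T h) (reversed T ?q) \<mu> \<omega> c"
    if L: "mild_on_line T h (\<lambda>x \<mu> \<omega> t. - ?q x \<mu> \<omega> t) (- \<mu>) \<omega> (c + \<mu> * \<omega> * T)" for \<mu> \<omega> c
    unfolding mild_on_line_def
  proof (intro allI impI)
    fix a b assume ab: "0 \<le> a \<and> a \<le> b \<and> b \<le> T \<and> c + \<mu> * \<omega> * a \<in> {0..1} \<and> c + \<mu> * \<omega> * b \<in> {0..1}"
    have pos: "c + \<mu> * \<omega> * T + - \<mu> * \<omega> * s = c + \<mu> * \<omega> * (T - s)" for s by (simp add: algebra_simps)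
    define k where "k s = ?q (c + \<mu> * \<omega> * (T - s)) (- \<mu>) \<omega> s" for s
    have "0 \<le> T - b \<and> T - b \<le> T - a \<and> T - a \<le> T \<and> c + \<mu> * \<omega> * (T - (T - b)) \<in> {0..1} \<and> c + \<mu> * \<omega> * (T - (T - a)) \<in> {0..1}"
      using ab by simp
    from L[unfolded mild_on_line_def pos, rule_format, OF this]
    have int: "set_integrable lborel {T - b..T - a} (\<lambda>s. - k s)"
      and eq: "h (c + \<mu> * \<omega> * a) (- \<mu>) \<omega> (T - a) - h (c + \<mu> * \<omega> * b) (- \<mu>) \<omega> (T - b) = (LINT s:{T - b..T - a}|lborel. - k s)"
      by (simp_all add: k_def)
    have ind: "indicator {T - b..T - a} (T + (-1) * t) = (indicator {a..b} t :: real)" for t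
      by (auto split: split_indicator)
    have i1: "integrable lborel (\<lambda>s. indicator {T - b..T - a} s * k s)"
      using int unfolding set_integrable_def by simp
    have i2: "integrable lborel (\<lambda>t. indicator {a..b} t * k (T - t))"
      using lborel_integrable_real_affine[OF i1, of "-1" T] unfolding ind by simp
    have "(\<integral>s. indicator {T - b..T - a} s * k s \<partial>lborel) = (\<integral>t. indicator {a..b} t * k (T - t) \<partial>lborel)"
      using lborel_integral_real_affine[of "-1" "\<lambda>s. indicator {T - b..T - a} s * k s" T] unfolding ind by simp
    then have "h (c + \<mu> * \<omega> * b) (- \<mu>) \<omega> (T - b) - h (c + \<mu> * \<omega> * a) (- \<mu>) \<omega> (T - a) = (\<integral>t. indicator {a..b} t * k (T - t) \<partial>lborel)"
      using eq by (simp add: set_lebesgue_integral_def)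
    moreover have "k (T - t) = reversed T ?q (c + \<mu> * \<omega> * t) \<mu> \<omega> t" for t by (simp add: k_def)
    ultimately show "set_integrable lborel {a..b} (\<lambda>t. reversed T ?q (c + \<mu> * \<omega> * t) \<mu> \<omega> t) \<and>
      reversed T h (c + \<mu> * \<omega> * b) \<mu> \<omega> b - reversed T h (c + \<mu> * \<omega> * a) \<mu> \<omega> a =
      (LINT t:{a..b}|lborel. reversed T ?q (c + \<mu> * \<omega> * t) \<mu> \<omega> t)"
      using i2 by (simp add: set_integrable_def set_lebesgue_integral_def)
  qed
  show "AE \<mu> in lborel. AE \<omega> in lborel. AE c in lborel. \<mu> \<in> {-1..1} \<and> 0 < \<omega> \<longrightarrow>
    mild_on_line T (reversed T h) (\<lambda>x \<mu> \<omega> t. - \<omega> * reversed T h x \<mu> \<omega> t + \<omega> * gstar \<omega> / scattering_rate * moment (reversed T h) x t) \<mu> \<omega> c"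
    unfolding q using AE_lborel_uminus[OF mild]
  proof eventually_elim
    case (elim \<mu>) then show ?case
    proof eventually_elim
      case (elim \<omega>)
      from AE_lborel_affine[OF _ this, of 1 "\<mu> * \<omega> * T"]
      have "AE c in lborel. - \<mu> \<in> {-1..1} \<and> 0 < \<omega> \<longrightarrow> mild_on_line T h (\<lambda>x \<mu> \<omega> t. - ?q x \<mu> \<omega> t) (- \<mu>) \<omega> (c + \<mu> * \<omega> * T)"
        by (simp add: add.commute)
      then show ?case
      proof eventually_elim
        case (elim c)
        show ?case by (intro impI line mp[OF elim]) auto
      qed
    qed
  qed
  have "AE \<mu> in lborel. AE \<omega> in lborel. AE x in lborel. x \<in> {0..1} \<and> \<mu> \<in> {-1..1} \<and> 0 < \<omega> \<longrightarrow> h x \<mu> \<omega> T = 0"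
    by (rule AE_rotate) (use S in simp)
  from AE_lborel_uminus[OF this]
  show "AE \<mu> in lborel. AE \<omega> in lborel. AE x in lborel. x \<in> {0..1} \<and> \<mu> \<in> {-1..1} \<and> 0 < \<omega> \<longrightarrow> reversed T h x \<mu> \<omega> 0 = 0"
    by eventually_elim (auto elim!: eventually_mono)
  have "AE \<mu> in lborel. AE \<omega> in lborel. AE t in lborel. \<mu> \<in> {-1..<0} \<and> 0 < \<omega> \<and> t \<in> {0..T} \<longrightarrow> h 0 \<mu> \<omega> t = \<psi> t * gstar \<omega> / \<mu>"
    by (rule AE_lborel_prod3) (use S in simp)
  from AE_lborel_uminus[OF this]
  show "AE \<nu> in lborel. AE \<omega> in lborel. AE t in lborel. \<nu> \<in> {0<..1} \<and> 0 < \<omega> \<and> t \<in> {0..T} \<longrightarrow>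
    reversed T h 0 \<nu> \<omega> t = - \<psi> (T - t) * gstar \<omega> / \<nu>"
  proof eventually_elim
    case (elim \<nu>) then show ?case
    proof eventually_elim
      case (elim \<omega>)
      from AE_lborel_reflect[OF this, of T] show ?case by eventually_elim auto
    qed
  qed
  have "AE \<mu> in lborel. AE \<omega> in lborel. AE t in lborel. \<mu> \<in> {0<..1} \<and> 0 < \<omega> \<and> t \<in> {0..T} \<longrightarrow> h 1 \<mu> \<omega> t = \<eta> \<omega> * h 1 (- \<mu>) \<omega> t"
    by (rule AE_lborel_prod3) (use S in simp)
  then show "AE \<nu> in lborel. AE \<omega> in lborel. AE t in lborel. \<nu> \<in> {0<..1} \<and> 0 < \<omega> \<and> t \<in> {0..T} \<longrightarrow>
    reversed T h 1 (- \<nu>) \<omega> t = \<eta> \<omega> * reversed T h 1 \<nu> \<omega> t"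
  proof eventually_elim
    case (elim \<nu>) then show ?case
    proof eventually_elim
      case (elim \<omega>)
      from AE_lborel_reflect[OF this, of T] show ?case by eventually_elim auto
    qed
  qed
qed

subsection \<open>The derivative of the forward map\<close>

text \<open>The estimate of the derivative is pointwise in \<omega>, so the frequency must become
  the outermost variable of the trace bounds.\<close>

lemma AE_trace_swap:
  fixes F H :: "real \<times> real \<times> real \<Rightarrow> ennreal"
  assumes [measurable]: "F \<in> borel_measurable (borel \<Otimes>\<^sub>M borel \<Otimes>\<^sub>M borel)" "H \<in> borel_measurable (borel \<Otimes>\<^sub>M borel \<Otimes>\<^sub>M borel)"
    and "AE \<nu> in lborel. AE \<omega> in lborel. AE t in lborel. \<nu> \<in> {0<..1} \<longrightarrow> F (\<nu>, \<omega>, t) \<le> H (\<nu>, \<omega>, t)"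
  shows "AE \<omega> in lborel. AE \<nu> in lborel. AE t in lborel. \<nu> \<in> {0<..1} \<longrightarrow> F (\<nu>, \<omega>, t) \<le> H (\<nu>, \<omega>, t)"
proof -
  define P where "P w \<longleftrightarrow> (fst w \<in> {0<..1} \<longrightarrow> F w \<le> H w)" for w :: "real \<times> real \<times> real"
  have "Measurable.pred (borel \<Otimes>\<^sub>M borel \<Otimes>\<^sub>M borel) P" unfolding P_def by measurable
  from AE_swap3_left[OF this] assms(3) show ?thesis unfolding P_def fst_conv by blast
qed

lemma AE_trace_swap2:
  fixes F H :: "real \<times> real \<Rightarrow> ennreal"
  assumes [measurable]: "F \<in> borel_measurable (borel \<Otimes>\<^sub>M borel)" "H \<in> borel_measurable (borel \<Otimes>\<^sub>M borel)"
    and "AE \<nu> in lborel. AE \<omega> in lborel. \<nu> \<in> {0<..1} \<and> 0 < \<omega> \<longrightarrow> F (\<nu>, \<omega>) \<le> H (\<nu>, \<omega>)"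
  shows "AE \<omega> in lborel. AE \<nu> in lborel. \<nu> \<in> {0<..1} \<and> 0 < \<omega> \<longrightarrow> F (\<nu>, \<omega>) \<le> H (\<nu>, \<omega>)"
proof -
  define P where "P w \<longleftrightarrow> (fst w \<in> {0<..1} \<and> 0 < snd w \<longrightarrow> F w \<le> H w)" for w :: "real \<times> real"
  have [measurable]: "Measurable.pred (borel \<Otimes>\<^sub>M borel) P" unfolding P_def by measurable
  have "AE w in lborel \<Otimes>\<^sub>M lborel. P w"
  proof (rule lborel_pair.AE_pair_measure)
    show "{w \<in> space (lborel \<Otimes>\<^sub>M lborel). P w} \<in> sets (lborel \<Otimes>\<^sub>M lborel)" by measurable
    show "AE x in lborel. AE y in lborel. P (x, y)" unfolding P_def fst_conv snd_conv by (rule assms(3))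
  qed
  have "(AE \<nu> in lborel. AE \<omega> in lborel. P (\<nu>, \<omega>)) \<longleftrightarrow> (AE \<omega> in lborel. AE \<nu> in lborel. P (\<nu>, \<omega>))"
    by (rule lborel_pair.AE_commute) measurable
  with assms(3) show ?thesis unfolding P_def fst_conv snd_conv by blast
qed

lemma nn_integral_incoming_half:
  fixes A :: "real \<times> real \<Rightarrow> ennreal"
  assumes [measurable]: "A \<in> borel_measurable (borel \<Otimes>\<^sub>M borel)"
  shows "(\<integral>\<^sup>+t. \<integral>\<^sup>+\<mu>. indicator {-1..0} \<mu> * (ennreal (- \<mu> * a) * A (- \<mu>, t)) \<partial>lborel \<partial>lborel)
    = (\<integral>\<^sup>+\<nu>. indicator {0<..1} \<nu> * (ennreal (\<nu> * a) * (\<integral>\<^sup>+t. A (\<nu>, t) \<partial>lborel)) \<partial>lborel)"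
proof -
  define h where "h \<nu> = indicator {0..1} \<nu> * (ennreal (\<nu> * a) * (\<integral>\<^sup>+t. A (\<nu>, t) \<partial>lborel))" for \<nu> :: real
  have [measurable]: "h \<in> borel_measurable borel" unfolding h_def by measurable
  have "(\<integral>\<^sup>+t. \<integral>\<^sup>+\<mu>. indicator {-1..0} \<mu> * (ennreal (- \<mu> * a) * A (- \<mu>, t)) \<partial>lborel \<partial>lborel)
    = (\<integral>\<^sup>+\<mu>. \<integral>\<^sup>+t. indicator {-1..0} \<mu> * (ennreal (- \<mu> * a) * A (- \<mu>, t)) \<partial>lborel \<partial>lborel)"
    by (intro lborel_pair.Fubini') measurable
  also have "\<dots> = (\<integral>\<^sup>+\<mu>. h (0 - \<mu>) \<partial>lborel)"
    unfolding h_def by (intro nn_integral_cong) (auto simp: nn_integral_cmult split: split_indicator)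
  also have "\<dots> = (\<integral>\<^sup>+\<nu>. h \<nu> \<partial>lborel)" by (rule nn_integral_flip) measurable
  also have "\<dots> = (\<integral>\<^sup>+\<nu>. indicator {0<..1} \<nu> * (ennreal (\<nu> * a) * (\<integral>\<^sup>+t. A (\<nu>, t) \<partial>lborel)) \<partial>lborel)"
    by (intro nn_integral_cong_AE eventually_mono[OF AE_lborel_singleton[of 0]]) (auto simp: h_def split: split_indicator)
  finally show ?thesis .
qed

text \<open>For \<mu> < 0 the adjoint trace h(1, \<mu>, \<omega>, t) is the trace of the reversed
  solution in the outgoing direction -\<mu> at time T - t. Both factors of the product are therefore
  outgoing traces at x = 1.\<close>

lemma frechet_M_truncation:
  assumes "0 < \<omega>"
  shows "frechet_M T g h \<omega> = 1 / scattering_rate * (\<integral>t. \<integral>\<mu>. indicator {-1..0} \<mu> * (\<mu> * (\<omega> / gstar \<omega>) *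
     (truncation T (reversed T h) (1, - \<mu>, \<omega>, T - t) * truncation T g (1, - \<mu>, \<omega>, t))) \<partial>lborel \<partial>lborel)"
proof -
  have "(LINT t:{0..T}|lborel. LINT \<mu>:{-1..0}|lborel. \<mu> * \<omega> * h 1 \<mu> \<omega> t * g 1 (- \<mu>) \<omega> t / gstar \<omega>)
    = (\<integral>t. \<integral>\<mu>. indicator {0..T} t * (indicator {-1..0} \<mu> * (\<mu> * \<omega> * h 1 \<mu> \<omega> t * g 1 (- \<mu>) \<omega> t / gstar \<omega>)) \<partial>lborel \<partial>lborel)"
    by (simp add: set_lebesgue_integral_def)
  also have "\<dots> = (\<integral>t. \<integral>\<mu>. indicator {-1..0} \<mu> * (\<mu> * (\<omega> / gstar \<omega>) *
     (truncation T (reversed T h) (1, - \<mu>, \<omega>, T - t) * truncation T g (1, - \<mu>, \<omega>, t))) \<partial>lborel \<partial>lborel)"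
    using assms by (intro Bochner_Integration.integral_cong) (auto simp: truncation_def split: split_indicator)
  finally show ?thesis by (simp add: frechet_M_def)
qed

text \<open>The derivative is bilinear in the traces. In each of the two difference terms the
  undifferenced factor is bounded pointwise in t by \<nu>^(-3/4) times its profile, and the
  differenced one is integrated in t; integrating \<nu>^(-3/4) then yields the 4.\<close>

lemma frechet_M_difference:
  fixes T :: real and g1 g2 h1 h2 :: "real \<Rightarrow> real \<Rightarrow> real \<Rightarrow> real \<Rightarrow> real" and cg ch :: "real \<Rightarrow> ennreal"
  defines "k1 \<equiv> reversed T h1" and "k2 \<equiv> reversed T h2"
  assumes T: "0 < T"
    and tg1: "truncation T g1 \<in> borel_measurable (borel \<Otimes>\<^sub>M borel \<Otimes>\<^sub>M borel \<Otimes>\<^sub>M borel)"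
    and tg2: "truncation T g2 \<in> borel_measurable (borel \<Otimes>\<^sub>M borel \<Otimes>\<^sub>M borel \<Otimes>\<^sub>M borel)"
    and tk1: "truncation T k1 \<in> borel_measurable (borel \<Otimes>\<^sub>M borel \<Otimes>\<^sub>M borel \<Otimes>\<^sub>M borel)"
    and tk2: "truncation T k2 \<in> borel_measurable (borel \<Otimes>\<^sub>M borel \<Otimes>\<^sub>M borel \<Otimes>\<^sub>M borel)"
    and cg_meas [measurable]: "cg \<in> borel_measurable borel" and ch_meas [measurable]: "ch \<in> borel_measurable borel"
    and cg_fin: "\<And>\<omega>. cg \<omega> < \<infinity>" and ch_fin: "\<And>\<omega>. ch \<omega> < \<infinity>"
    and g_trace: "\<And>g. g \<in> {g1, g2} \<Longrightarrow> AE \<nu> in lborel. AE \<omega> in lborel. AE t in lborel. \<nu> \<in> {0<..1} \<longrightarrow>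
        modulus T g (1, \<nu>, \<omega>, t) \<le> ennreal (\<nu> powr - (3/4)) * cg \<omega>"
    and k_trace: "\<And>k. k \<in> {k1, k2} \<Longrightarrow> AE \<nu> in lborel. AE \<omega> in lborel. AE t in lborel. \<nu> \<in> {0<..1} \<longrightarrow>
        modulus T k (1, \<nu>, \<omega>, t) \<le> ennreal (\<nu> powr - (3/4)) * ch \<omega>"
    and g_diff: "AE \<nu> in lborel. AE \<omega> in lborel. \<nu> \<in> {0<..1} \<and> 0 < \<omega> \<longrightarrow>
        (\<integral>\<^sup>+t. modulus T (pointwise_diff g1 g2) (1, \<nu>, \<omega>, t) \<partial>lborel) \<le> ennreal (gstar \<omega> / \<nu>) / gstar_mass * Mg"
    and k_diff: "AE \<nu> in lborel. AE \<omega> in lborel. \<nu> \<in> {0<..1} \<and> 0 < \<omega> \<longrightarrow>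
        (\<integral>\<^sup>+t. modulus T (pointwise_diff k1 k2) (1, \<nu>, \<omega>, t) \<partial>lborel) \<le> ennreal (gstar \<omega> / \<nu>) / gstar_mass * Mk"
  shows "AE \<omega> in lborel. 0 < \<omega> \<longrightarrow> ennreal \<bar>frechet_M T g1 h1 \<omega> - frechet_M T g2 h2 \<omega>\<bar>
    \<le> 1 / (2 * gstar_mass) * (4 * (ennreal \<omega> / gstar_mass * (cg \<omega> * Mk + ch \<omega> * Mg)))"
proof -
  define dg where "dg = pointwise_diff g1 g2"
  define dk where "dk = pointwise_diff k1 k2"
  have tdg: "truncation T dg \<in> borel_measurable (borel \<Otimes>\<^sub>M borel \<Otimes>\<^sub>M borel \<Otimes>\<^sub>M borel)"
    and tdk: "truncation T dk \<in> borel_measurable (borel \<Otimes>\<^sub>M borel \<Otimes>\<^sub>M borel \<Otimes>\<^sub>M borel)"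
    using tg1 tg2 tk1 tk2 unfolding dg_def dk_def truncation_diff[abs_def] by measurable
  note [measurable] = tg1 tg2 tk1 tk2 modulus_measurable_of_truncation[OF tg1] modulus_measurable_of_truncation[OF tg2]
    modulus_measurable_of_truncation[OF tk1] modulus_measurable_of_truncation[OF tk2]
    modulus_measurable_of_truncation[OF tdg] modulus_measurable_of_truncation[OF tdk]
  have swap: "AE \<omega> in lborel. AE \<nu> in lborel. AE t in lborel. \<nu> \<in> {0<..1} \<longrightarrow>
        modulus T f (1, \<nu>, \<omega>, t) \<le> ennreal (\<nu> powr - (3/4)) * c \<omega>"
    if "AE \<nu> in lborel. AE \<omega> in lborel. AE t in lborel. \<nu> \<in> {0<..1} \<longrightarrow>
        modulus T f (1, \<nu>, \<omega>, t) \<le> ennreal (\<nu> powr - (3/4)) * c \<omega>"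
      and [measurable]: "modulus T f \<in> borel_measurable (borel \<Otimes>\<^sub>M borel \<Otimes>\<^sub>M borel \<Otimes>\<^sub>M borel)" "c \<in> borel_measurable borel" for f c
    using AE_trace_swap[of "\<lambda>(\<nu>, \<omega>, t). modulus T f (1, \<nu>, \<omega>, t)" "\<lambda>(\<nu>, \<omega>, t). ennreal (\<nu> powr - (3/4)) * c \<omega>"] that(1)
    unfolding prod.case by measurable
  have swap2: "AE \<omega> in lborel. AE \<nu> in lborel. \<nu> \<in> {0<..1} \<and> 0 < \<omega> \<longrightarrow>
        (\<integral>\<^sup>+t. modulus T f (1, \<nu>, \<omega>, t) \<partial>lborel) \<le> ennreal (gstar \<omega> / \<nu>) / gstar_mass * M"
    if "AE \<nu> in lborel. AE \<omega> in lborel. \<nu> \<in> {0<..1} \<and> 0 < \<omega> \<longrightarrow>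
        (\<integral>\<^sup>+t. modulus T f (1, \<nu>, \<omega>, t) \<partial>lborel) \<le> ennreal (gstar \<omega> / \<nu>) / gstar_mass * M"
      and [measurable]: "modulus T f \<in> borel_measurable (borel \<Otimes>\<^sub>M borel \<Otimes>\<^sub>M borel \<Otimes>\<^sub>M borel)" for f M
    using AE_trace_swap2[of "\<lambda>(\<nu>, \<omega>). \<integral>\<^sup>+t. modulus T f (1, \<nu>, \<omega>, t) \<partial>lborel" "\<lambda>(\<nu>, \<omega>). ennreal (gstar \<omega> / \<nu>) / gstar_mass * M"] that(1)
    unfolding prod.case by measurable
  note traces = swap[OF g_trace[of g1]] swap[OF g_trace[of g2]] swap[OF k_trace[of k1]] swap[OF k_trace[of k2]]
    swap2[OF g_diff, folded dg_def] swap2[OF k_diff, folded dk_def]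
  have "AE \<omega> in lborel. AE \<nu> in lborel. AE t in lborel. \<nu> \<in> {0<..1} \<longrightarrow> modulus T g1 (1, \<nu>, \<omega>, t) \<le> ennreal (\<nu> powr - (3/4)) * cg \<omega>"
    "AE \<omega> in lborel. AE \<nu> in lborel. AE t in lborel. \<nu> \<in> {0<..1} \<longrightarrow> modulus T g2 (1, \<nu>, \<omega>, t) \<le> ennreal (\<nu> powr - (3/4)) * cg \<omega>"
    "AE \<omega> in lborel. AE \<nu> in lborel. AE t in lborel. \<nu> \<in> {0<..1} \<longrightarrow> modulus T k1 (1, \<nu>, \<omega>, t) \<le> ennreal (\<nu> powr - (3/4)) * ch \<omega>"
    "AE \<omega> in lborel. AE \<nu> in lborel. AE t in lborel. \<nu> \<in> {0<..1} \<longrightarrow> modulus T k2 (1, \<nu>, \<omega>, t) \<le> ennreal (\<nu> powr - (3/4)) * ch \<omega>"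
    "AE \<omega> in lborel. AE \<nu> in lborel. \<nu> \<in> {0<..1} \<and> 0 < \<omega> \<longrightarrow> (\<integral>\<^sup>+t. modulus T dg (1, \<nu>, \<omega>, t) \<partial>lborel) \<le> ennreal (gstar \<omega> / \<nu>) / gstar_mass * Mg"
    "AE \<omega> in lborel. AE \<nu> in lborel. \<nu> \<in> {0<..1} \<and> 0 < \<omega> \<longrightarrow> (\<integral>\<^sup>+t. modulus T dk (1, \<nu>, \<omega>, t) \<partial>lborel) \<le> ennreal (gstar \<omega> / \<nu>) / gstar_mass * Mk"
    by (rule traces; simp?; measurable)+
  then show ?thesis
  proof eventually_elim
    case (elim \<omega>)
    show ?case
    proof
      assume om: "0 < \<omega>"
      define a where "a = \<omega> / gstar \<omega>"
      have a: "0 < a" using om gstar_pos[OF om] by (simp add: a_def)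
      define A where "A k g = (\<lambda>(\<nu>, t). modulus T k (1, \<nu>, \<omega>, T - t) * modulus T g (1, \<nu>, \<omega>, t))" for k g
      define K where "K k g = (\<lambda>(t, \<mu>). indicator {-1..0} \<mu> * (\<mu> * a *
        (truncation T k (1, - \<mu>, \<omega>, T - t) * truncation T g (1, - \<mu>, \<omega>, t))))" for k g
      have A_meas [measurable]: "A k1 g1 \<in> borel_measurable (borel \<Otimes>\<^sub>M borel)" "A k2 g2 \<in> borel_measurable (borel \<Otimes>\<^sub>M borel)"
        "A dk g1 \<in> borel_measurable (borel \<Otimes>\<^sub>M borel)" "A k2 dg \<in> borel_measurable (borel \<Otimes>\<^sub>M borel)"
        unfolding A_def by measurable
      have K_meas [measurable]: "K k1 g1 \<in> borel_measurable (borel \<Otimes>\<^sub>M borel)" "K k2 g2 \<in> borel_measurable (borel \<Otimes>\<^sub>M borel)"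
        unfolding K_def by measurable
      have absK: "ennreal \<bar>K k g (t, \<mu>)\<bar> = indicator {-1..0} \<mu> * (ennreal (- \<mu> * a) * A k g (- \<mu>, t))" for k g t \<mu>
      proof (cases "\<mu> \<in> {-1..0}")
        case True
        let ?u = "\<bar>truncation T k (1, - \<mu>, \<omega>, T - t)\<bar>" and ?v = "\<bar>truncation T g (1, - \<mu>, \<omega>, t)\<bar>"
        have "0 \<le> - \<mu> * a" using True a by (simp add: mult_nonpos_nonneg)
        then have "ennreal (- \<mu> * a * (?u * ?v)) = ennreal (- \<mu> * a) * (ennreal ?u * ennreal ?v)"
          by (simp only: ennreal_mult mult_nonneg_nonneg abs_ge_zero)
        moreover have "\<bar>K k g (t, \<mu>)\<bar> = - \<mu> * a * (?u * ?v)"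
          using True a by (simp add: K_def abs_mult)
        ultimately show ?thesis using True by (simp only: A_def modulus_truncation prod.case) simp
      qed (simp add: K_def)
      \<comment> \<open>Finiteness is needed for subtracting the two iterated integrals. Here both
        traces are taken pointwise, and the weight \<nu> absorbs one of the two factors
        \<nu>^(-3/4).\<close>
      have fin: "(\<integral>\<^sup>+t. \<integral>\<^sup>+\<mu>. ennreal \<bar>K k g (t, \<mu>)\<bar> \<partial>lborel \<partial>lborel) < \<infinity>"
        if k: "AE \<nu> in lborel. AE t in lborel. \<nu> \<in> {0<..1} \<longrightarrow> modulus T k (1, \<nu>, \<omega>, t) \<le> ennreal (\<nu> powr - (3/4)) * ch \<omega>"
          and g: "AE \<nu> in lborel. AE t in lborel. \<nu> \<in> {0<..1} \<longrightarrow> modulus T g (1, \<nu>, \<omega>, t) \<le> ennreal (\<nu> powr - (3/4)) * cg \<omega>"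
          and [measurable]: "A k g \<in> borel_measurable (borel \<Otimes>\<^sub>M borel)" for k g
      proof -
        have "(\<integral>\<^sup>+t. \<integral>\<^sup>+\<mu>. ennreal \<bar>K k g (t, \<mu>)\<bar> \<partial>lborel \<partial>lborel)
          = (\<integral>\<^sup>+\<nu>. indicator {0<..1} \<nu> * (ennreal (\<nu> * a) * (\<integral>\<^sup>+t. A k g (\<nu>, t) \<partial>lborel)) \<partial>lborel)"
          unfolding absK by (rule nn_integral_incoming_half) fact
        also have "\<dots> \<le> (\<integral>\<^sup>+\<nu>. (ennreal (\<nu> powr - (3/4)) * indicator {0<..1} \<nu>) * (ennreal a * (cg \<omega> * ch \<omega> * ennreal T)) \<partial>lborel)"
        proof (rule nn_integral_mono_AE, use k g in eventually_elim)
          case (elim \<nu>)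
          show ?case
          proof (cases "\<nu> \<in> {0<..1}")
            case True
            let ?p = "ennreal (\<nu> powr - (3/4))"
            have "(\<integral>\<^sup>+t. A k g (\<nu>, t) \<partial>lborel) \<le> (\<integral>\<^sup>+t. (?p * ch \<omega>) * (?p * cg \<omega>) * indicator {0..T} t \<partial>lborel)"
            proof (rule nn_integral_mono_AE, use AE_lborel_reflect[OF elim(1), of T] elim(2) in eventually_elim)
              case (elim t)
              have "A k g (\<nu>, t) = A k g (\<nu>, t) * indicator {0..T} t"
                by (auto simp: A_def modulus_def split: split_indicator)
              also have "\<dots> \<le> (?p * ch \<omega>) * (?p * cg \<omega>) * indicator {0..T} t"
                using elim True by (intro mult_right_mono) (auto simp: A_def intro!: mult_mono)
              finally show ?case .
            qed
            also have "\<dots> = (?p * ch \<omega>) * (?p * cg \<omega>) * ennreal T"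
              using T by (subst nn_integral_cmult) auto
            finally have "ennreal (\<nu> * a) * (\<integral>\<^sup>+t. A k g (\<nu>, t) \<partial>lborel) \<le> ennreal (\<nu> * a) * ((?p * ch \<omega>) * (?p * cg \<omega>) * ennreal T)"
              by (rule mult_left_mono) simp
            also have "\<dots> = (ennreal (\<nu> * \<nu> powr - (3/4))) * (?p * (ennreal a * (cg \<omega> * ch \<omega> * ennreal T)))"
              using True a by (simp add: ennreal_mult mult_ac)
            also have "\<dots> \<le> 1 * (?p * (ennreal a * (cg \<omega> * ch \<omega> * ennreal T)))"
              using mult_powr_le_1[OF True] by (intro mult_right_mono) auto
            finally show ?thesis using True by simp
          qed simp
        qed
        also have "\<dots> = 4 * (ennreal a * (cg \<omega> * ch \<omega> * ennreal T))"
          by (simp add: nn_integral_multc ennreal_quarter_integral)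
        also have "\<dots> < \<infinity>" using cg_fin[of \<omega>] ch_fin[of \<omega>] by (simp add: ennreal_mult_less_top)
        finally show ?thesis .
      qed
      have diff: "(\<integral>\<^sup>+t. \<integral>\<^sup>+\<mu>. ennreal \<bar>K k1 g1 (t, \<mu>) - K k2 g2 (t, \<mu>)\<bar> \<partial>lborel \<partial>lborel)
        \<le> 4 * (ennreal \<omega> / gstar_mass * (cg \<omega> * Mk + ch \<omega> * Mg))"
      proof -
        define B where "B z = A dk g1 z + A k2 dg z" for z
        have [measurable]: "B \<in> borel_measurable (borel \<Otimes>\<^sub>M borel)" unfolding B_def by measurable
        have "(\<integral>\<^sup>+t. \<integral>\<^sup>+\<mu>. ennreal \<bar>K k1 g1 (t, \<mu>) - K k2 g2 (t, \<mu>)\<bar> \<partial>lborel \<partial>lborel)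
          \<le> (\<integral>\<^sup>+t. \<integral>\<^sup>+\<mu>. indicator {-1..0} \<mu> * (ennreal (- \<mu> * a) * B (- \<mu>, t)) \<partial>lborel \<partial>lborel)"
        proof (intro nn_integral_mono)
          fix t \<mu>
          \<comment> \<open>The product rule k1 g1 - k2 g2 = (k1 - k2) g1 + k2 (g1 - g2).\<close>
          have "K k1 g1 (t, \<mu>) - K k2 g2 (t, \<mu>) = K dk g1 (t, \<mu>) + K k2 dg (t, \<mu>)"
            unfolding K_def dg_def dk_def prod.case truncation_diff by (simp add: algebra_simps)
          then have "ennreal \<bar>K k1 g1 (t, \<mu>) - K k2 g2 (t, \<mu>)\<bar> \<le> ennreal (\<bar>K dk g1 (t, \<mu>)\<bar> + \<bar>K k2 dg (t, \<mu>)\<bar>)"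
            by (simp only:) (rule ennreal_leI, rule abs_triangle_ineq)
          also have "\<dots> = ennreal \<bar>K dk g1 (t, \<mu>)\<bar> + ennreal \<bar>K k2 dg (t, \<mu>)\<bar>" by simp
          also have "\<dots> = indicator {-1..0} \<mu> * (ennreal (- \<mu> * a) * B (- \<mu>, t))"
            unfolding absK B_def by (simp add: distrib_left)
          finally show "ennreal \<bar>K k1 g1 (t, \<mu>) - K k2 g2 (t, \<mu>)\<bar> \<le> indicator {-1..0} \<mu> * (ennreal (- \<mu> * a) * B (- \<mu>, t))" .
        qed
        also have "\<dots> = (\<integral>\<^sup>+\<nu>. indicator {0<..1} \<nu> * (ennreal (\<nu> * a) * (\<integral>\<^sup>+t. B (\<nu>, t) \<partial>lborel)) \<partial>lborel)"
          by (rule nn_integral_incoming_half) measurable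
        also have "\<dots> \<le> (\<integral>\<^sup>+\<nu>. (ennreal (\<nu> powr - (3/4)) * indicator {0<..1} \<nu>) * (ennreal \<omega> / gstar_mass * (cg \<omega> * Mk + ch \<omega> * Mg)) \<partial>lborel)"
        proof (rule nn_integral_mono_AE, use elim in eventually_elim)
          case (elim \<nu>)
          show ?case
          proof (cases "\<nu> \<in> {0<..1}")
            case True
            let ?p = "ennreal (\<nu> powr - (3/4))"
            have "(\<integral>\<^sup>+t. B (\<nu>, t) \<partial>lborel) = (\<integral>\<^sup>+t. A dk g1 (\<nu>, t) \<partial>lborel) + (\<integral>\<^sup>+t. A k2 dg (\<nu>, t) \<partial>lborel)"
              unfolding B_def by (rule nn_integral_add) measurable
            also have "\<dots> \<le> (\<integral>\<^sup>+t. (?p * cg \<omega>) * modulus T dk (1, \<nu>, \<omega>, T - t) \<partial>lborel) + (\<integral>\<^sup>+t. (?p * ch \<omega>) * modulus T dg (1, \<nu>, \<omega>, t) \<partial>lborel)"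
            proof (rule add_mono)
              show "(\<integral>\<^sup>+t. A dk g1 (\<nu>, t) \<partial>lborel) \<le> (\<integral>\<^sup>+t. (?p * cg \<omega>) * modulus T dk (1, \<nu>, \<omega>, T - t) \<partial>lborel)"
              proof (rule nn_integral_mono_AE, use elim(1) in eventually_elim)
                case (elim t)
                then show ?case using True
                  by (simp add: A_def mult.commute[of "modulus T dk _"] mult_right_mono)
              qed
              show "(\<integral>\<^sup>+t. A k2 dg (\<nu>, t) \<partial>lborel) \<le> (\<integral>\<^sup>+t. (?p * ch \<omega>) * modulus T dg (1, \<nu>, \<omega>, t) \<partial>lborel)"
              proof (rule nn_integral_mono_AE, use AE_lborel_reflect[OF elim(4), of T] in eventually_elim)
                case (elim t)
                then show ?case using True by (simp add: A_def mult_right_mono)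
              qed
            qed
            also have "\<dots> = (?p * cg \<omega>) * (\<integral>\<^sup>+t. modulus T dk (1, \<nu>, \<omega>, T - t) \<partial>lborel) + (?p * ch \<omega>) * (\<integral>\<^sup>+t. modulus T dg (1, \<nu>, \<omega>, t) \<partial>lborel)"
              by (simp add: nn_integral_cmult)
            also have "(\<integral>\<^sup>+t. modulus T dk (1, \<nu>, \<omega>, T - t) \<partial>lborel) = (\<integral>\<^sup>+t. modulus T dk (1, \<nu>, \<omega>, t) \<partial>lborel)"
              by (rule nn_integral_flip) measurable
            also have "(?p * cg \<omega>) * (\<integral>\<^sup>+t. modulus T dk (1, \<nu>, \<omega>, t) \<partial>lborel) + (?p * ch \<omega>) * (\<integral>\<^sup>+t. modulus T dg (1, \<nu>, \<omega>, t) \<partial>lborel)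
              \<le> (?p * cg \<omega>) * (ennreal (gstar \<omega> / \<nu>) / gstar_mass * Mk) + (?p * ch \<omega>) * (ennreal (gstar \<omega> / \<nu>) / gstar_mass * Mg)"
              using elim(5,6) True om by (intro add_mono mult_left_mono) auto
            finally have "ennreal (\<nu> * a) * (\<integral>\<^sup>+t. B (\<nu>, t) \<partial>lborel)
              \<le> ennreal (\<nu> * a) * ((?p * cg \<omega>) * (ennreal (gstar \<omega> / \<nu>) / gstar_mass * Mk) + (?p * ch \<omega>) * (ennreal (gstar \<omega> / \<nu>) / gstar_mass * Mg))"
              by (rule mult_left_mono) simp
            also have "\<dots> = (ennreal (\<nu> * a) * ennreal (gstar \<omega> / \<nu>)) * (?p * inverse gstar_mass * (cg \<omega> * Mk + ch \<omega> * Mg))"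
              by (simp only: divide_ennreal_def distrib_left distrib_right mult_ac)
            \<comment> \<open>The singular weight 1/\<open>gstar \<omega>\<close> of the derivative
              and the 1/\<nu> of the flux estimate cancel here.\<close>
            also have "ennreal (\<nu> * a) * ennreal (gstar \<omega> / \<nu>) = ennreal \<omega>"
              using True om gstar_pos[OF om] by (simp add: a_def ennreal_mult[symmetric])
            finally show ?thesis using True by (simp add: divide_ennreal_def mult_ac)
          qed simp
        qed
        also have "\<dots> = 4 * (ennreal \<omega> / gstar_mass * (cg \<omega> * Mk + ch \<omega> * Mg))"
          by (simp add: nn_integral_multc ennreal_quarter_integral)
        finally show ?thesis .
      qed
      have eq1: "frechet_M T g1 h1 \<omega> = 1 / scattering_rate * (\<integral>t. \<integral>\<mu>. K k1 g1 (t, \<mu>) \<partial>lborel \<partial>lborel)"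
        and eq2: "frechet_M T g2 h2 \<omega> = 1 / scattering_rate * (\<integral>t. \<integral>\<mu>. K k2 g2 (t, \<mu>) \<partial>lborel \<partial>lborel)"
        unfolding K_def prod.case a_def k1_def k2_def by (rule frechet_M_truncation[OF om])+
      have "frechet_M T g1 h1 \<omega> - frechet_M T g2 h2 \<omega> = 1 / scattering_rate *
         ((\<integral>t. \<integral>\<mu>. K k1 g1 (t, \<mu>) \<partial>lborel \<partial>lborel) - (\<integral>t. \<integral>\<mu>. K k2 g2 (t, \<mu>) \<partial>lborel \<partial>lborel))"
        unfolding eq1 eq2 by (rule right_diff_distrib[symmetric])
      then have "ennreal \<bar>frechet_M T g1 h1 \<omega> - frechet_M T g2 h2 \<omega>\<bar> = ennreal (1 / scattering_rate) *
         ennreal \<bar>(\<integral>t. \<integral>\<mu>. K k1 g1 (t, \<mu>) \<partial>lborel \<partial>lborel) - (\<integral>t. \<integral>\<mu>. K k2 g2 (t, \<mu>) \<partial>lborel \<partial>lborel)\<bar>"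
        using scattering_rate_pos by (simp add: abs_mult ennreal_mult del: times_divide_eq_left)
      also have "ennreal (1 / scattering_rate) = 1 / (2 * gstar_mass)"
        using scattering_rate_pos by (simp add: divide_ennreal[symmetric] scattering_rate_eq)
      also have "1 / (2 * gstar_mass) * ennreal \<bar>(\<integral>t. \<integral>\<mu>. K k1 g1 (t, \<mu>) \<partial>lborel \<partial>lborel) - (\<integral>t. \<integral>\<mu>. K k2 g2 (t, \<mu>) \<partial>lborel \<partial>lborel)\<bar>
        \<le> 1 / (2 * gstar_mass) * (4 * (ennreal \<omega> / gstar_mass * (cg \<omega> * Mk + ch \<omega> * Mg)))"
        using iterated_integral_diff_le[OF K_meas fin[OF elim(3,1) A_meas(1)] fin[OF elim(4,2) A_meas(2)]] diff
        by (intro mult_left_mono) (auto intro: order_trans)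
      finally show "ennreal \<bar>frechet_M T g1 h1 \<omega> - frechet_M T g2 h2 \<omega>\<bar>
        \<le> 1 / (2 * gstar_mass) * (4 * (ennreal \<omega> / gstar_mass * (cg \<omega> * Mk + ch \<omega> * Mg)))" .
    qed
  qed
qed

text \<open>Frequency profile of the outgoing trace at \<open>x = 1\<close> for an inflow bounded by \<open>b(\<omega>)/\<mu>\<close>.\<close>

definition amplified :: "real \<Rightarrow> (real \<Rightarrow> ennreal) \<Rightarrow> real \<Rightarrow> ennreal" where
  "amplified T b \<omega> = b \<omega> + ennreal (gstar \<omega>) / (2 * gstar_mass) *
     (trace_constant T * (\<integral>\<^sup>+\<omega>. ennreal \<omega> * b \<omega> * indicator {0<..} \<omega> \<partial>lborel))"

lemma amplified_measurable [measurable]: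
  assumes [measurable]: "b \<in> borel_measurable borel"
  shows "amplified T b \<in> borel_measurable borel"
  unfolding amplified_def by measurable

lemma amplified_cmult:
  assumes [measurable]: "b \<in> borel_measurable borel"
  shows "amplified T (\<lambda>\<omega>. c * b \<omega>) \<omega> = c * amplified T b \<omega>"
proof -
  have "(\<integral>\<^sup>+\<omega>. ennreal \<omega> * (c * b \<omega>) * indicator {0<..} \<omega> \<partial>lborel) = (\<integral>\<^sup>+\<omega>. c * (ennreal \<omega> * b \<omega> * indicator {0<..} \<omega>) \<partial>lborel)"
    by (intro nn_integral_cong) (simp add: mult_ac)
  also have "\<dots> = c * (\<integral>\<^sup>+\<omega>. ennreal \<omega> * b \<omega> * indicator {0<..} \<omega> \<partial>lborel)"
    by (rule nn_integral_cmult) measurable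
  finally show ?thesis unfolding amplified_def by (simp add: distrib_left mult_ac)
qed

lemma trace_constant_finite: "0 < T \<Longrightarrow> trace_constant T < \<infinity>"
  using ennreal_geometric_finite[OF kappa_less_1, of T 224] by (simp add: trace_constant_def)

lemma amplified_eq:
  assumes "0 < T" and "(\<integral>\<^sup>+\<omega>. ennreal \<omega> * b \<omega> * indicator {0<..} \<omega> \<partial>lborel) < \<infinity>"
  obtains k where "k < \<infinity>" "\<And>\<omega>. amplified T b \<omega> = b \<omega> + k * ennreal (gstar \<omega>)"
proof
  let ?k = "trace_constant T * (\<integral>\<^sup>+\<omega>. ennreal \<omega> * b \<omega> * indicator {0<..} \<omega> \<partial>lborel) / (2 * gstar_mass)"
  show "?k < \<infinity>"
    using trace_constant_finite[OF assms(1)] assms(2) gstar_mass_pos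
    by (auto simp: divide_ennreal_def less_top[symmetric] ennreal_mult_eq_top_iff)
  show "amplified T b \<omega> = b \<omega> + ?k * ennreal (gstar \<omega>)" for \<omega>
    by (simp add: amplified_def divide_ennreal_def mult_ac)
qed

lemma ennreal_square_add_le:
  fixes a b :: ennreal
  shows "(a + b)\<^sup>2 \<le> 2 * a\<^sup>2 + 2 * b\<^sup>2"
proof (cases "a = \<infinity> \<or> b = \<infinity>")
  case True then show ?thesis by (auto simp: power2_eq_square ennreal_mult_top)
next
  case False
  then obtain x y where xy: "a = ennreal x" "0 \<le> x" "b = ennreal y" "0 \<le> y"
    by (cases a; cases b) auto
  have "(x + y)\<^sup>2 \<le> 2 * x\<^sup>2 + 2 * y\<^sup>2"
    using sum_squares_bound[of x y] by (simp add: power2_sum)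
  then show ?thesis
    using xy by (simp add: ennreal_power ennreal_mult[symmetric] ennreal_plus[symmetric] ennreal_leI del: ennreal_plus flip: ennreal_numeral)
qed

lemma amplified_square_integrable:
  assumes T: "0 < T" and [measurable]: "b \<in> borel_measurable borel"
    and W: "(\<integral>\<^sup>+\<omega>. ennreal \<omega> * b \<omega> * indicator {0<..} \<omega> \<partial>lborel) < \<infinity>"
    and W2: "(\<integral>\<^sup>+\<omega>. (ennreal \<omega> * b \<omega>)\<^sup>2 * indicator {0<..} \<omega> \<partial>lborel) < \<infinity>"
  shows "(\<integral>\<^sup>+\<omega>. (ennreal \<omega> * amplified T b \<omega>)\<^sup>2 * indicator {0<..} \<omega> \<partial>lborel) < \<infinity>"
proof -
  obtain k where k: "k < \<infinity>" "\<And>\<omega>. amplified T b \<omega> = b \<omega> + k * ennreal (gstar \<omega>)"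
    using amplified_eq[OF T W] by blast
  have "(\<integral>\<^sup>+\<omega>. (ennreal \<omega> * amplified T b \<omega>)\<^sup>2 * indicator {0<..} \<omega> \<partial>lborel)
    \<le> (\<integral>\<^sup>+\<omega>. 2 * ((ennreal \<omega> * b \<omega>)\<^sup>2 * indicator {0<..} \<omega>) + 2 * k\<^sup>2 * ((ennreal (\<omega> * gstar \<omega>))\<^sup>2 * indicator {0<..} \<omega>) \<partial>lborel)"
  proof (rule nn_integral_mono)
    fix \<omega> :: real
    show "(ennreal \<omega> * amplified T b \<omega>)\<^sup>2 * indicator {0<..} \<omega>
      \<le> 2 * ((ennreal \<omega> * b \<omega>)\<^sup>2 * indicator {0<..} \<omega>) + 2 * k\<^sup>2 * ((ennreal (\<omega> * gstar \<omega>))\<^sup>2 * indicator {0<..} \<omega>)"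
    proof (cases "0 < \<omega>")
      case True
      have "ennreal \<omega> * amplified T b \<omega> = ennreal \<omega> * b \<omega> + k * ennreal (\<omega> * gstar \<omega>)"
        using True gstar_nonneg[of \<omega>] by (simp add: k(2) distrib_left ennreal_mult mult_ac)
      then show ?thesis
        using ennreal_square_add_le[of "ennreal \<omega> * b \<omega>" "k * ennreal (\<omega> * gstar \<omega>)"] True
        by (simp add: power_mult_distrib mult_ac)
    qed simp
  qed
  also have "\<dots> = 2 * (\<integral>\<^sup>+\<omega>. (ennreal \<omega> * b \<omega>)\<^sup>2 * indicator {0<..} \<omega> \<partial>lborel)
     + 2 * k\<^sup>2 * (\<integral>\<^sup>+\<omega>. (ennreal (\<omega> * gstar \<omega>))\<^sup>2 * indicator {0<..} \<omega> \<partial>lborel)"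
    by (simp add: nn_integral_add nn_integral_cmult)
  also have "\<dots> < \<infinity>"
    using W2 gstar_square_integral_finite k(1) by (simp add: ennreal_mult_less_top power2_eq_square)
  finally show ?thesis .
qed

text \<open>The function \<open>v\<close> dominates both profiles \<omega> \<open>cg\<close> and
  \<omega> \<open>ch\<close> up to the factors P and Q. Each product pairs one profile with a mass
  controlled by the other, so the bound has the form P * Q times an integral against \<delta> times
  v(\<omega>).\<close>

lemma frechet_M_lipschitz_pointwise:
  fixes b :: "real \<Rightarrow> ennreal" and \<delta> :: "real \<Rightarrow> ennreal"
  assumes T: "0 < T" and b_meas [measurable]: "b \<in> borel_measurable borel"
    and W: "(\<integral>\<^sup>+\<omega>. ennreal \<omega> * b \<omega> * indicator {0<..} \<omega> \<partial>lborel) < \<infinity>"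
    and b_fin: "\<And>\<omega>. b \<omega> < \<infinity>"
    and \<phi>: "AE \<nu> in lborel. AE \<omega> in lborel. AE t in lborel. \<nu> \<in> {0<..1} \<and> 0 < \<omega> \<and> t \<in> {0..T} \<longrightarrow>
       ennreal \<bar>\<phi> \<nu> \<omega> t\<bar> \<le> ennreal P * b \<omega>"
    and \<psi>: "AE t in lborel. t \<in> {0..T} \<longrightarrow> ennreal \<bar>\<psi> t\<bar> \<le> ennreal Q"
    and eta: "reflection_coefficient \<eta>1" "reflection_coefficient \<eta>2"
    and \<delta>_meas [measurable]: "\<delta> \<in> borel_measurable borel"
    and \<delta>: "\<And>\<omega>. 0 < \<omega> \<Longrightarrow> \<delta> \<omega> = ennreal \<bar>\<eta>1 \<omega> - \<eta>2 \<omega>\<bar>"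
    and g: "forward_solution T \<phi> \<eta>1 g1" "forward_solution T \<phi> \<eta>2 g2"
    and h: "adjoint_solution T \<psi> \<eta>1 h1" "adjoint_solution T \<psi> \<eta>2 h2"
  defines "v \<equiv> \<lambda>\<omega>. ennreal \<omega> * amplified T b \<omega> + ennreal \<omega> * amplified T (\<lambda>\<omega>. ennreal (gstar \<omega>)) \<omega>"
  shows "AE \<omega> in lborel. 0 < \<omega> \<longrightarrow> ennreal \<bar>frechet_M T g1 h1 \<omega> - frechet_M T g2 h2 \<omega>\<bar>
    \<le> (4 / gstar_mass / gstar_mass * ennreal T / (1 - kappa T)) * (ennreal P * ennreal Q) * (\<integral>\<^sup>+\<omega>. \<delta> \<omega> * v \<omega> * indicator {0<..} \<omega> \<partial>lborel) * v \<omega>"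
proof -
  let ?s = "\<lambda>\<omega>. ennreal (gstar \<omega>)"
  let ?\<psi> = "\<lambda>\<nu> \<omega> t. - \<psi> (T - t) * gstar \<omega> / \<nu>"
  let ?p = "\<lambda>\<nu>::real. ennreal (\<nu> powr - (3/4))"
  note gs = g[THEN forward_reflecting_solution] and hs = h[THEN adjoint_reflecting_solution]
  define cg where "cg \<omega> = ennreal P * amplified T b \<omega>" for \<omega>
  define ch where "ch \<omega> = ennreal Q * amplified T ?s \<omega>" for \<omega>
  have Ws: "(\<integral>\<^sup>+\<omega>. ennreal \<omega> * ?s \<omega> * indicator {0<..} \<omega> \<partial>lborel) < \<infinity>"
  proof -
    have "(\<integral>\<^sup>+\<omega>. ennreal \<omega> * ?s \<omega> * indicator {0<..} \<omega> \<partial>lborel) = gstar_mass"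
      unfolding gstar_mass_def by (intro nn_integral_cong) (auto simp: ennreal_mult gstar_nonneg split: split_indicator)
    then show ?thesis using gstar_mass_less_top by simp
  qed
  have cg_meas [measurable]: "cg \<in> borel_measurable borel" and ch_meas [measurable]: "ch \<in> borel_measurable borel"
    unfolding cg_def ch_def by measurable
  have cg_fin: "cg \<omega> < \<infinity>" for \<omega>
    using amplified_eq[OF T W] b_fin[of \<omega>] unfolding cg_def by (metis ennreal_add_less_top ennreal_less_top ennreal_mult_less_top infinity_ennreal_def)
  have ch_fin: "ch \<omega> < \<infinity>" for \<omega>
    using amplified_eq[OF T Ws] unfolding ch_def by (metis ennreal_add_less_top ennreal_less_top ennreal_mult_less_top infinity_ennreal_def)
  have g_datum: "AE \<nu> in lborel. AE \<omega> in lborel. AE t in lborel. \<nu> \<in> {0<..1} \<and> 0 < \<omega> \<and> t \<in> {0..T} \<longrightarrow>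
       ennreal \<bar>\<phi> \<nu> \<omega> t\<bar> \<le> ennreal (1 / \<nu>) * (ennreal P * b \<omega>)"
    using \<phi>
  proof eventually_elim
    case (elim \<nu>) then show ?case
    proof eventually_elim
      case (elim \<omega>) then show ?case
      proof eventually_elim
        case (elim t)
        show ?case
        proof
          assume A: "\<nu> \<in> {0<..1} \<and> 0 < \<omega> \<and> t \<in> {0..T}"
          \<comment> \<open>As \<nu> \<le> 1, a bounded datum is a special case of an inflow bounded
            by b/\<nu>, so one trace bound serves both problems.\<close>
          then have "1 \<le> ennreal (1 / \<nu>)" by simp
          from mult_right_mono[OF this, of "ennreal P * b \<omega>"] elim A
          show "ennreal \<bar>\<phi> \<nu> \<omega> t\<bar> \<le> ennreal (1 / \<nu>) * (ennreal P * b \<omega>)" by (auto intro: order_trans)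
        qed
      qed
    qed
  qed
  have h_datum: "AE \<nu> in lborel. AE \<omega> in lborel. AE t in lborel. \<nu> \<in> {0<..1} \<and> 0 < \<omega> \<and> t \<in> {0..T} \<longrightarrow>
       ennreal \<bar>?\<psi> \<nu> \<omega> t\<bar> \<le> ennreal (1 / \<nu>) * (ennreal Q * ?s \<omega>)"
  proof (rule AE_I2, rule AE_I2)
    fix \<nu> \<omega> :: real
    show "AE t in lborel. \<nu> \<in> {0<..1} \<and> 0 < \<omega> \<and> t \<in> {0..T} \<longrightarrow> ennreal \<bar>?\<psi> \<nu> \<omega> t\<bar> \<le> ennreal (1 / \<nu>) * (ennreal Q * ?s \<omega>)"
      using AE_lborel_reflect[OF \<psi>, of T]
    proof eventually_elim
      case (elim t)
      show ?case
      proof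
        assume A: "\<nu> \<in> {0<..1} \<and> 0 < \<omega> \<and> t \<in> {0..T}"
        have "ennreal \<bar>?\<psi> \<nu> \<omega> t\<bar> = ennreal (1 / \<nu>) * (ennreal \<bar>\<psi> (T - t)\<bar> * ?s \<omega>)"
          using A gstar_nonneg[of \<omega>] by (simp add: abs_mult ennreal_mult[symmetric])
        also have "\<dots> \<le> ennreal (1 / \<nu>) * (ennreal Q * ?s \<omega>)"
          using elim A by (intro mult_left_mono mult_right_mono) auto
        finally show "ennreal \<bar>?\<psi> \<nu> \<omega> t\<bar> \<le> ennreal (1 / \<nu>) * (ennreal Q * ?s \<omega>)" .
      qed
    qed
  qed
  have scaled_fin: "(\<integral>\<^sup>+\<omega>. ennreal \<omega> * (ennreal c * f \<omega>) * indicator {0<..} \<omega> \<partial>lborel) < \<infinity>"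
    if "(\<integral>\<^sup>+\<omega>. ennreal \<omega> * f \<omega> * indicator {0<..} \<omega> \<partial>lborel) < \<infinity>" and [measurable]: "f \<in> borel_measurable borel" for c f
  proof -
    have "(\<integral>\<^sup>+\<omega>. ennreal \<omega> * (ennreal c * f \<omega>) * indicator {0<..} \<omega> \<partial>lborel) = (\<integral>\<^sup>+\<omega>. ennreal c * (ennreal \<omega> * f \<omega> * indicator {0<..} \<omega>) \<partial>lborel)"
      by (intro nn_integral_cong) (simp add: mult_ac)
    also have "\<dots> = ennreal c * (\<integral>\<^sup>+\<omega>. ennreal \<omega> * f \<omega> * indicator {0<..} \<omega> \<partial>lborel)"
      by (rule nn_integral_cmult) measurable
    finally show ?thesis using that(1) by (simp add: ennreal_mult_less_top)
  qed
  have g_trace: "AE \<nu> in lborel. AE \<omega> in lborel. AE t in lborel. \<nu> \<in> {0<..1} \<longrightarrow> modulus T f (1, \<nu>, \<omega>, t) \<le> ?p \<nu> * cg \<omega>"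
    if "reflecting_solution T \<phi> \<eta> f" "reflection_coefficient \<eta>" for f \<eta>
    unfolding cg_def unfolding amplified_cmult[OF b_meas, symmetric] unfolding amplified_def
    by (rule solution_trace_bound[OF T that _ g_datum scaled_fin[OF W b_meas]]) measurable
  have s_meas: "?s \<in> borel_measurable borel" by measurable
  have h_trace: "AE \<nu> in lborel. AE \<omega> in lborel. AE t in lborel. \<nu> \<in> {0<..1} \<longrightarrow> modulus T f (1, \<nu>, \<omega>, t) \<le> ?p \<nu> * ch \<omega>"
    if "reflecting_solution T ?\<psi> \<eta> f" "reflection_coefficient \<eta>" for f \<eta>
    unfolding ch_def unfolding amplified_cmult[OF s_meas, symmetric] unfolding amplified_def
    by (rule solution_trace_bound[OF T that _ h_datum scaled_fin[OF Ws s_meas]]) measurable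
  define Mg where "Mg = mass T (intensity T (pointwise_diff g1 g2))"
  define Mk where "Mk = mass T (intensity T (pointwise_diff (reversed T h1) (reversed T h2)))"
  note dg = solution_difference[OF T gs eta(1) \<delta>_meas \<delta> cg_meas g_trace[OF gs(2) eta(2)], folded Mg_def]
  note dk = solution_difference[OF T hs eta(1) \<delta>_meas \<delta> ch_meas h_trace[OF hs(2) eta(2)], folded Mk_def]
  define I where "I = (\<integral>\<^sup>+\<omega>. \<delta> \<omega> * v \<omega> * indicator {0<..} \<omega> \<partial>lborel)"
  define B where "B = ennreal T / (1 - kappa T)"
  have [measurable]: "v \<in> borel_measurable borel" unfolding v_def by measurable
  have cg_v: "ennreal \<omega> * cg \<omega> \<le> ennreal P * v \<omega>" and ch_v: "ennreal \<omega> * ch \<omega> \<le> ennreal Q * v \<omega>" for \<omega>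
    unfolding cg_def ch_def v_def by (simp_all add: distrib_left mult_ac)
  have int_le: "(\<integral>\<^sup>+\<omega>. \<delta> \<omega> * (ennreal \<omega> * c \<omega>) * indicator {0<..} \<omega> \<partial>lborel) \<le> ennreal R * I"
    if "\<And>\<omega>. ennreal \<omega> * c \<omega> \<le> ennreal R * v \<omega>" for c R
  proof -
    have "(\<integral>\<^sup>+\<omega>. \<delta> \<omega> * (ennreal \<omega> * c \<omega>) * indicator {0<..} \<omega> \<partial>lborel) \<le> (\<integral>\<^sup>+\<omega>. \<delta> \<omega> * (ennreal R * v \<omega>) * indicator {0<..} \<omega> \<partial>lborel)"
      by (intro nn_integral_mono mult_right_mono mult_left_mono that) auto
    also have "\<dots> = (\<integral>\<^sup>+\<omega>. ennreal R * (\<delta> \<omega> * v \<omega> * indicator {0<..} \<omega>) \<partial>lborel)"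
      by (intro nn_integral_cong) (simp add: mult_ac)
    also have "\<dots> = ennreal R * I" unfolding I_def by (rule nn_integral_cmult) measurable
    finally show ?thesis .
  qed
  have Mg: "Mg \<le> B * (ennreal P * I)"
    using order_trans[OF dg(1) divide_right_mono_ennreal[OF mult_left_mono[OF int_le[OF cg_v]]]]
    by (simp add: B_def divide_ennreal_def mult_ac)
  have Mk: "Mk \<le> B * (ennreal Q * I)"
    using order_trans[OF dk(1) divide_right_mono_ennreal[OF mult_left_mono[OF int_le[OF ch_v]]]]
    by (simp add: B_def divide_ennreal_def mult_ac)
  have "AE \<omega> in lborel. 0 < \<omega> \<longrightarrow> ennreal \<bar>frechet_M T g1 h1 \<omega> - frechet_M T g2 h2 \<omega>\<bar>
    \<le> 1 / (2 * gstar_mass) * (4 * (ennreal \<omega> / gstar_mass * (cg \<omega> * Mk + ch \<omega> * Mg)))"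
  proof (rule frechet_M_difference[OF T _ _ _ _ cg_meas ch_meas cg_fin ch_fin _ _ dg(2) dk(2)])
    show "truncation T g1 \<in> borel_measurable (borel \<Otimes>\<^sub>M borel \<Otimes>\<^sub>M borel \<Otimes>\<^sub>M borel)"
      "truncation T g2 \<in> borel_measurable (borel \<Otimes>\<^sub>M borel \<Otimes>\<^sub>M borel \<Otimes>\<^sub>M borel)"
      "truncation T (reversed T h1) \<in> borel_measurable (borel \<Otimes>\<^sub>M borel \<Otimes>\<^sub>M borel \<Otimes>\<^sub>M borel)"
      "truncation T (reversed T h2) \<in> borel_measurable (borel \<Otimes>\<^sub>M borel \<Otimes>\<^sub>M borel \<Otimes>\<^sub>M borel)"
      using gs hs unfolding reflecting_solution_def by blast+
    show "AE \<nu> in lborel. AE \<omega> in lborel. AE t in lborel. \<nu> \<in> {0<..1} \<longrightarrow> modulus T f (1, \<nu>, \<omega>, t) \<le> ?p \<nu> * cg \<omega>"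
      if "f \<in> {g1, g2}" for f
      using that g_trace[OF gs(1) eta(1)] g_trace[OF gs(2) eta(2)] by blast
    show "AE \<nu> in lborel. AE \<omega> in lborel. AE t in lborel. \<nu> \<in> {0<..1} \<longrightarrow> modulus T f (1, \<nu>, \<omega>, t) \<le> ?p \<nu> * ch \<omega>"
      if "f \<in> {reversed T h1, reversed T h2}" for f
      using that h_trace[OF hs(1) eta(1)] h_trace[OF hs(2) eta(2)] by blast
  qed
  then have "AE \<omega> in lborel. 0 < \<omega> \<longrightarrow> ennreal \<bar>frechet_M T g1 h1 \<omega> - frechet_M T g2 h2 \<omega>\<bar>
    \<le> (4 / gstar_mass / gstar_mass * ennreal T / (1 - kappa T)) * (ennreal P * ennreal Q) * I * v \<omega>"
  proof eventually_elim
    case (elim \<omega>)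
    \<comment> \<open>Both summands have this same bound. The resulting factor 2 cancels the one in
      \<open>2 * gstar_mass\<close>, and 4 remains from the integral over \<nu>.\<close>
    let ?X = "B * (ennreal P * ennreal Q) * I * v \<omega>"
    have "ennreal \<omega> * (cg \<omega> * Mk + ch \<omega> * Mg) = (ennreal \<omega> * cg \<omega>) * Mk + (ennreal \<omega> * ch \<omega>) * Mg"
      by (simp add: distrib_left mult_ac)
    also have "\<dots> \<le> (ennreal P * v \<omega>) * (B * (ennreal Q * I)) + (ennreal Q * v \<omega>) * (B * (ennreal P * I))"
      by (intro add_mono mult_mono cg_v ch_v Mg Mk) auto
    also have "\<dots> = ?X + ?X" by (simp only: mult_ac)
    also have "\<dots> = 2 * ?X" by (rule mult_2[symmetric])
    finally have X: "ennreal \<omega> * (cg \<omega> * Mk + ch \<omega> * Mg) \<le> 2 * ?X" .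
    have "1 / (2 * gstar_mass) * (4 * (ennreal \<omega> / gstar_mass * (cg \<omega> * Mk + ch \<omega> * Mg)))
      = inverse (2 * gstar_mass) * 4 * inverse gstar_mass * (ennreal \<omega> * (cg \<omega> * Mk + ch \<omega> * Mg))"
    proof -
      have "1 / (2 * gstar_mass) * (4 * (x / gstar_mass * y)) = inverse (2 * gstar_mass) * 4 * inverse gstar_mass * (x * y)" for x y
        by (simp add: divide_ennreal_def mult_ac)
      then show ?thesis .
    qed
    also have "\<dots> \<le> inverse (2 * gstar_mass) * 4 * inverse gstar_mass * (2 * ?X)"
      by (rule mult_left_mono[OF X]) simp
    also have "\<dots> = (inverse (2 * gstar_mass) * 2) * 4 * inverse gstar_mass * ?X"
      by (simp only: mult_ac)
    also have "inverse (2 * gstar_mass) * 2 = inverse gstar_mass"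
      by (rule inverse_double_ennreal[OF gstar_mass_pos gstar_mass_less_top])
    also have "inverse gstar_mass * 4 * inverse gstar_mass * ?X = (4 / gstar_mass / gstar_mass * ennreal T / (1 - kappa T)) * (ennreal P * ennreal Q) * I * v \<omega>"
    proof -
      show ?thesis by (simp only: B_def divide_ennreal_def mult_ac)
    qed
    finally show ?case using elim by (auto intro: order_trans)
  qed
  then show ?thesis by (simp only: I_def)
qed

lemma L2_norm_le_by_square:
  assumes "(\<integral>\<^sup>+\<omega>\<in>{0<..}. ennreal ((f \<omega>)\<^sup>2) \<partial>lborel) \<le> ennreal (C\<^sup>2) * (\<integral>\<^sup>+\<omega>\<in>{0<..}. ennreal ((g \<omega>)\<^sup>2) \<partial>lborel)"
    and "0 < C"
  shows "L2_norm f \<le> ennreal C * L2_norm g"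
proof -
  define I J where "I = (\<integral>\<^sup>+\<omega>\<in>{0<..}. ennreal ((f \<omega>)\<^sup>2) \<partial>lborel)" and "J = (\<integral>\<^sup>+\<omega>\<in>{0<..}. ennreal ((g \<omega>)\<^sup>2) \<partial>lborel)"
  have le: "I \<le> ennreal (C\<^sup>2) * J" using assms(1) by (simp add: I_def J_def)
  show ?thesis
  proof (cases "J = \<infinity>")
    case True
    then have "L2_norm g = \<infinity>" by (simp add: L2_norm_def J_def)
    \<comment> \<open>Positivity of \<open>C\<close> matters here, since 0 * \<infinity> = 0 in
      \<open>ennreal\<close>.\<close>
    then show ?thesis using assms(2) by (simp add: ennreal_mult_top)
  next
    case False
    then obtain y where y: "J = ennreal y" "0 \<le> y" by (cases J) auto
    have "I \<le> ennreal (C\<^sup>2 * y)" using le y by (simp add: ennreal_mult)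
    then obtain x where x: "I = ennreal x" "0 \<le> x" "x \<le> C\<^sup>2 * y"
      using y by (cases I) (auto simp: top_unique)
    have "sqrt x \<le> sqrt (C\<^sup>2 * y)" using x(3) by (rule real_sqrt_le_mono)
    also have "\<dots> = C * sqrt y" using assms(2) by (simp add: real_sqrt_mult)
    finally have "ennreal (sqrt x) \<le> ennreal C * ennreal (sqrt y)"
      using assms(2) y by (simp add: ennreal_mult[symmetric] ennreal_leI)
    then show ?thesis using x y by (simp add: L2_norm_def I_def[symmetric] J_def[symmetric])
  qed
qed

text \<open>The quantities \<open>B\<close> and \<open>V\<close> in the proof depend on
  \<open>tmax\<close> and \<open>w\<close> alone, so one function of the two norms can be fixed
  before the data. The estimates hold for arbitrary solutions g1, g2, h1, h2 and appeal to no
  uniqueness result.\<close>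

theorem proposition4p3:
  fixes tmax :: real and w :: "real \<Rightarrow> real"
  assumes "0 < tmax" and "frequency_envelope w"
  shows "\<exists>L :: real \<Rightarrow> real \<Rightarrow> real. \<forall>\<phi> \<psi>. incoming_datum tmax w \<phi> \<and> test_function tmax \<psi> \<longrightarrow>
    (\<forall>\<eta>1 \<eta>2 g1 g2 h1 h2.
       reflection_coefficient \<eta>1 \<and> reflection_coefficient \<eta>2 \<and>
       forward_solution tmax \<phi> \<eta>1 g1 \<and> forward_solution tmax \<phi> \<eta>2 g2 \<and>
       adjoint_solution tmax \<psi> \<eta>1 h1 \<and> adjoint_solution tmax \<psi> \<eta>2 h2 \<longrightarrow>
       L2_norm (\<lambda>\<omega>. frechet_M tmax g1 h1 \<omega> - frechet_M tmax g2 h2 \<omega>)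
         \<le> ennreal (L (phi_norm tmax \<phi>) (psi_norm tmax \<psi>)) * L2_norm (\<lambda>\<omega>. \<eta>1 \<omega> - \<eta>2 \<omega>))"
proof -
  let ?i = "indicator {0<..} :: real \<Rightarrow> real"
  \<comment> \<open>Nothing is known about \<open>w\<close> outside \<omega> > 0, so it is cut off
    there. Measurability is recovered from the integrable function \<omega>w after division by
    \<omega>.\<close>
  define b where "b \<omega> = ennreal (?i \<omega> * w \<omega>)" for \<omega>
  have w: "\<And>\<omega>. 0 < \<omega> \<Longrightarrow> 0 \<le> w \<omega>" "integrable lborel (\<lambda>\<omega>. ?i \<omega> * (\<omega> * w \<omega>))"
    "integrable lborel (\<lambda>\<omega>. ?i \<omega> * (\<omega> * w \<omega>)\<^sup>2)"
    using assms(2) by (auto simp: frequency_envelope_def set_integrable_def)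
  have b_meas [measurable]: "b \<in> borel_measurable borel"
  proof -
    have [measurable]: "(\<lambda>\<omega>. ?i \<omega> * (\<omega> * w \<omega>)) \<in> borel_measurable borel" using w(2) by auto
    have b_eq: "b = (\<lambda>\<omega>. ennreal (?i \<omega> * (\<omega> * w \<omega>) / \<omega>))"
      by (auto simp: b_def split: split_indicator)
    show ?thesis unfolding b_eq by measurable
  qed
  have b_eq: "ennreal \<omega> * b \<omega> = ennreal (\<omega> * w \<omega>)" if "0 < \<omega>" for \<omega>
    using that w(1) by (simp add: b_def ennreal_mult)
  have W: "(\<integral>\<^sup>+\<omega>. ennreal \<omega> * b \<omega> * indicator {0<..} \<omega> \<partial>lborel) < \<infinity>"
  proof -
    have "(\<integral>\<^sup>+\<omega>. ennreal \<omega> * b \<omega> * indicator {0<..} \<omega> \<partial>lborel) = (\<integral>\<^sup>+\<omega>. ennreal (norm (?i \<omega> * (\<omega> * w \<omega>))) \<partial>lborel)"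
      using w(1) by (intro nn_integral_cong) (auto simp: b_eq split: split_indicator)
    then show ?thesis using w(2) by (simp add: integrable_iff_bounded)
  qed
  have W2: "(\<integral>\<^sup>+\<omega>. (ennreal \<omega> * b \<omega>)\<^sup>2 * indicator {0<..} \<omega> \<partial>lborel) < \<infinity>"
  proof -
    have "(\<integral>\<^sup>+\<omega>. (ennreal \<omega> * b \<omega>)\<^sup>2 * indicator {0<..} \<omega> \<partial>lborel) = (\<integral>\<^sup>+\<omega>. ennreal (norm (?i \<omega> * (\<omega> * w \<omega>)\<^sup>2)) \<partial>lborel)"
      using w(1) by (intro nn_integral_cong) (auto simp: b_eq ennreal_power split: split_indicator)
    then show ?thesis using w(3) by (simp add: integrable_iff_bounded)
  qed
  let ?s = "\<lambda>\<omega>. ennreal (gstar \<omega>)"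
  \<comment> \<open>One profile for the forward and the adjoint traces together. Its square
    integrability is what both the Cauchy-Schwarz step and the final norm in \<omega>
    require.\<close>
  define v where "v \<omega> = ennreal \<omega> * amplified tmax b \<omega> + ennreal \<omega> * amplified tmax ?s \<omega>" for \<omega>
  have v_meas [measurable]: "v \<in> borel_measurable borel" unfolding v_def by measurable
  define V where "V = (\<integral>\<^sup>+\<omega>. (v \<omega>)\<^sup>2 * indicator {0<..} \<omega> \<partial>lborel)"
  have V_fin: "V < \<infinity>"
  proof -
    have s_eq: "ennreal \<omega> * ?s \<omega> = ennreal (\<omega> * gstar \<omega>)" if "0 < \<omega>" for \<omega>
      using that gstar_nonneg by (simp add: ennreal_mult)
    have 1: "(\<integral>\<^sup>+\<omega>. (ennreal \<omega> * amplified tmax b \<omega>)\<^sup>2 * indicator {0<..} \<omega> \<partial>lborel) < \<infinity>"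
      by (rule amplified_square_integrable[OF assms(1) b_meas W W2])
    have 2: "(\<integral>\<^sup>+\<omega>. (ennreal \<omega> * amplified tmax ?s \<omega>)\<^sup>2 * indicator {0<..} \<omega> \<partial>lborel) < \<infinity>"
    proof (rule amplified_square_integrable[OF assms(1)])
      have "(\<integral>\<^sup>+\<omega>. ennreal \<omega> * ?s \<omega> * indicator {0<..} \<omega> \<partial>lborel) = (\<integral>\<^sup>+\<omega>. ennreal (\<omega> * gstar \<omega>) * indicator {0<..} \<omega> \<partial>lborel)"
        by (intro nn_integral_cong) (auto simp: s_eq split: split_indicator)
      then show "(\<integral>\<^sup>+\<omega>. ennreal \<omega> * ?s \<omega> * indicator {0<..} \<omega> \<partial>lborel) < \<infinity>"
        using gstar_integral_finite by simp
      have "(\<integral>\<^sup>+\<omega>. (ennreal \<omega> * ?s \<omega>)\<^sup>2 * indicator {0<..} \<omega> \<partial>lborel) = (\<integral>\<^sup>+\<omega>. (ennreal (\<omega> * gstar \<omega>))\<^sup>2 * indicator {0<..} \<omega> \<partial>lborel)"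
        by (intro nn_integral_cong) (auto simp: s_eq split: split_indicator)
      then show "(\<integral>\<^sup>+\<omega>. (ennreal \<omega> * ?s \<omega>)\<^sup>2 * indicator {0<..} \<omega> \<partial>lborel) < \<infinity>"
        using gstar_square_integral_finite by simp
    qed measurable
    have "V \<le> (\<integral>\<^sup>+\<omega>. 2 * ((ennreal \<omega> * amplified tmax b \<omega>)\<^sup>2 * indicator {0<..} \<omega>) + 2 * ((ennreal \<omega> * amplified tmax ?s \<omega>)\<^sup>2 * indicator {0<..} \<omega>) \<partial>lborel)"
      unfolding V_def v_def
      by (intro nn_integral_mono) (auto intro: ennreal_square_add_le split: split_indicator)
    also have "\<dots> < \<infinity>"
      using 1 2 by (simp add: nn_integral_add nn_integral_cmult ennreal_mult_less_top)
    finally show ?thesis .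
  qed
  define B where "B = 4 / gstar_mass / gstar_mass * ennreal tmax / (1 - kappa tmax)"
  have B_fin: "B < \<infinity>"
  proof -
    have "4 / gstar_mass / gstar_mass < \<infinity>"
      using gstar_mass_pos by (auto simp: divide_ennreal_def less_top[symmetric] ennreal_mult_eq_top_iff)
    then show ?thesis
      unfolding B_def by (intro ennreal_geometric_finite kappa_less_1 assms(1)) (simp add: ennreal_mult_less_top)
  qed
  \<comment> \<open>The summand 1 keeps the constant positive when a norm of the data vanishes, so
    that the estimate also covers an infinite norm of \<eta>1 - \<eta>2.\<close>
  define L where "L P Q = enn2real (B * V) * (P * Q) + 1" for P Q :: real
  show ?thesis
  proof (intro exI[of _ L] allI impI, elim conjE)
    fix \<phi> \<psi> \<eta>1 \<eta>2 g1 g2 h1 h2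
    assume phi: "incoming_datum tmax w \<phi>" and psi: "test_function tmax \<psi>"
      and eta: "reflection_coefficient \<eta>1" "reflection_coefficient \<eta>2"
      and g: "forward_solution tmax \<phi> \<eta>1 g1" "forward_solution tmax \<phi> \<eta>2 g2"
      and h: "adjoint_solution tmax \<psi> \<eta>1 h1" "adjoint_solution tmax \<psi> \<eta>2 h2"
    define P Q where "P = phi_norm tmax \<phi>" and "Q = psi_norm tmax \<psi>"
    have PQ: "0 \<le> P" "0 \<le> Q" by (simp_all add: P_def Q_def)
    have phi_le: "AE \<nu> in lborel. AE \<omega> in lborel. AE t in lborel. \<nu> \<in> {0<..1} \<and> 0 < \<omega> \<and> t \<in> {0..tmax} \<longrightarrow>
       ennreal \<bar>\<phi> \<nu> \<omega> t\<bar> \<le> ennreal P * b \<omega>"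
    proof (rule AE_lborel_prod3)
      have "AE (\<nu>, \<omega>, t) in inflow_space tmax. \<bar>\<phi> \<nu> \<omega> t\<bar> \<le> P * w \<omega>"
        using phi by (simp add: incoming_datum_def P_def)
      then have "AE z in lborel. z \<in> {0<..1} \<times> {0<..} \<times> {0..tmax} \<longrightarrow> (case z of (\<nu>, \<omega>, t) \<Rightarrow> \<bar>\<phi> \<nu> \<omega> t\<bar> \<le> P * w \<omega>)"
        by (subst (asm) AE_restrict_space_iff) (auto simp: borel_prod[symmetric])
      then show "AE (\<nu>, \<omega>, t) in lborel. \<nu> \<in> {0<..1} \<and> 0 < \<omega> \<and> t \<in> {0..tmax} \<longrightarrow> ennreal \<bar>\<phi> \<nu> \<omega> t\<bar> \<le> ennreal P * b \<omega>"
      proof eventually_elim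
        case (elim z)
        then show ?case
          using PQ w(1) by (cases z) (auto simp: b_def ennreal_mult[symmetric] ennreal_leI)
      qed
    qed
    have psi_le: "AE t in lborel. t \<in> {0..tmax} \<longrightarrow> ennreal \<bar>\<psi> t\<bar> \<le> ennreal Q"
    proof -
      have "AE t in restrict_space lborel {0..tmax}. ennreal \<bar>\<psi> t\<bar> \<le> Linf_norm (restrict_space lborel {0..tmax}) \<psi>"
        unfolding Linf_norm_def by (rule esssup_AE)
      moreover have "Linf_norm (restrict_space lborel {0..tmax}) \<psi> = ennreal Q"
        using psi by (simp add: test_function_def Q_def)
      ultimately show ?thesis by (simp add: AE_restrict_space_iff)
    qed
    \<comment> \<open>Reflection coefficients are measurable only on \<omega> > 0; the cut-off gives
      a Borel function on the whole line.\<close>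
    define \<delta> where "\<delta> \<omega> = ennreal \<bar>?i \<omega> * \<eta>1 \<omega> - ?i \<omega> * \<eta>2 \<omega>\<bar>" for \<omega>
    have [measurable]: "(\<lambda>\<omega>. ?i \<omega> * \<eta>1 \<omega>) \<in> borel_measurable borel" "(\<lambda>\<omega>. ?i \<omega> * \<eta>2 \<omega>) \<in> borel_measurable borel"
      using eta by (auto simp: reflection_coefficient_def borel_measurable_restrict_space_iff)
    have \<delta>_meas [measurable]: "\<delta> \<in> borel_measurable borel" unfolding \<delta>_def by measurable
    have \<delta>: "\<delta> \<omega> = ennreal \<bar>\<eta>1 \<omega> - \<eta>2 \<omega>\<bar>" if "0 < \<omega>" for \<omega> using that by (simp add: \<delta>_def)
    define N where "N = (\<integral>\<^sup>+\<omega>\<in>{0<..}. ennreal ((\<eta>1 \<omega> - \<eta>2 \<omega>)\<^sup>2) \<partial>lborel)"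
    define I where "I = (\<integral>\<^sup>+\<omega>. \<delta> \<omega> * v \<omega> * indicator {0<..} \<omega> \<partial>lborel)"
    have I_le: "I\<^sup>2 \<le> N * V"
    proof -
      have "I = (\<integral>\<^sup>+\<omega>. (\<delta> \<omega> * indicator {0<..} \<omega>) * (v \<omega> * indicator {0<..} \<omega>) \<partial>lborel)"
        unfolding I_def by (intro nn_integral_cong) (auto split: split_indicator)
      then have "I\<^sup>2 \<le> (\<integral>\<^sup>+\<omega>. (\<delta> \<omega> * indicator {0<..} \<omega>)\<^sup>2 \<partial>lborel) * (\<integral>\<^sup>+\<omega>. (v \<omega> * indicator {0<..} \<omega>)\<^sup>2 \<partial>lborel)"
        by (simp only:) (rule Cauchy_Schwarz_nn_integral, measurable)
      also have "(\<integral>\<^sup>+\<omega>. (\<delta> \<omega> * indicator {0<..} \<omega>)\<^sup>2 \<partial>lborel) = N"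
        unfolding N_def by (intro nn_integral_cong) (auto simp: \<delta> ennreal_power split: split_indicator)
      also have "(\<integral>\<^sup>+\<omega>. (v \<omega> * indicator {0<..} \<omega>)\<^sup>2 \<partial>lborel) = V"
        unfolding V_def by (intro nn_integral_cong) (auto split: split_indicator)
      finally show ?thesis .
    qed
    have b_fin: "b \<omega> < \<infinity>" for \<omega> by (simp add: b_def)
    let ?F = "\<lambda>\<omega>. frechet_M tmax g1 h1 \<omega> - frechet_M tmax g2 h2 \<omega>"
    let ?C = "B * (ennreal P * ennreal Q)"
    have F_le: "AE \<omega> in lborel. 0 < \<omega> \<longrightarrow> ennreal \<bar>?F \<omega>\<bar> \<le> ?C * I * v \<omega>"
      using frechet_M_lipschitz_pointwise[OF assms(1) b_meas W b_fin phi_le psi_le eta \<delta>_meas \<delta> g h]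
      unfolding I_def B_def v_def[abs_def] by simp
    have "(\<integral>\<^sup>+\<omega>\<in>{0<..}. ennreal ((?F \<omega>)\<^sup>2) \<partial>lborel) \<le> (\<integral>\<^sup>+\<omega>. (?C * I)\<^sup>2 * ((v \<omega>)\<^sup>2 * indicator {0<..} \<omega>) \<partial>lborel)"
    proof (rule nn_integral_mono_AE, use F_le in eventually_elim)
      case (elim \<omega>)
      show ?case
      proof (cases "0 < \<omega>")
        case True
        have "ennreal ((?F \<omega>)\<^sup>2) = (ennreal \<bar>?F \<omega>\<bar>)\<^sup>2" by (simp add: ennreal_power)
        also have "\<dots> \<le> (?C * I * v \<omega>)\<^sup>2" using elim True by (intro power_mono) auto
        finally show ?thesis using True by (simp add: power_mult_distrib)
      qed simp
    qed
    also have "\<dots> = (?C * I)\<^sup>2 * V" unfolding V_def by (rule nn_integral_cmult) measurable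
    \<comment> \<open>One factor \<open>V\<close> comes from Cauchy-Schwarz for \<open>I\<close>,
      the other from integrating v^2. Together they give V^2, so \<open>V\<close> itself enters the
      Lipschitz constant.\<close>
    also have "\<dots> \<le> (?C\<^sup>2 * (N * V)) * V"
      unfolding power_mult_distrib[of ?C I] by (intro mult_right_mono mult_left_mono I_le) auto
    also have "\<dots> = (B * V * (ennreal P * ennreal Q))\<^sup>2 * N"
      by (simp add: power_mult_distrib power2_eq_square mult_ac)
    also have "\<dots> \<le> ennreal ((L P Q)\<^sup>2) * N"
    proof (intro mult_right_mono)
      have "B * V < \<infinity>" using B_fin V_fin by (simp add: ennreal_mult_less_top)
      then have "B * V * (ennreal P * ennreal Q) = ennreal (enn2real (B * V) * (P * Q))"
        using PQ by (simp add: ennreal_mult)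
      also have "\<dots> \<le> ennreal (L P Q)" unfolding L_def by (intro ennreal_leI) simp
      finally have "(B * V * (ennreal P * ennreal Q))\<^sup>2 \<le> (ennreal (L P Q))\<^sup>2" by (rule power_mono) simp
      also have "\<dots> = ennreal ((L P Q)\<^sup>2)" using PQ by (intro ennreal_power) (simp add: L_def)
      finally show "(B * V * (ennreal P * ennreal Q))\<^sup>2 \<le> ennreal ((L P Q)\<^sup>2)" .
    qed simp
    finally have "(\<integral>\<^sup>+\<omega>\<in>{0<..}. ennreal ((?F \<omega>)\<^sup>2) \<partial>lborel) \<le> ennreal ((L P Q)\<^sup>2) * N" .
    moreover have "0 < L P Q" using PQ by (simp add: L_def add_nonneg_pos)
    ultimately show "L2_norm ?F \<le> ennreal (L (phi_norm tmax \<phi>) (psi_norm tmax \<psi>)) * L2_norm (\<lambda>\<omega>. \<eta>1 \<omega> - \<eta>2 \<omega>)"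
      unfolding N_def P_def Q_def by (rule L2_norm_le_by_square)
  qed
qed

end
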